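(* For all $k\ge1$ and $n\ge2$: (1) the multiplicity of $S^{k^{n-1}1}$ in $\rho_{n,k}$ is $1$; (2) $\rho_{n,k}\cong S^{k^{n-1}1}\oplus\tilde\rho_{n,k}$ as $\mathfrak S_{k(n-1)+1}$-modules; (3) $\tilde\rho_{n,k}=0$ if and only if $k\in\{1,2\}$.
   Context: All vector spaces are over $\mathbb C$. For $n\ge 2$, a Filippov $n$-algebra is a vector space $L$ with an $n$-linear map $[\cdot,\dots,\cdot]:L^n\to L$ satisfying $[x_1,\dots,x_n]=\mathrm{sgn}(\sigma)[x_{\sigma(1)},\dots,x_{\sigma(n)}]$ for all $\sigma\in\mathfrak S_n$, and $[[x_1,\dots,x_n],x_{n+1},\dots,x_{2n-1}]=\sum_{i=1}^n[x_1,\dots,x_{i-1},[x_i,x_{n+1},\dots,x_{2n-1}],x_{i+1},\dots,x_n]$. The free Filippov $n$-algebra on a set $X$ is generated by all $n$-ary bracketings of elements of $X$, subject only to relations following from $n$-linearity, antisymmetry and the generalized Jacobi identity. $\rho_{n,k}$ is the multilinear component of the free Filippov $n$-algebra on $[k(n-1)+1]$ (span of $n$-bracketed permutations), an $\mathfrak S_{k(n-1)+1}$-module by permuting letters. A bracketed permutation $[w_1,\dots,w_n]$ (each $w_i$ a single letter or a bracketed permutation) is a non-comb if either (i) for some $i\ne j$, both $w_i$ and $w_j$ have more than one letter, or (ii) some $w_i$ is a non-comb. $\tilde\rho_{n,k}$ is the submodule of $\rho_{n,k}$ spanned by non-combs. $S^\lambda$ is the Specht module indexed by $\lambda$; $k^{n-1}1$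 is the partition with $n-1$ parts equal to $k$ followed by a part $1$. The multiplicity of $S^\lambda$ in $V$ is the largest $c$ such that $c$ copies of $S^\lambda$ embed in $V$. *)

theory Defs
  imports
    "HOL-Algebra.AbelCoset"
    "HOL-Algebra.Sym_Groups"
    "HOL-Library.Poly_Mapping"
    "Jordan_Normal_Form.VS_Connect"
begin

section \<open>Complex vector spaces\<close>

text \<open>
  Vector spaces are records of type \<open>(complex, 'v) module\<close>, over the field \<open>class_ring\<close> of all
  complex numbers. The fields \<open>mult\<close> and \<open>one\<close>, which such a record inherits from rings, have no
  meaning here.
\<close>

abbreviation vspan :: "(complex, 'v) module \<Rightarrow> 'v set \<Rightarrow> 'v set"
  where "vspan \<equiv> LinearCombinations.module.span class_ring"

definition free_space :: "'b set \<Rightarrow> (complex, 'b \<Rightarrow>\<^sub>0 complex) module"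
  where "free_space B =
    \<lparr>carrier = {f. Poly_Mapping.keys f \<subseteq> B}, monoid.mult = (\<lambda>_ _. 0), one = 0, zero = 0, add = (+),
     smult = (\<lambda>c. Poly_Mapping.map ((*) c))\<rparr>"

abbreviation basis_vec :: "'b \<Rightarrow> 'b \<Rightarrow>\<^sub>0 complex"
  where "basis_vec b \<equiv> Poly_Mapping.single b 1"

text \<open>The linear extension of a map between bases.\<close>

definition push :: "('b \<Rightarrow> 'c) \<Rightarrow> ('b \<Rightarrow>\<^sub>0 complex) \<Rightarrow> ('c \<Rightarrow>\<^sub>0 complex)"
  where "push h f = (\<Sum>b\<in>Poly_Mapping.keys f. Poly_Mapping.single (h b) (Poly_Mapping.lookup f b))"

text \<open>
  The scalar multiple \<open>c \<odot> A\<close> of a coset \<open>A\<close> is the coset of \<open>c \<odot> a\<close> for any \<open>a \<in> A\<close>; the plain image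
  of \<open>A\<close> would be wrong for \<open>c = 0\<close>.
\<close>

definition quotient_space :: "(complex, 'v) module \<Rightarrow> 'v set \<Rightarrow> (complex, 'v set) module"
  where "quotient_space V W =
    \<lparr>carrier = a_rcosets\<^bsub>V\<^esub> W, monoid.mult = (\<lambda>_ _. W), one = W, zero = W, add = set_add V,
     smult = (\<lambda>c A. \<Union>a\<in>A. W +>\<^bsub>V\<^esub> (c \<odot>\<^bsub>V\<^esub> a))\<rparr>"


section \<open>Representations over the complex numbers\<close>

record ('g, 'v) rep =
  space :: "(complex, 'v) module"
  act :: "'g \<Rightarrow> 'v \<Rightarrow> 'v"

definition rep_hom :: "('g, 'm) monoid_scheme \<Rightarrow> ('g, 'v) rep \<Rightarrow> ('g, 'w) rep \<Rightarrow> ('v \<Rightarrow> 'w) set"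
  where "rep_hom G V W =
    {f \<in> LinearCombinations.module_hom class_ring (space V) (space W).
       \<forall>g\<in>carrier G. \<forall>v\<in>carrier (space V). f (act V g v) = act W g (f v)}"

definition rep_embeds :: "('g, 'm) monoid_scheme \<Rightarrow> ('g, 'v) rep \<Rightarrow> ('g, 'w) rep \<Rightarrow> bool"
  where "rep_embeds G V W \<longleftrightarrow> (\<exists>f\<in>rep_hom G V W. inj_on f (carrier (space V)))"

definition rep_iso :: "('g, 'm) monoid_scheme \<Rightarrow> ('g, 'v) rep \<Rightarrow> ('g, 'w) rep \<Rightarrow> bool"
  where "rep_iso G V W \<longleftrightarrow>
    (\<exists>f\<in>rep_hom G V W. bij_betw f (carrier (space V)) (carrier (space W)))"

definition rep_sum :: "('g, 'v) rep \<Rightarrow> ('g, 'w) rep \<Rightarrow> ('g, 'v \<times> 'w) rep"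
  where "rep_sum V W =
    \<lparr>space = direct_sum (space V) (space W), act = (\<lambda>g. map_prod (act V g) (act W g))\<rparr>"

definition rep_copies :: "nat \<Rightarrow> ('g, 'v) rep \<Rightarrow> ('g, nat \<Rightarrow> 'v) rep"
  where "rep_copies c V =
    \<lparr>space =
       \<lparr>carrier = {..<c} \<rightarrow>\<^sub>E carrier (space V),
        monoid.mult = (\<lambda>_ _. \<lambda>i\<in>{..<c}. \<zero>\<^bsub>space V\<^esub>),
        one = (\<lambda>i\<in>{..<c}. \<zero>\<^bsub>space V\<^esub>),
        zero = (\<lambda>i\<in>{..<c}. \<zero>\<^bsub>space V\<^esub>),
        add = (\<lambda>u v. \<lambda>i\<in>{..<c}. u i \<oplus>\<^bsub>space V\<^esub> v i),
        smult = (\<lambda>a v. \<lambda>i\<in>{..<c}. a \<odot>\<^bsub>space V\<^esub> v i)\<rparr>,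
     act = (\<lambda>g v. \<lambda>i\<in>{..<c}. act V g (v i))\<rparr>"

definition has_multiplicity ::
    "('g, 'm) monoid_scheme \<Rightarrow> ('g, 'v) rep \<Rightarrow> ('g, 'w) rep \<Rightarrow> nat \<Rightarrow> bool"
  where "has_multiplicity G S V c \<longleftrightarrow>
    rep_embeds G (rep_copies c S) V \<and> (\<forall>d. rep_embeds G (rep_copies d S) V \<longrightarrow> d \<le> c)"


section \<open>Specht modules\<close>

text \<open>
  A partition is a weakly decreasing list of positive parts. Rows and columns of its diagram are
  numbered from 0, the entries of a tableau from 1. Tableaux are arbitrary functions outside the
  diagram; only their values on the diagram are used. A tabloid is the list of the sets of
  entries of the rows.
\<close>

definition diagram :: "nat list \<Rightarrow> (nat \<times> nat) set"
  where "diagram lam = {(i, j). i < length lam \<and> j < lam ! i}"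

definition tableaux :: "nat list \<Rightarrow> (nat \<times> nat \<Rightarrow> nat) set"
  where "tableaux lam = {t. bij_betw t (diagram lam) {1..sum_list lam}}"

definition tabloid :: "nat list \<Rightarrow> (nat \<times> nat \<Rightarrow> nat) \<Rightarrow> nat set list"
  where "tabloid lam t = map (\<lambda>i. t ` {(i', j) \<in> diagram lam. i' = i}) [0..<length lam]"

definition column_stabilizer :: "nat list \<Rightarrow> (nat \<times> nat \<Rightarrow> nat) \<Rightarrow> (nat \<Rightarrow> nat) set"
  where "column_stabilizer lam t =
    {p \<in> carrier (sym_group (sum_list lam)).
       \<forall>j. p ` t ` {(i, j') \<in> diagram lam. j' = j} = t ` {(i, j') \<in> diagram lam. j' = j}}"

definition polytabloid :: "nat list \<Rightarrow> (nat \<times> nat \<Rightarrow> nat) \<Rightarrow> nat set list \<Rightarrow>\<^sub>0 complex"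
  where "polytabloid lam t =
    (\<Sum>p\<in>column_stabilizer lam t. Poly_Mapping.single (tabloid lam (p \<circ> t)) (of_int (sign p)))"

definition tabloid_rep :: "nat list \<Rightarrow> (nat \<Rightarrow> nat, nat set list \<Rightarrow>\<^sub>0 complex) rep"
  where "tabloid_rep lam =
    \<lparr>space = free_space (tabloid lam ` tableaux lam), act = (\<lambda>p. push (map (image p)))\<rparr>"

definition specht :: "nat list \<Rightarrow> (nat \<Rightarrow> nat, nat set list \<Rightarrow>\<^sub>0 complex) rep"
  where "specht lam = (let M = space (tabloid_rep lam) in
    (tabloid_rep lam)\<lparr>space := M\<lparr>carrier := vspan M (polytabloid lam ` tableaux lam)\<rparr>\<rparr>)"


section \<open>The free Filippov algebra\<close>

datatype 'a btree = Letter 'a | Br "'a btree list"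

inductive_set bracketings :: "nat \<Rightarrow> 'a set \<Rightarrow> 'a btree set" for n X where
  "x \<in> X \<Longrightarrow> Letter x \<in> bracketings n X"
| "length ts = n \<Longrightarrow> \<forall>t\<in>set ts. t \<in> bracketings n X \<Longrightarrow> Br ts \<in> bracketings n X"

primrec letters :: "'a btree \<Rightarrow> 'a list" where
  "letters (Letter x) = [x]"
| "letters (Br ts) = concat (map letters ts)"

text \<open>The multilinear extension of \<open>Br\<close> to formal linear combinations of bracketings.\<close>

definition bracket :: "('a btree \<Rightarrow>\<^sub>0 complex) list \<Rightarrow> 'a btree \<Rightarrow>\<^sub>0 complex"
  where "bracket fs =
    (\<Sum>ts\<in>listset (map Poly_Mapping.keys fs).
       Poly_Mapping.single (Br ts) (prod_list (map2 Poly_Mapping.lookup fs ts)))"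

text \<open>
  The ideal, in the free \<open>n\<close>-ary nonassociative algebra on \<open>X\<close>, generated by antisymmetry
  and the generalized Jacobi identity. \<open>n\<close>-linearity is already built into \<open>bracket\<close>.
\<close>

inductive_set filippov_ideal :: "nat \<Rightarrow> 'a set \<Rightarrow> ('a btree \<Rightarrow>\<^sub>0 complex) set" for n X where
  antisymmetry:
    "length xs = n \<Longrightarrow> set xs \<subseteq> carrier (free_space (bracketings n X)) \<Longrightarrow> p permutes {..<n} \<Longrightarrow>
     bracket xs - Poly_Mapping.map ((*) (of_int (sign p))) (bracket (permute_list p xs))
       \<in> filippov_ideal n X"
| jacobi:
    "length xs = n \<Longrightarrow> length ys = n - 1 \<Longrightarrow>
     set xs \<union> set ys \<subseteq> carrier (free_space (bracketings n X)) \<Longrightarrow>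
     bracket (bracket xs # ys) - (\<Sum>i<n. bracket (xs[i := bracket (xs ! i # ys)]))
       \<in> filippov_ideal n X"
| absorb:
    "r \<in> filippov_ideal n X \<Longrightarrow> length xs = n \<Longrightarrow> set xs \<subseteq> carrier (free_space (bracketings n X)) \<Longrightarrow>
     i < n \<Longrightarrow> bracket (xs[i := r]) \<in> filippov_ideal n X"
| zero: "0 \<in> filippov_ideal n X"
| add: "r \<in> filippov_ideal n X \<Longrightarrow> s \<in> filippov_ideal n X \<Longrightarrow> r + s \<in> filippov_ideal n X"
| smult: "r \<in> filippov_ideal n X \<Longrightarrow> Poly_Mapping.map ((*) c) r \<in> filippov_ideal n X"

definition free_filippov :: "nat \<Rightarrow> 'a set \<Rightarrow> (complex, ('a btree \<Rightarrow>\<^sub>0 complex) set) module"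
  where "free_filippov n X = quotient_space (free_space (bracketings n X)) (filippov_ideal n X)"

definition bracketing_class :: "nat \<Rightarrow> 'a set \<Rightarrow> 'a btree \<Rightarrow> ('a btree \<Rightarrow>\<^sub>0 complex) set"
  where "bracketing_class n X t = filippov_ideal n X +>\<^bsub>free_space (bracketings n X)\<^esub> basis_vec t"


section \<open>The multilinear component and its non-comb part\<close>

definition nletters :: "nat \<Rightarrow> nat \<Rightarrow> nat"
  where "nletters n k = k * (n - 1) + 1"

definition bracketed_permutations :: "nat \<Rightarrow> nat \<Rightarrow> nat btree set"
  where "bracketed_permutations n k =
    {t \<in> bracketings n {1..nletters n k}. distinct (letters t) \<and> set (letters t) = {1..nletters n k}}"

fun noncomb :: "'a btree \<Rightarrow> bool" where
  "noncomb (Letter x) = False"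
| "noncomb (Br ts) \<longleftrightarrow>
     (\<exists>i<length ts. \<exists>j<length ts. i \<noteq> j \<and> 1 < length (letters (ts ! i)) \<and> 1 < length (letters (ts ! j)))
     \<or> (\<exists>t\<in>set ts. noncomb t)"

text \<open>
  A permutation relabels letters. It acts on a coset elementwise; the image is again a coset,
  as the ideal is invariant under permutations of the set of letters.
\<close>

definition bracketing_span :: "nat \<Rightarrow> nat \<Rightarrow> nat btree set \<Rightarrow>
    (nat \<Rightarrow> nat, (nat btree \<Rightarrow>\<^sub>0 complex) set) rep"
  where "bracketing_span n k T = (let X = {1..nletters n k}; F = free_filippov n X in
    \<lparr>space = F\<lparr>carrier := vspan F (bracketing_class n X ` T)\<rparr>,
     act = (\<lambda>p. image (push (map_btree p)))\<rparr>)"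

definition rho :: "nat \<Rightarrow> nat \<Rightarrow> (nat \<Rightarrow> nat, (nat btree \<Rightarrow>\<^sub>0 complex) set) rep"
  where "rho n k = bracketing_span n k (bracketed_permutations n k)"

definition rho_noncomb :: "nat \<Rightarrow> nat \<Rightarrow> (nat \<Rightarrow> nat, (nat btree \<Rightarrow>\<^sub>0 complex) set) rep"
  where "rho_noncomb n k = bracketing_span n k {t \<in> bracketed_permutations n k. noncomb t}"

end

(* Membership in a subspace of formal combinations of bracketings is tested with linear functionals,
   so the proof works with the functionals L that vanish on the Filippov ideal.

   Modulo the ideal every bracketing is, up to sign, a comb or a non-comb. A tableau t of shape
   k^(n-1) 1 gives a comb whose blocks are the columns of t. A functional that also vanishes on
   non-combs satisfies on these combs the column antisymmetry and the Garnir relations: the Jacobi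
   identity turns it into an eigenvector of an odd graph, and the eigenvalue forces the Garnir
   relations. This gives a map psi from tabloids to combs.

   In the other direction, sending a letter to the unit vector of its row evaluates bracketings in the
   vector product algebra of dimension n + 1. A non-comb contains two disjoint brackets of letters
   only, and one of them avoids the single letter of the last row, so it has two letters in a common
   row. Hence a functional that is invariant under the row stabilizer vanishes on non-combs, and it is
   determined by one value. It follows that evaluation along all tabloids is a map phi which kills
   the non-combs and sends the comb of t to the polytabloid of t. The Young symmetrizer computation
   gives psi o phi = id modulo non-combs, hence the splitting; uniqueness of the row-invariant vector
   gives multiplicity one. For k >= 3 some non-comb has a nonzero vector product, and for k <= 2 the
   k (n - 1) + 1 letters do not suffice for a non-comb. *)

theory Submission
  imports Defs "HOL-Combinatorics.Permutations" "Jordan_Normal_Form.Determinant"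
begin

section \<open>Formal linear combinations and functionals\<close>

text \<open>Functionals suit the ideal because it is generated inductively: each relation becomes an
  equation between complex numbers, and fixing all but one slot of a bracket yields such a
  functional again, so inductions can run over subtrees. The main obstacle is the Garnir relations.
  For the first column and one other, Jacobi gives a single relation on the (n-1)-subsets of 2n-1
  letters. The disjointness graph of these subsets has the eigenvalues (-1)^i (n-i), and absolute
  value 1 occurs only for i = n-1, which after the twist by signs is the component of shape 2^(n-1)
  1. For two later columns, both of length n-1, the relation is derived indirectly, from those with
  the first column and from the commutation of blocks. The second obstacle is that the constant of
  the Young symmetrizer must be nonzero; it is built up cell by cell from positive factors. In the
  evaluation along rows, letters go to e_0, ..., e_(n-1) only; e_n arises as the value of a bracket,
  and adding blocks to a comb makes its value alternate between multiples of e_n and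
  e_(n-1).\<close>

abbreviation keys :: "('b \<Rightarrow>\<^sub>0 complex) \<Rightarrow> 'b set"
  where "keys \<equiv> Poly_Mapping.keys"

abbreviation lookup :: "('b \<Rightarrow>\<^sub>0 complex) \<Rightarrow> 'b \<Rightarrow> complex"
  where "lookup \<equiv> Poly_Mapping.lookup"

abbreviation scl :: "complex \<Rightarrow> ('b \<Rightarrow>\<^sub>0 complex) \<Rightarrow> 'b \<Rightarrow>\<^sub>0 complex"
  where "scl c \<equiv> Poly_Mapping.map ((*) c)"

lemma lookup_scl [simp]: "lookup (scl c f) b = c * lookup f b"
  by (simp add: Poly_Mapping.map.rep_eq when_def)

lemma keys_scl_subset: "keys (scl c f) \<subseteq> keys f"
  by (auto simp: in_keys_iff)

text \<open>Any function on basis elements gives a linear functional in this way, so functionals are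
  plain functions and their linearity never has to be assumed.\<close>

definition plin :: "('b \<Rightarrow> complex) \<Rightarrow> ('b \<Rightarrow>\<^sub>0 complex) \<Rightarrow> complex"
  where "plin L f = (\<Sum>b\<in>keys f. lookup f b * L b)"

lemma plin_superset: "finite B \<Longrightarrow> keys f \<subseteq> B \<Longrightarrow> plin L f = (\<Sum>b\<in>B. lookup f b * L b)"
  unfolding plin_def by (rule sum.mono_neutral_left) (auto simp: in_keys_iff)

lemma plin_zero [simp]: "plin L 0 = 0"
  by (simp add: plin_def)

lemma plin_single [simp]: "plin L (Poly_Mapping.single b c) = c * L b"
  by (subst plin_superset[of "{b}"]) auto

lemma plin_add: "plin L (f + g) = plin L f + plin L g"
  using Poly_Mapping.keys_add[of f g]
  by (simp add: plin_superset[of "keys f \<union> keys g"] lookup_add distrib_right sum.distrib)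

lemma plin_scl [simp]: "plin L (scl c f) = c * plin L f"
  using keys_scl_subset[of c f]
  by (simp add: plin_superset[of "keys f"] sum_distrib_left mult.assoc)

lemma plin_uminus: "plin L (- f) = - plin L f"
  using plin_add[of L f "- f"] by (simp add: eq_neg_iff_add_eq_0 add.commute)

lemma plin_diff: "plin L (f - g) = plin L f - plin L g"
  using plin_add[of L f "- g"] by (simp add: plin_uminus)

lemma plin_sum: "plin L (sum f A) = (\<Sum>a\<in>A. plin L (f a))"
  by (induction A rule: infinite_finite_induct) (auto simp: plin_add)

lemma plin_delta: "plin (\<lambda>x. of_bool (x = b)) f = lookup f b"
  by (subst plin_superset[of "insert b (keys f)"]) (auto simp: sum.remove[of _ b] in_keys_iff)

lemma plin_eqI: "(\<And>L. plin L f = plin L g) \<Longrightarrow> f = g"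
  by (intro poly_mapping_eqI) (metis plin_delta)

lemma plin_cong: "(\<And>b. b \<in> keys f \<Longrightarrow> L b = L' b) \<Longrightarrow> plin L f = plin L' f"
  unfolding plin_def by (rule sum.cong) auto

lemma plin_fun_add: "plin (\<lambda>b. L b + L' b) f = plin L f + plin L' f"
  by (simp add: plin_def distrib_left sum.distrib)

lemma plin_fun_mult: "plin (\<lambda>b. c * L b) f = c * plin L f"
  by (simp add: plin_def sum_distrib_left algebra_simps)

lemma plin_fun_sum: "plin (\<lambda>b. \<Sum>a\<in>A. L a b) f = (\<Sum>a\<in>A. plin (L a) f)"
  unfolding plin_def by (simp add: sum_distrib_left sum.swap[of _ A])

lemma plin_swap: "plin (\<lambda>s. plin (\<lambda>t. H s t) g) f = plin (\<lambda>t. plin (\<lambda>s. H s t) f) g"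
  unfolding plin_def sum_distrib_left by (subst sum.swap) (simp add: algebra_simps)

lemma plin_push: "plin L (push h f) = plin (\<lambda>b. L (h b)) f"
  unfolding push_def plin_sum by (simp add: plin_def[of _ f])

lemma keys_push: "keys (push h f) \<subseteq> h ` keys f"
  unfolding push_def
  by (rule order.trans[OF Poly_Mapping.keys_sum]) (auto split: if_splits)

lemma keys_sum_subset: "(\<And>a. a \<in> A \<Longrightarrow> keys (f a) \<subseteq> B) \<Longrightarrow> keys (sum f A) \<subseteq> B"
  using Poly_Mapping.keys_sum[of f A] by blast

text \<open>\<open>push\<close> sends basis elements to basis elements; here they go to arbitrary
  combinations.\<close>

definition pext :: "('b \<Rightarrow> 'c \<Rightarrow>\<^sub>0 complex) \<Rightarrow> ('b \<Rightarrow>\<^sub>0 complex) \<Rightarrow> 'c \<Rightarrow>\<^sub>0 complex"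
  where "pext F x = (\<Sum>b\<in>keys x. scl (lookup x b) (F b))"

lemma plin_pext: "plin L (pext F x) = plin (\<lambda>b. plin L (F b)) x"
  unfolding pext_def plin_sum by (simp add: plin_def[of _ x])

lemma pext_add: "pext F (x + y) = pext F x + pext F y"
  by (rule plin_eqI) (simp add: plin_pext plin_add)

lemma pext_scl: "pext F (scl c x) = scl c (pext F x)"
  by (rule plin_eqI) (simp add: plin_pext)

lemma pext_zero [simp]: "pext F 0 = 0"
  by (simp add: pext_def)

lemma pext_single [simp]: "pext F (Poly_Mapping.single b c) = scl c (F b)"
  by (rule plin_eqI) (simp add: plin_pext)

lemma pext_diff: "pext F (x - y) = pext F x - pext F y"
  by (rule plin_eqI) (simp add: plin_pext plin_diff)

lemma keys_pext: "(\<And>b. b \<in> keys x \<Longrightarrow> keys (F b) \<subseteq> B) \<Longrightarrow> keys (pext F x) \<subseteq> B"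
  unfolding pext_def by (rule keys_sum_subset) (blast dest: keys_scl_subset[THEN subsetD])

section \<open>Subspaces, and separation of points from subspaces by functionals\<close>

definition pm_subspace :: "('b \<Rightarrow>\<^sub>0 complex) set \<Rightarrow> bool"
  where "pm_subspace W \<longleftrightarrow> 0 \<in> W \<and> (\<forall>x\<in>W. \<forall>y\<in>W. x + y \<in> W) \<and> (\<forall>c. \<forall>x\<in>W. scl c x \<in> W)"

lemma pm_subspaceD:
  assumes "pm_subspace W"
  shows "0 \<in> W" "x \<in> W \<Longrightarrow> y \<in> W \<Longrightarrow> x + y \<in> W" "x \<in> W \<Longrightarrow> scl c x \<in> W"
    "x \<in> W \<Longrightarrow> - x \<in> W" "x \<in> W \<Longrightarrow> y \<in> W \<Longrightarrow> x - y \<in> W"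
proof -
  show 1: "0 \<in> W" "\<And>x y. x \<in> W \<Longrightarrow> y \<in> W \<Longrightarrow> x + y \<in> W" "\<And>c x. x \<in> W \<Longrightarrow> scl c x \<in> W"
    using assms by (auto simp: pm_subspace_def)
  have eq: "- x = scl (-1) x" for x :: "'a \<Rightarrow>\<^sub>0 complex"
    by (rule poly_mapping_eqI) simp
  show 2: "- x \<in> W" if "x \<in> W" for x
    unfolding eq using that by (rule 1)
  show "x - y \<in> W" if "x \<in> W" "y \<in> W" for x y
    using 1(2)[OF that(1) 2[OF that(2)]] by simp
qed

lemma pm_subspace_sum: "pm_subspace W \<Longrightarrow> (\<And>a. a \<in> A \<Longrightarrow> f a \<in> W) \<Longrightarrow> sum f A \<in> W"
  by (induction A rule: infinite_finite_induct) (auto simp: pm_subspaceD)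

lemma pm_subspace_pext:
  "pm_subspace W \<Longrightarrow> (\<And>b. b \<in> keys x \<Longrightarrow> F b \<in> W) \<Longrightarrow> pext F x \<in> W"
  unfolding pext_def by (rule pm_subspace_sum) (auto simp: pm_subspaceD)

lemma pext_basis_vec: "pext basis_vec x = x"
  by (rule plin_eqI) (simp add: plin_pext)

text \<open>Makes spans, independence and extension of linear maps available on the whole type of
  formal combinations.\<close>

interpretation pm: vector_space "scl :: complex \<Rightarrow> ('b \<Rightarrow>\<^sub>0 complex) \<Rightarrow> _"
  by unfold_locales (auto intro!: poly_mapping_eqI simp: lookup_add algebra_simps)

definition kills :: "('b \<Rightarrow> complex) \<Rightarrow> ('b \<Rightarrow>\<^sub>0 complex) set \<Rightarrow> bool"
  where "kills L W \<longleftrightarrow> (\<forall>w\<in>W. plin L w = 0)"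

lemma killsD: "kills L W \<Longrightarrow> w \<in> W \<Longrightarrow> plin L w = 0"
  by (simp add: kills_def)

text \<open>A basis of \<open>W\<close> stays independent when \<open>x\<close> is added, so some
  linear functional is 1 at \<open>x\<close> and 0 on \<open>W\<close>. This reduces membership in
  the ideal to numerical identities.\<close>

lemma separation:
  assumes W: "pm_subspace W" and L: "\<And>L. kills L W \<Longrightarrow> plin L x = 0"
  shows "x \<in> W"
proof (rule ccontr)
  assume x: "x \<notin> W"
  have sub: "pm.subspace W"
    using W by (auto simp: pm.subspace_def pm_subspace_def)
  obtain B where B: "B \<subseteq> W" "pm.independent B" "W \<subseteq> pm.span B"
    by (rule pm.maximal_independent_subset)
  have span: "pm.span B = W"
    using B sub by (metis pm.span_minimal subset_antisym)
  have ind: "pm.independent (insert x B)"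
    using B x span by (simp add: pm.independent_insert)
  interpret vp: vector_space_pair "scl :: complex \<Rightarrow> ('a \<Rightarrow>\<^sub>0 complex) \<Rightarrow> _" "(*) :: complex \<Rightarrow> complex \<Rightarrow> complex"
    by unfold_locales (auto simp: algebra_simps)
  obtain g where g: "Vector_Spaces.linear scl (*) g" "\<forall>b\<in>insert x B. g b = (if b = x then 1 else 0)"
    using vp.linear_independent_extend[OF ind, of "\<lambda>b. if b = x then 1 else 0"] by blast
  interpret g: Vector_Spaces.linear scl "(*)" g
    by (rule g(1))
  \<comment> \<open>A linear functional is \<open>plin\<close> of its values on basis vectors, the
    form over which the hypothesis quantifies.\<close>
  have gp: "g y = plin (\<lambda>b. g (basis_vec b)) y" for y
  proof -
    have "g y = g (pext basis_vec y)" by (simp add: pext_basis_vec)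
    also have "\<dots> = plin (\<lambda>b. g (basis_vec b)) y"
      unfolding pext_def plin_def g.sum g.scale by (rule refl)
    finally show ?thesis .
  qed
  have "g w = 0" if "w \<in> W" for w
  proof -
    have "w \<in> pm.span B" using that span by simp
    then show ?thesis
    proof (rule pm.span_induct_alt)
      show "g 0 = 0" by (rule g.zero)
    next
      fix c b y assume "b \<in> B" "g y = 0"
      moreover have "b \<noteq> x" using \<open>b \<in> B\<close> B(1) x by auto
      ultimately show "g (scl c b + y) = 0"
        using g(2) by (simp add: g.add g.scale)
    qed
  qed
  then have "kills (\<lambda>b. g (basis_vec b)) W"
    by (simp add: kills_def gp[symmetric])
  then have "plin (\<lambda>b. g (basis_vec b)) x = 0" by (rule L)
  then show False using g(2) by (simp add: gp[symmetric])
qed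

section \<open>Multilinear extension\<close>

primrec mlin :: "('b list \<Rightarrow> complex) \<Rightarrow> ('b \<Rightarrow>\<^sub>0 complex) list \<Rightarrow> complex" where
  "mlin G [] = G []"
| "mlin G (f # fs) = plin (\<lambda>t. mlin (\<lambda>ts. G (t # ts)) fs) f"

text \<open>The left side is what \<open>bracket\<close> produces, a sum over all lists of basis
  elements; the right side applies \<open>plin\<close> slot by slot and so admits induction over the
  slots.\<close>

lemma sum_listset:
  "(\<Sum>ts\<in>listset (map keys fs). prod_list (map2 lookup fs ts) * G ts) = mlin G fs"
proof (induction fs arbitrary: G)
  case Nil then show ?case by simp
next
  case (Cons f fs)
  let ?S = "listset (map keys fs)"
  have eq: "listset (map keys (f # fs)) = (\<lambda>(t, ts). t # ts) ` (keys f \<times> ?S)"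
    by (auto simp: set_Cons_def)
  have "(\<Sum>ts\<in>listset (map keys (f # fs)). prod_list (map2 lookup (f # fs) ts) * G ts)
      = (\<Sum>(t, ts)\<in>keys f \<times> ?S. lookup f t * (prod_list (map2 lookup fs ts) * G (t # ts)))"
    unfolding eq by (subst sum.reindex) (auto simp: inj_on_def intro!: sum.cong)
  also have "\<dots> = (\<Sum>t\<in>keys f. lookup f t * (\<Sum>ts\<in>?S. prod_list (map2 lookup fs ts) * G (t # ts)))"
    by (simp add: sum.cartesian_product[symmetric] sum_distrib_left)
  also have "\<dots> = mlin G (f # fs)"
    by (simp add: Cons.IH plin_def)
  finally show ?case .
qed

lemma plin_bracket: "plin L (bracket fs) = mlin (\<lambda>ts. L (Br ts)) fs"
  unfolding bracket_def plin_sum sum_listset[symmetric] by simp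

lemma mlin_basis: "mlin G (map basis_vec ts) = G ts"
  by (induction ts arbitrary: G) auto

lemma mlin_push: "mlin G (map (push h) fs) = mlin (\<lambda>ts. G (map h ts)) fs"
  by (induction fs arbitrary: G) (auto simp: plin_push)

text \<open>Finite sums commute, so any slot may be treated as the outermost one.\<close>

lemma mlin_slot: "mlin G (fs @ f # gs) = plin (\<lambda>t. mlin G (fs @ basis_vec t # gs)) f"
proof (induction fs arbitrary: G)
  case Nil
  show ?case by simp
next
  case (Cons a fs)
  show ?case by (simp only: append_Cons mlin.simps Cons.IH) (rule plin_swap)
qed

lemma mlin_slot_basis:
  "mlin G (map basis_vec as @ f # map basis_vec bs) = plin (\<lambda>t. G (as @ t # bs)) f"
proof -
  have "mlin G (map basis_vec as @ basis_vec t # map basis_vec bs) = G (as @ t # bs)" for t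
    using mlin_basis[of G "as @ t # bs"] by simp
  then show ?thesis by (subst mlin_slot) simp
qed

lemma bracket_basis: "bracket (map basis_vec ts) = basis_vec (Br ts)"
  by (rule plin_eqI) (simp add: plin_bracket mlin_basis)

lemma push_bracket: "push (map_btree p) (bracket fs) = bracket (map (push (map_btree p)) fs)"
  by (rule plin_eqI) (simp add: plin_bracket plin_push mlin_push)

section \<open>The Filippov ideal and its functionals\<close>

abbreviation fil_funct :: "nat \<Rightarrow> 'a set \<Rightarrow> ('a btree \<Rightarrow> complex) \<Rightarrow> bool"
  where "fil_funct n X L \<equiv> kills L (filippov_ideal n X)"

lemma carrier_free_space: "carrier (free_space B) = {f. keys f \<subseteq> B}"
  by (simp add: free_space_def)

lemma pm_subspace_ideal: "pm_subspace (filippov_ideal n X)"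
  unfolding pm_subspace_def
  by (auto intro: filippov_ideal.zero filippov_ideal.add filippov_ideal.smult)

text \<open>The absorption rule with basis vectors in the other slots. It lets a statement about a
  subtree be applied inside a larger bracket.\<close>

lemma fil_funct_context:
  assumes L: "fil_funct n X L" and len: "length as + length bs + 1 = n"
    and sub: "set as \<subseteq> bracketings n X" "set bs \<subseteq> bracketings n X"
  shows "fil_funct n X (\<lambda>t. L (Br (as @ t # bs)))"
  unfolding kills_def
proof
  fix r assume r: "r \<in> filippov_ideal n X"
  \<comment> \<open>The entry 0 is a placeholder for the slot that receives
    \<open>r\<close>.\<close>
  let ?xs = "map basis_vec as @ 0 # map basis_vec bs"
  have "bracket (?xs[length as := r]) \<in> filippov_ideal n X"
    using r len sub by (intro filippov_ideal.absorb) (auto simp: carrier_free_space)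
  then have "bracket (map basis_vec as @ r # map basis_vec bs) \<in> filippov_ideal n X"
    by (simp add: list_update_append)
  from killsD[OF L this] show "plin (\<lambda>t. L (Br (as @ t # bs))) r = 0"
    by (simp add: plin_bracket mlin_slot_basis)
qed

lemma fil_funct_permute:
  assumes L: "fil_funct n X L" and len: "length ts = n" and sub: "set ts \<subseteq> bracketings n X"
    and p: "p permutes {..<n}"
  shows "L (Br ts) = of_int (sign p) * L (Br (permute_list p ts))"
proof -
  have "bracket (map basis_vec ts) - scl (of_int (sign p)) (bracket (permute_list p (map basis_vec ts))) \<in> filippov_ideal n X"
    using len sub p by (intro filippov_ideal.antisymmetry) (auto simp: carrier_free_space)
  moreover have "permute_list p (map basis_vec ts) = map basis_vec (permute_list p ts)"
    using len p by (simp add: permute_list_map)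
  ultimately have "plin L (basis_vec (Br ts) - scl (of_int (sign p)) (basis_vec (Br (permute_list p ts)))) = 0"
    using killsD[OF L] by (simp only: bracket_basis)
  then show ?thesis by (simp add: plin_diff del: Poly_Mapping.map_single)
qed

lemma fil_funct_swap:
  assumes L: "fil_funct n X L" and len: "length ts = n" and sub: "set ts \<subseteq> bracketings n X"
    and ij: "i < n" "j < n" "i \<noteq> j"
  shows "L (Br (ts[i := ts ! j, j := ts ! i])) = - L (Br ts)"
proof -
  have p: "Transposition.transpose i j permutes {..<n}"
    using ij by (intro permutes_swap_id) auto
  have "permute_list (Transposition.transpose i j) ts = ts[i := ts ! j, j := ts ! i]"
    using ij len by (intro nth_equalityI) (auto simp: permute_list_nth[OF p[folded len]] nth_list_update Transposition.transpose_def)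
  then show ?thesis
    using fil_funct_permute[OF L len sub p] ij by (simp add: sign_swap_id)
qed

lemma fil_funct_adj:
  assumes L: "fil_funct n X L" and "length (as @ x # y # bs) = n" "set (as @ x # y # bs) \<subseteq> bracketings n X"
  shows "L (Br (as @ y # x # bs)) = - L (Br (as @ x # y # bs))"
proof -
  have "(as @ x # y # bs)[length as := (as @ x # y # bs) ! Suc (length as), Suc (length as) := (as @ x # y # bs) ! length as]
      = as @ y # x # bs"
    by (simp add: nth_append list_update_append)
  then show ?thesis
    using fil_funct_swap[OF assms, of "length as" "Suc (length as)"] assms(2) by simp
qed

text \<open>One sign for each entry passed. It moves the nested bracket between the last slot, where
  \<open>comb\<close> keeps it, and the first slot, where the Jacobi identity expects it.\<close>

lemma fil_funct_to_end:
  assumes L: "fil_funct n X L" and "length (as @ x # bs) = n" "set (as @ x # bs) \<subseteq> bracketings n X"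
  shows "L (Br (as @ bs @ [x])) = (-1) ^ length bs * L (Br (as @ x # bs))"
  using assms(2,3)
proof (induction bs arbitrary: as)
  case (Cons b bs)
  have "L (Br ((as @ [b]) @ bs @ [x])) = (-1) ^ length bs * L (Br ((as @ [b]) @ x # bs))"
    using Cons.prems by (intro Cons.IH) auto
  also have "L (Br ((as @ [b]) @ x # bs)) = - L (Br (as @ x # b # bs))"
    using fil_funct_adj[OF L, of as x b bs] Cons.prems by simp
  finally show ?case by simp
qed simp

lemma fil_funct_jacobi:
  assumes L: "fil_funct n X L" and len: "length xs = n" "length ys = n - 1" and n: "n > 0"
    and sub: "set xs \<subseteq> bracketings n X" "set ys \<subseteq> bracketings n X"
  shows "L (Br (Br xs # ys)) = (\<Sum>i<n. L (Br (xs[i := Br (xs ! i # ys)])))"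
proof -
  let ?b = "map basis_vec"
  have "bracket (bracket (?b xs) # ?b ys) - (\<Sum>i<n. bracket ((?b xs)[i := bracket (?b xs ! i # ?b ys)])) \<in> filippov_ideal n X"
    using len sub by (intro filippov_ideal.jacobi) (auto simp: carrier_free_space)
  moreover have "bracket ((?b xs)[i := bracket (?b xs ! i # ?b ys)]) = basis_vec (Br (xs[i := Br (xs ! i # ys)]))" if "i < n" for i
  proof -
    have "?b xs ! i # ?b ys = ?b (xs ! i # ys)" using that len by simp
    moreover have "(?b xs)[i := basis_vec t] = ?b (xs[i := t])" for t by (simp add: map_update)
    ultimately show ?thesis by (simp only: bracket_basis)
  qed
  moreover have "bracket (bracket (?b xs) # ?b ys) = basis_vec (Br (Br xs # ys))"
    using bracket_basis[of "Br xs # ys"] by (simp add: bracket_basis)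
  ultimately have "basis_vec (Br (Br xs # ys)) - (\<Sum>i<n. basis_vec (Br (xs[i := Br (xs ! i # ys)]))) \<in> filippov_ideal n X"
    by simp
  from killsD[OF L this] show ?thesis by (simp add: plin_diff plin_sum)
qed

lemma bracketings_map_btree:
  assumes "t \<in> bracketings n X" "p ` X \<subseteq> Y"
  shows "map_btree p t \<in> bracketings n Y"
  using assms(1) by induction (use assms(2) in \<open>auto intro!: bracketings.intros\<close>)

text \<open>Since \<open>push\<close> commutes with \<open>bracket\<close>, every generator goes to
  a generator of the same kind.\<close>

lemma push_ideal:
  assumes "r \<in> filippov_ideal n X" and p: "p ` X \<subseteq> X"
  shows "push (map_btree p) r \<in> filippov_ideal n X"
proof -
  let ?h = "push (map_btree p)"
  have car: "?h f \<in> carrier (free_space (bracketings n X))" if "f \<in> carrier (free_space (bracketings n X))" for f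
    using that keys_push[of "map_btree p" f] bracketings_map_btree[OF _ p, of _ n]
    by (fastforce simp: carrier_free_space)
  have h: "?h (f + g) = ?h f + ?h g" "?h (f - g) = ?h f - ?h g" "?h (scl c f) = scl c (?h f)" "?h 0 = 0"
    "?h (sum F A) = (\<Sum>a\<in>A. ?h (F a))" for f g c and F :: "nat \<Rightarrow> _" and A
    by (rule plin_eqI; simp add: plin_push plin_add plin_diff plin_sum)+
  from assms(1) show ?thesis
  proof induction
    case (antisymmetry xs q)
    have "bracket (map ?h xs) - scl (of_int (sign q)) (bracket (permute_list q (map ?h xs))) \<in> filippov_ideal n X"
      using antisymmetry car by (intro filippov_ideal.antisymmetry) auto
    then show ?case using antisymmetry by (simp add: h push_bracket permute_list_map)
  next
    case (jacobi xs ys)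
    have "bracket (bracket (map ?h xs) # map ?h ys) - (\<Sum>i<n. bracket ((map ?h xs)[i := bracket (map ?h xs ! i # map ?h ys)])) \<in> filippov_ideal n X"
      using jacobi car by (intro filippov_ideal.jacobi) auto
    then show ?case using jacobi by (simp add: h push_bracket map_update)
  next
    case (absorb r xs i)
    have "bracket ((map ?h xs)[i := ?h r]) \<in> filippov_ideal n X"
      using absorb car by (intro filippov_ideal.absorb) auto
    then show ?case by (simp add: push_bracket map_update)
  qed (auto simp: h intro: filippov_ideal.zero filippov_ideal.add filippov_ideal.smult)
qed

lemma fil_funct_relabel:
  assumes "fil_funct n X L" "p ` X \<subseteq> X"
  shows "fil_funct n X (\<lambda>t. L (map_btree p t))"
  unfolding kills_def
proof
  fix w assume "w \<in> filippov_ideal n X"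
  from killsD[OF assms(1) push_ideal[OF this assms(2)]]
  show "plin (\<lambda>t. L (map_btree p t)) w = 0" by (simp add: plin_push)
qed

section \<open>Bracketings and combs\<close>

lemma concat_letters_Letter [simp]: "concat (map (letters \<circ> Letter) xs) = xs"
  by (induction xs) auto

lemma set_btree_letters: "set_btree t = set (letters t)"
  by (induction t) auto

lemma letters_map_btree: "letters (map_btree f t) = map f (letters t)"
  by (induction t) (auto simp: map_concat intro!: arg_cong[of _ _ concat])

lemma map_btree_fix: "(\<And>a. a \<in> set (letters t) \<Longrightarrow> f a = a) \<Longrightarrow> map_btree f t = t"
  by (rule btree.map_ident_strong) (simp add: set_btree_letters)

lemma bracketings_Br_iff:
  "Br ts \<in> bracketings n X \<longleftrightarrow> length ts = n \<and> set ts \<subseteq> bracketings n X"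
  by (auto elim: bracketings.cases intro: bracketings.intros)

lemma bracketings_Letter_iff [simp]: "Letter x \<in> bracketings n X \<longleftrightarrow> x \<in> X"
  by (auto elim: bracketings.cases intro: bracketings.intros)

lemma Letter_image_bracketings [simp]: "Letter ` A \<subseteq> bracketings n X \<longleftrightarrow> A \<subseteq> X"
  by auto

lemma length_letters_pos: "t \<in> bracketings n X \<Longrightarrow> n > 0 \<Longrightarrow> length (letters t) \<ge> 1"
proof (induction rule: bracketings.induct)
  case (2 ts)
  then obtain t where "t \<in> set ts" by (cases ts) auto
  with 2 have "letters t \<noteq> []" by auto
  with \<open>t \<in> set ts\<close> have "concat (map letters ts) \<noteq> []" by auto
  then show ?case by (simp add: Suc_le_eq)
qed simp

lemma sum_list_ge_length: "(\<And>x. x \<in> set xs \<Longrightarrow> 1 \<le> (f x :: nat)) \<Longrightarrow> length xs \<le> sum_list (map f xs)"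
  by (induction xs) fastforce+

lemma length_letters_Br:
  assumes "Br ts \<in> bracketings n X" "n \<ge> 2"
  shows "1 < length (letters (Br ts))"
proof -
  have "n \<le> sum_list (map (length \<circ> letters) ts)"
    using assms length_letters_pos[of _ n X]
    by (auto simp: bracketings_Br_iff subset_iff intro!: sum_list_ge_length)
  then show ?thesis using assms(2) by (simp add: length_concat comp_def)
qed

lemma distinct_letters_disjoint:
  assumes "distinct (letters (Br ts))" "i < length ts" "j < length ts" "i \<noteq> j"
  shows "set (letters (ts ! i)) \<inter> set (letters (ts ! j)) = {}"
proof -
  have *: "set (letters (ts ! i)) \<inter> set (letters (ts ! j)) = {}" if "i < j" "j < length ts" for i j
  proof -
    have "ts = take j ts @ ts ! j # drop (Suc j) ts" using that by (simp add: id_take_nth_drop)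
    then have "letters (Br ts) = concat (map letters (take j ts)) @ letters (ts ! j) @ concat (map letters (drop (Suc j) ts))"
      by (metis concat.simps(2) concat_append letters.simps(2) list.simps(9) map_append)
    then have "set (concat (map letters (take j ts))) \<inter> set (letters (ts ! j)) = {}"
      using assms(1) by auto
    moreover have "ts ! i \<in> set (take j ts)" using that by (auto simp: in_set_conv_nth intro!: exI[of _ i])
    ultimately show ?thesis by auto
  qed
  show ?thesis using *[of i j] *[of j i] assms by (cases "i < j") (auto simp: Int_commute)
qed

lemma distinct_letters_child:
  "distinct (letters (Br ts)) \<Longrightarrow> t \<in> set ts \<Longrightarrow> distinct (letters t)"
  by (auto simp: distinct_concat_iff)

subsection \<open>Sibling letters\<close>

inductive sib :: "'a \<Rightarrow> 'a \<Rightarrow> 'a btree \<Rightarrow> bool" for a b where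
  here: "Letter a \<in> set ts \<Longrightarrow> Letter b \<in> set ts \<Longrightarrow> sib a b (Br ts)"
| below: "t \<in> set ts \<Longrightarrow> sib a b t \<Longrightarrow> sib a b (Br ts)"

lemma sib_letters: "sib a b t \<Longrightarrow> a \<in> set (letters t) \<and> b \<in> set (letters t)"
  by (induction rule: sib.induct) (auto intro: bexI[of _ "Letter _"])

text \<open>All letters are distinct, so transposing two entries of one bracket leaves every other
  subtree fixed and amounts to swapping two arguments there; the brackets around it are a
  context.\<close>

lemma sib_antisym:
  assumes "sib a b t" "fil_funct n X L" "t \<in> bracketings n X" "distinct (letters t)" "a \<noteq> b"
  shows "L (map_btree (Transposition.transpose a b) t) = - L t"
  using assms
proof (induction arbitrary: L rule: sib.induct)
  case (here ts)
  let ?p = "Transposition.transpose a b"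
  obtain i j where ij: "i < length ts" "ts ! i = Letter a" "j < length ts" "ts ! j = Letter b"
    using here by (metis in_set_conv_nth)
  have "i \<noteq> j" using ij here by auto
  have "map (map_btree ?p) ts = ts[i := ts ! j, j := ts ! i]"
  proof (rule nth_equalityI)
    fix l assume l: "l < length (map (map_btree ?p) ts)"
    show "map (map_btree ?p) ts ! l = ts[i := ts ! j, j := ts ! i] ! l"
    proof (cases "l = i \<or> l = j")
      case True
      then show ?thesis using ij l \<open>i \<noteq> j\<close> by auto
    next
      case False
      then have "a \<notin> set (letters (ts ! l))" "b \<notin> set (letters (ts ! l))"
        using distinct_letters_disjoint[OF here(5), of l i] distinct_letters_disjoint[OF here(5), of l j] ij l by auto
      then have "map_btree ?p (ts ! l) = ts ! l"
        by (intro map_btree_fix) (metis transpose_apply_other)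
      then show ?thesis using False l by simp
    qed
  qed simp
  then show ?case
    using fil_funct_swap[OF here(3), of ts i j] here(4) ij \<open>i \<noteq> j\<close> by (simp add: bracketings_Br_iff)
next
  case (below t ts)
  let ?p = "Transposition.transpose a b"
  obtain as bs where ts: "ts = as @ t # bs" using below by (meson split_list)
  have dj: "set (letters u) \<inter> set (letters t) = {}" if "u \<in> set as \<union> set bs" for u
    using below(6) that unfolding ts by auto
  have fixed: "map_btree ?p u = u" if "u \<in> set as \<union> set bs" for u
    using dj[OF that] sib_letters[OF below(2)]
    by (intro map_btree_fix) (metis disjoint_iff transpose_apply_other)
  have "L (map_btree ?p (Br ts)) = L (Br (as @ map_btree ?p t # bs))"
    using fixed by (simp add: ts map_idI)
  also have "\<dots> = - L (Br (as @ t # bs))"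
    using below(4-7) ts distinct_letters_child[OF below(6), of t]
    by (intro below(3)[of "\<lambda>t. L (Br (as @ t # bs))"] fil_funct_context) (auto simp: bracketings_Br_iff)
  finally show ?case by (simp add: ts)
qed

text \<open>The word is used as for rooted trees: an innermost bracket, all of whose entries are
  leaves.\<close>

inductive cherry :: "'a list \<Rightarrow> 'a btree \<Rightarrow> bool" for ls where
  here: "cherry ls (Br (map Letter ls))"
| below: "t \<in> set ts \<Longrightarrow> cherry ls t \<Longrightarrow> cherry ls (Br ts)"

lemma cherry_sib: "cherry ls t \<Longrightarrow> a \<in> set ls \<Longrightarrow> b \<in> set ls \<Longrightarrow> sib a b t"
  by (induction rule: cherry.induct) (auto intro: sib.intros)

lemma cherry_letters:
  assumes "cherry ls t" "t \<in> bracketings n X" "distinct (letters t)"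
  shows "set ls \<subseteq> set (letters t) \<and> length ls = n \<and> distinct ls"
  using assms
proof induction
  case here
  then show ?case by (auto simp: bracketings_Br_iff)
next
  case (below t ts)
  then show ?case using distinct_letters_child[OF below(5,1)] by (auto simp: bracketings_Br_iff)
qed

lemma cherry_exists: "t \<in> bracketings n X \<Longrightarrow> t = Br ts \<Longrightarrow> \<exists>ls. cherry ls t"
proof (induction arbitrary: ts rule: bracketings.induct)
  case (2 us)
  show ?case
  proof (cases "\<forall>u\<in>set us. \<exists>x. u = Letter x")
    case True
    then obtain g where "\<forall>u\<in>set us. u = Letter (g u)" by metis
    then have "us = map Letter (map g us)" by (simp add: map_idI)
    then show ?thesis by (metis cherry.here)
  next
    case False
    then obtain u vs where "u \<in> set us" "u = Br vs" by (metis btree.exhaust)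
    then show ?thesis using 2 by (blast intro: cherry.below)
  qed
qed simp

text \<open>Each of the two nested siblings contains an innermost bracket, and the siblings have no
  letter in common.\<close>

lemma noncomb_cherries:
  assumes "noncomb t" "t \<in> bracketings n X" "distinct (letters t)"
  shows "\<exists>ls ls'. cherry ls t \<and> cherry ls' t \<and> set ls \<inter> set ls' = {}"
  using assms
proof (induction t)
  case (Br ts)
  have len: "1 < length (letters u) \<Longrightarrow> \<exists>us. u = Br us" for u :: "'a btree" by (cases u) auto
  from Br.prems(1) consider (two) i j where "i < length ts" "j < length ts" "i \<noteq> j"
      "1 < length (letters (ts ! i))" "1 < length (letters (ts ! j))"
    | (sub) u where "u \<in> set ts" "noncomb u" by auto
  then show ?case
  proof cases
    case two
    have br: "ts ! i \<in> bracketings n X" "ts ! j \<in> bracketings n X"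
      using Br.prems(2) two by (auto simp: bracketings_Br_iff subset_iff)
    obtain ls ls' where ls: "cherry ls (ts ! i)" "cherry ls' (ts ! j)"
      using len two br cherry_exists by metis
    have ds: "distinct (letters (ts ! i))" "distinct (letters (ts ! j))"
      using distinct_letters_child[OF Br.prems(3)] two by auto
    have "set ls \<inter> set ls' = {}"
      using cherry_letters[OF ls(1) br(1) ds(1)] cherry_letters[OF ls(2) br(2) ds(2)]
        distinct_letters_disjoint[OF Br.prems(3) two(1,2,3)] by blast
    moreover have "cherry ls (Br ts)" "cherry ls' (Br ts)"
      using ls two by (auto intro: cherry.below[OF nth_mem])
    ultimately show ?thesis by blast
  next
    case sub
    then show ?thesis using Br.IH[OF sub] Br.prems(2,3) distinct_letters_child[OF Br.prems(3)]
      by (auto simp: bracketings_Br_iff subset_iff intro: cherry.below; blast intro: cherry.below)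
  qed
qed simp

text \<open>Of two disjoint all-letter brackets, one avoids the only letter of the last row, so it has
  two letters in a common row.\<close>

lemma noncomb_same_row:
  assumes t: "noncomb t" "t \<in> bracketings n X" "distinct (letters t)"
    and r: "\<And>a. a \<in> set (letters t) \<Longrightarrow> r a < n"
    and last: "\<And>a b. a \<in> set (letters t) \<Longrightarrow> b \<in> set (letters t) \<Longrightarrow> r a = n - 1 \<Longrightarrow> r b = n - 1 \<Longrightarrow> a = b"
  shows "\<exists>a b. a \<noteq> b \<and> r a = r b \<and> sib a b t"
proof -
  obtain ls ls' where ls: "cherry ls t" "cherry ls' t" "set ls \<inter> set ls' = {}"
    using noncomb_cherries[OF t] by blast
  have main: "\<exists>a b. a \<noteq> b \<and> r a = r b \<and> sib a b t"
    if c: "cherry us t" and no: "\<forall>a\<in>set us. r a \<noteq> n - 1" for us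
  proof -
    note cl = cherry_letters[OF c t(2,3)]
    have "r ` set us \<subseteq> {..<n - 1}" using cl r no by fastforce
    \<comment> \<open>Excludes \<open>n = 0\<close>, where \<open>n - 1\<close> is again 0 and the
      pigeonhole count below would fail.\<close>
    moreover have "us \<noteq> []"
    proof
      assume "us = []"
      then have "n = 0" using cl by auto
      moreover obtain ts where "t = Br ts" using t(1) by (cases t) auto
      ultimately have "t = Br []" using t(2) by (auto simp: bracketings_Br_iff)
      then show False using t(1) by simp
    qed
    \<comment> \<open>Pigeonhole: \<open>n\<close> distinct letters lie in at most
      \<open>n - 1\<close> rows.\<close>
    ultimately have "card (r ` set us) < card (set us)"
      using cl card_mono[of "{..<n - 1}" "r ` set us"] by (cases n) (auto simp: distinct_card)
    then have "\<not> inj_on r (set us)" using card_image by fastforce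
    then show ?thesis using cherry_sib[OF c] by (auto simp: inj_on_def)
  qed
  show ?thesis
  proof (cases "\<forall>a\<in>set ls. r a \<noteq> n - 1")
    case True
    then show ?thesis by (rule main[OF ls(1)])
  next
    case False
    then obtain z where z: "z \<in> set ls" "r z = n - 1" by auto
    have "r a \<noteq> n - 1" if "a \<in> set ls'" for a
      using last[of a z] z that ls(3) cherry_letters[OF ls(1) t(2,3)] cherry_letters[OF ls(2) t(2,3)] by blast
    then show ?thesis by (intro main[OF ls(2)]) blast
  qed
qed

subsection \<open>Combs\<close>

text \<open>\<open>A\<close> is the innermost bracket and will be the first column of a tableau; the
  lists in \<open>Bs\<close>, outermost first, are the later columns. The nested bracket is always
  the last entry.\<close>

primrec comb :: "'a list \<Rightarrow> 'a list list \<Rightarrow> 'a btree" where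
  "comb A [] = Br (map Letter A)"
| "comb A (B # Bs) = Br (map Letter B @ [comb A Bs])"

lemma letters_comb: "letters (comb A Bs) = concat Bs @ A"
  by (induction Bs) auto

lemma map_btree_comb: "map_btree f (comb A Bs) = comb (map f A) (map (map f) Bs)"
  by (induction Bs) auto

definition comb_shape :: "nat \<Rightarrow> 'a set \<Rightarrow> 'a list \<Rightarrow> 'a list list \<Rightarrow> bool"
  where "comb_shape n X A Bs \<longleftrightarrow> length A = n \<and> set A \<subseteq> X \<and> (\<forall>B\<in>set Bs. length B = n - 1 \<and> set B \<subseteq> X)"

lemma comb_bracketing: "n > 0 \<Longrightarrow> comb_shape n X A Bs \<Longrightarrow> comb A Bs \<in> bracketings n X"
  by (induction Bs) (auto simp: comb_shape_def bracketings_Br_iff)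

lemma sib_comb: "B \<in> set (A # Bs) \<Longrightarrow> a \<in> set B \<Longrightarrow> b \<in> set B \<Longrightarrow> sib a b (comb A Bs)"
  by (induction Bs) (auto intro: sib.intros)

lemma fil_funct_context_end:
  assumes "fil_funct n X L" "n > 0" "length B = n - 1" "set B \<subseteq> X"
  shows "fil_funct n X (\<lambda>t. L (Br (map Letter B @ [t])))"
  using fil_funct_context[OF assms(1), of "map Letter B" "[]"] assms by auto

text \<open>At every level at most one entry is a bracket, and antisymmetry moves it to the end. The
  comb and the sign \<open>c\<close> are chosen before \<open>L\<close>, so they serve all
  functionals at once.\<close>

lemma comb_normal_form:
  assumes "t \<in> bracketings n X" "t = Br ts" "\<not> noncomb t" "n \<ge> 2"
  shows "\<exists>A Bs c. (c = 1 \<or> c = -1) \<and> comb_shape n X A Bs \<and> mset (letters t) = mset (letters (comb A Bs)) \<and>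
    (\<forall>L. fil_funct n X L \<longrightarrow> L t = c * L (comb A Bs))"
  using assms
proof (induction arbitrary: ts rule: bracketings.induct)
  case (2 us)
  have br: "Br us \<in> bracketings n X" using 2 by (auto simp: bracketings_Br_iff)
  show ?case
  proof (cases "\<forall>u\<in>set us. \<exists>x. u = Letter x")
    case True
    then obtain g where "\<forall>u\<in>set us. u = Letter (g u)" by metis
    then have us: "us = map Letter (map g us)" by (simp add: map_idI)
    then have sub: "Br (map Letter (map g us)) \<in> bracketings n X" using br by simp
    then have "comb_shape n X (map g us) []" using 2 by (auto simp: comb_shape_def bracketings_Br_iff)
    moreover have "Br us = comb (map g us) []" using us by simp
    ultimately show ?thesis by (intro exI[of _ "map g us"] exI[of _ "[]"] exI[of _ 1]) simp
  next
    case False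
    then obtain u vs where u: "u \<in> set us" "u = Br vs" by (metis btree.exhaust)
    have ubr: "u \<in> bracketings n X" using u(1) br by (metis bracketings_Br_iff subsetD)
    have "\<not> noncomb u" using 2(4) u(1) by (metis noncomb.simps(2))
    then obtain A Bs c where IH: "c = 1 \<or> c = -1" "comb_shape n X A Bs"
      "mset (letters u) = mset (letters (comb A Bs))" "\<forall>L. fil_funct n X L \<longrightarrow> L u = c * L (comb A Bs)"
      using 2 u by metis
    obtain as bs where us: "us = as @ u # bs" using u by (meson split_list)
    \<comment> \<open>A second nested entry beside \<open>u\<close> would make the tree a
      non-comb.\<close>
    have "\<exists>x. v = Letter x" if v: "v \<in> set (as @ bs)" for v
    proof (cases v)
      case (Br ws)
      obtain j where j: "j < length us" "us ! j = v" "j \<noteq> length as"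
      proof -
        from v consider i where "i < length as" "as ! i = v" | i where "i < length bs" "bs ! i = v"
          by (metis Un_iff in_set_conv_nth set_append)
        then show thesis
        proof cases
          case 1 then show thesis by (intro that[of i]) (auto simp: us nth_append)
        next
          case 2 then show thesis by (intro that[of "Suc (length as + i)"]) (auto simp: us nth_append)
        qed
      qed
      have vb: "v \<in> bracketings n X" using v br us by (auto simp: bracketings_Br_iff)
      have "us ! length as = u" "length as < length us" using us by simp_all
      moreover have "1 < length (letters u)" "1 < length (letters v)"
        using length_letters_Br[of vs n X] length_letters_Br[of ws n X] u Br ubr vb 2(5) by auto
      ultimately have "noncomb (Br us)" using j by auto
      with 2(4) show ?thesis by contradiction
    qed simp
    then obtain g where "\<forall>v\<in>set (as @ bs). v = Letter (g v)" by metis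
    then have ab: "as @ bs = map Letter (map g (as @ bs))" by (simp add: map_idI)
    define B where "B = map g (as @ bs)"
    have ab: "as @ bs = map Letter B" using ab by (simp add: B_def)
    have lenB: "length B = n - 1" using 2(1) us by (simp add: B_def)
    have "Letter b \<in> bracketings n X" if "b \<in> set B" for b
    proof -
      have "Letter b \<in> set (as @ bs)" using that ab by simp
      then show ?thesis using br us by (auto simp: bracketings_Br_iff)
    qed
    then have setB: "set B \<subseteq> X" by auto
    have sh: "comb_shape n X A (B # Bs)" using IH(2) lenB setB by (simp add: comb_shape_def)
    have letB: "concat (map letters as) @ concat (map letters bs) = B"
      using arg_cong[OF ab, of "\<lambda>x. concat (map letters x)"] by simp
    have ms: "mset (letters (Br us)) = mset (letters (comb A (B # Bs)))"
      using IH(3) unfolding letters_comb us letB[symmetric] by (simp add: letB[symmetric] ac_simps)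
    have "L (Br us) = (-1) ^ length bs * c * L (comb A (B # Bs))" if L: "fil_funct n X L" for L
    proof -
      have "fil_funct n X (\<lambda>t. L (Br (map Letter B @ [t])))"
        using L lenB setB 2(5) by (intro fil_funct_context_end) auto
      then have "L (Br (map Letter B @ [u])) = c * L (comb A (B # Bs))" using IH(4) by fastforce
      moreover have "L (Br (as @ bs @ [u])) = (-1) ^ length bs * L (Br (as @ u # bs))"
        using br us by (intro fil_funct_to_end[OF L]) (auto simp: bracketings_Br_iff)
      moreover have "as @ bs @ [u] = map Letter B @ [u]" using ab by simp
      ultimately have "(-1) ^ length bs * L (Br us) = c * L (comb A (B # Bs))" using us by simp
      then show ?thesis by (cases "even (length bs)") (simp_all, metis minus_minus)
    qed
    moreover have "(-1) ^ length bs * c = 1 \<or> (-1) ^ length bs * c = -1"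
      using IH(1) by (cases "even (length bs)") auto
    ultimately show ?thesis using sh ms by blast
  qed
qed simp

text \<open>The Jacobi identity for the two innermost levels, the outer blocks \<open>Zs\<close>
  being a context. In each term one letter of \<open>A\<close> joins \<open>B\<close> in the
  innermost bracket, and the rest of \<open>A\<close> becomes the neighboring block.\<close>

lemma comb_jacobi:
  assumes L: "fil_funct n X L" and n: "n > 0" and sh: "comb_shape n X A (Zs @ [B])"
  shows "L (comb A (Zs @ [B])) = (\<Sum>i<n. (-1) ^ i * L (comb (A ! i # B) (Zs @ [take i A @ drop (Suc i) A])))"
  using L sh
proof (induction Zs arbitrary: L)
  case Nil
  have len: "length A = n" "length B = n - 1" "set A \<subseteq> X" "set B \<subseteq> X"
    using Nil by (auto simp: comb_shape_def)
  have brA: "Br (map Letter A) \<in> bracketings n X" using len by (auto simp: bracketings_Br_iff)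
  have "L (Br ([] @ map Letter B @ [Br (map Letter A)])) = (-1) ^ (n - 1) * L (Br ([] @ Br (map Letter A) # map Letter B))"
    using fil_funct_to_end[OF Nil(1), of "[]" "Br (map Letter A)" "map Letter B"] len n brA by auto
  also have "L (Br ([] @ Br (map Letter A) # map Letter B))
      = (\<Sum>i<n. L (Br ((map Letter A)[i := Br (map Letter A ! i # map Letter B)])))"
    using fil_funct_jacobi[OF Nil(1), of "map Letter A" "map Letter B"] len n by auto
  also have "(-1) ^ (n - 1) * \<dots> = (\<Sum>i<n. (-1) ^ i * L (comb (A ! i # B) [take i A @ drop (Suc i) A]))"
    unfolding sum_distrib_left
  proof (rule sum.cong)
    fix i assume "i \<in> {..<n}"
    then have i: "i < n" by simp
    let ?x = "Br (map Letter (A ! i # B))"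
    have "A ! i \<in> X" using len i by auto
    then have x: "?x \<in> bracketings n X" using len n by (auto simp: bracketings_Br_iff)
    have up: "(map Letter A)[i := Br (map Letter A ! i # map Letter B)] = map Letter (take i A) @ ?x # map Letter (drop (Suc i) A)"
      using i len by (simp add: upd_conv_take_nth_drop take_map drop_map)
    have "L (Br (map Letter (take i A) @ map Letter (drop (Suc i) A) @ [?x]))
      = (-1) ^ length (map Letter (drop (Suc i) A)) * L (Br (map Letter (take i A) @ ?x # map Letter (drop (Suc i) A)))"
    proof (rule fil_funct_to_end[OF Nil(1)])
      show "length (map Letter (take i A) @ ?x # map Letter (drop (Suc i) A)) = n" using i len by simp
      show "set (map Letter (take i A) @ ?x # map Letter (drop (Suc i) A)) \<subseteq> bracketings n X"
        using x len set_take_subset[of i A] set_drop_subset[of "Suc i" A] by auto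
    qed
    then have e: "L (comb (A ! i # B) [take i A @ drop (Suc i) A])
      = (-1) ^ (n - Suc i) * L (Br (map Letter (take i A) @ ?x # map Letter (drop (Suc i) A)))"
      using len by simp
    \<comment> \<open>Moving the bracket of \<open>A\<close> to the front costs \<open>n - 1\<close>
      signs, moving the new bracket from slot \<open>i\<close> to the end costs
      \<open>n - Suc i\<close>; together this is \<open>(-1) ^ i\<close>.\<close>
    have "(-1 :: complex) ^ i * (-1) ^ (n - Suc i) = (-1) ^ (n - 1)"
      unfolding power_add[symmetric] using i by simp
    then show "(-1) ^ (n - 1) * L (Br ((map Letter A)[i := Br (map Letter A ! i # map Letter B)]))
      = (-1) ^ i * L (comb (A ! i # B) [take i A @ drop (Suc i) A])"
      unfolding e up by (simp add: mult.assoc[symmetric])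
  qed simp
  finally show ?case by simp
next
  case (Cons Z Zs)
  have "fil_funct n X (\<lambda>t. L (Br (map Letter Z @ [t])))"
    using Cons.prems n by (intro fil_funct_context_end) (auto simp: comb_shape_def)
  from Cons.IH[OF this] Cons.prems(2) show ?case by (auto simp: comb_shape_def)
qed

subsection \<open>Functionals vanishing on non-combs\<close>

text \<open>Only non-combs with letter multiset \<open>m\<close> are required to vanish. Inside a
  context the letters of the context are split off from \<open>m\<close>, so the notion is inherited
  by subtrees.\<close>

definition comb_funct :: "nat \<Rightarrow> 'a set \<Rightarrow> 'a multiset \<Rightarrow> ('a btree \<Rightarrow> complex) \<Rightarrow> bool"
  where "comb_funct n X m L \<longleftrightarrow> fil_funct n X L \<and>
    (\<forall>t\<in>bracketings n X. noncomb t \<longrightarrow> mset (letters t) = m \<longrightarrow> L t = 0)"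

lemma comb_funct_context_end:
  assumes "comb_funct n X (mset B + m) L" "n > 0" "length B = n - 1" "set B \<subseteq> X"
  shows "comb_funct n X m (\<lambda>t. L (Br (map Letter B @ [t])))"
  using assms fil_funct_context_end[OF _ assms(2-4), of L]
  by (fastforce simp: comb_funct_def bracketings_Br_iff)

text \<open>Expand \<open>[[t, B'], B]\<close> by the Jacobi identity, where \<open>t\<close> is the
  inner comb. The term that brackets \<open>B\<close> with \<open>t\<close> is the comb with the
  blocks exchanged; every other term is a non-comb.\<close>

lemma comb_swap_blocks:
  assumes L: "comb_funct n X (mset (letters (comb A (Zs @ B # B' # Ws)))) L" and n: "n \<ge> 2"
    and sh: "comb_shape n X A (Zs @ B # B' # Ws)"
  shows "L (comb A (Zs @ B # B' # Ws)) = L (comb A (Zs @ B' # B # Ws))"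
  using L sh
proof (induction Zs arbitrary: L)
  case Nil
  have LL: "fil_funct n X L" using Nil by (simp add: comb_funct_def)
  define t where "t = comb A Ws"
  have t: "t \<in> bracketings n X" using Nil n by (auto simp: t_def comb_shape_def intro!: comb_bracketing)
  obtain ts where tB: "t = Br ts" by (cases Ws) (auto simp: t_def)
  have lt: "1 < length (letters t)" using length_letters_Br[of ts n X] t tB n by simp
  have len: "length B = n - 1" "set B \<subseteq> X" "length B' = n - 1" "set B' \<subseteq> X"
    using Nil by (auto simp: comb_shape_def)
  \<comment> \<open>Both nested brackets are moved from the last to the first slot; the two signs
    \<open>(-1) ^ (n - 1)\<close> cancel.\<close>
  have conv: "L (Br (map Letter C @ [Br (map Letter D @ [t])])) = L (Br (Br (t # map Letter D) # map Letter C))"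
    if C: "length C = n - 1" "set C \<subseteq> X" and D: "length D = n - 1" "set D \<subseteq> X" for C D
  proof -
    have Dt: "Br (t # map Letter D) \<in> bracketings n X" "Br (map Letter D @ [t]) \<in> bracketings n X"
      using D t n by (auto simp: bracketings_Br_iff)
    have "L (Br ([] @ map Letter C @ [Br (map Letter D @ [t])])) = (-1) ^ (n - 1) * L (Br ([] @ Br (map Letter D @ [t]) # map Letter C))"
      using fil_funct_to_end[OF LL, of "[]" "Br (map Letter D @ [t])" "map Letter C"] C n Dt by auto
    also have "L (Br ([] @ Br (map Letter D @ [t]) # map Letter C)) = (-1) ^ (n - 1) * L (Br ([] @ Br (t # map Letter D) # map Letter C))"
    proof -
      have "fil_funct n X (\<lambda>t. L (Br ([] @ t # map Letter C)))"
        using C n by (intro fil_funct_context[OF LL]) auto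
      from fil_funct_to_end[OF this, of "[]" t "map Letter D"] show ?thesis using D n t by auto
    qed
    finally show ?thesis by (simp add: power_mult_distrib[symmetric] mult.assoc[symmetric] flip: power_add mult_2)
  qed
  have "L (Br (Br (t # map Letter B') # map Letter B))
      = (\<Sum>i<n. L (Br ((t # map Letter B')[i := Br ((t # map Letter B') ! i # map Letter B)])))"
    using fil_funct_jacobi[OF LL, of "t # map Letter B'" "map Letter B"] len n t by auto
  also have "\<dots> = L (Br ((t # map Letter B')[0 := Br ((t # map Letter B') ! 0 # map Letter B)]))"
  proof (subst sum.mono_neutral_right[of _ "{0}"])
    show "\<forall>i\<in>{..<n} - {0}. L (Br ((t # map Letter B')[i := Br ((t # map Letter B') ! i # map Letter B)])) = 0"
    proof
      fix i assume i: "i \<in> {..<n} - {0}"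
      then obtain j where j: "i = Suc j" "j < length B'" using len by (cases i) auto
      let ?u = "Br (Letter (B' ! j) # map Letter B)"
      let ?v = "Br (t # (map Letter B')[j := ?u])"
      have bj: "B' ! j \<in> X" using j len by auto
      have u: "?u \<in> bracketings n X" using len n bj by (auto simp: bracketings_Br_iff)
      have v: "?v \<in> bracketings n X"
      proof -
        have "set ((map Letter B')[j := ?u]) \<subseteq> insert ?u (Letter ` set B')"
          using set_update_subset_insert[of "map Letter B'" j ?u] by simp
        also have "\<dots> \<subseteq> bracketings n X" using u len by (simp del: letters.simps)
        finally show ?thesis using t len n by (simp add: bracketings_Br_iff)
      qed
      have lu: "1 < length (letters ?u)" using length_letters_Br[OF u n] .
      \<comment> \<open>\<open>t\<close> and the new bracket \<open>?u\<close> are siblings with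
        more than one letter each.\<close>
      have "noncomb ?v"
        unfolding noncomb.simps
        by (intro disjI1 exI[of _ 0] exI[of _ "Suc j"] conjI) (use j lt lu in auto)
      moreover have "mset (letters ?v) = mset (letters (comb A ([] @ B # B' # Ws)))"
      proof -
        have "B' = take j B' @ B' ! j # drop (Suc j) B'" using j by (simp add: id_take_nth_drop)
        then have "mset B' = mset (take j B') + add_mset (B' ! j) (mset (drop (Suc j) B'))"
          by (metis mset.simps(2) mset_append)
        then show ?thesis using j
          by (simp add: upd_conv_take_nth_drop take_map drop_map letters_comb t_def ac_simps)
      qed
      ultimately have "L ?v = 0" using Nil(1) v by (auto simp: comb_funct_def)
      then show "L (Br ((t # map Letter B')[i := Br ((t # map Letter B') ! i # map Letter B)])) = 0"
        using j by simp
    qed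
  qed (use n in auto)
  also have "\<dots> = L (Br (Br (t # map Letter B) # map Letter B'))" by simp
  finally show ?case using conv[of B B'] conv[of B' B] len by (simp add: t_def)
next
  case (Cons Z Zs)
  have "comb_funct n X (mset (letters (comb A (Zs @ B # B' # Ws)))) (\<lambda>t. L (Br (map Letter Z @ [t])))"
    using Cons.prems n by (intro comb_funct_context_end) (auto simp: comb_shape_def letters_comb ac_simps)
  from Cons.IH[OF this] Cons.prems(2) show ?case by (auto simp: comb_shape_def)
qed

text \<open>Adjacent transpositions generate all rearrangements. It is applied both to the blocks of
  a comb and to the letters of one column.\<close>

lemma adjacent_swaps_invariant:
  assumes swap: "\<And>as x y bs. mset (as @ x # y # bs) = m \<Longrightarrow> f (as @ x # y # bs) = f (as @ y # x # bs)"
    and "mset xs = m" "mset ys = m"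
  shows "f xs = f ys"
  using assms
proof (induction xs arbitrary: f ys m)
  case Nil then show ?case by simp
next
  case (Cons x xs)
  have "x \<in> set ys" using Cons.prems by (metis list.set_intros(1) set_mset_mset)
  then obtain as bs where ys: "ys = as @ x # bs" by (meson split_list)
  have "f (us @ x # bs) = f (x # us @ bs)" if "mset (us @ x # bs) = m" for us
    using that
  proof (induction us arbitrary: bs rule: rev_induct)
    case (snoc u us)
    have "f (us @ u # x # bs) = f (us @ x # u # bs)" using snoc.prems by (intro Cons.prems(1)) simp
    moreover have "f (us @ x # u # bs) = f (x # us @ u # bs)" using snoc.prems by (intro snoc.IH) (simp add: add_mset_commute)
    ultimately show ?case by simp
  qed simp
  then have 1: "f ys = f (x # as @ bs)" using Cons.prems ys by simp
  have "f (x # xs) = f (x # as @ bs)"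
  proof (rule Cons.IH[of "mset xs" "\<lambda>zs. f (x # zs)"])
    fix as' u v bs' assume "mset (as' @ u # v # bs') = mset xs"
    then have "mset ((x # as') @ u # v # bs') = m" using Cons.prems by simp
    from Cons.prems(1)[OF this] show "f (x # as' @ u # v # bs') = f (x # as' @ v # u # bs')" by simp
  next
    show "mset (as @ bs) = mset xs" using Cons.prems ys by (metis add_mset_add_single add_right_imp_eq mset.simps(2) mset_append union_mset_add_mset_right)
  qed simp
  with 1 show ?case by simp
qed

lemma comb_permute_blocks:
  assumes L: "comb_funct n X (mset (letters (comb A Bs))) L" and n: "n \<ge> 2"
    and sh: "comb_shape n X A Bs" and m: "mset Bs' = mset Bs"
  shows "L (comb A Bs') = L (comb A Bs)"
proof (rule adjacent_swaps_invariant[where f = "\<lambda>Bs. L (comb A Bs)", OF _ m refl])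
  fix as x y bs assume e: "mset (as @ x # y # bs) = mset Bs"
  have s: "set (as @ x # y # bs) = set Bs" using mset_eq_setD[OF e] .
  have "mset (concat (as @ x # y # bs)) = mset (concat Bs)"
    using e by (metis mset_concat mset_map sum_mset_sum_list)
  then have "mset (letters (comb A (as @ x # y # bs))) = mset (letters (comb A Bs))"
    by (simp add: letters_comb)
  then show "L (comb A (as @ x # y # bs)) = L (comb A (as @ y # x # bs))"
    using L sh s by (intro comb_swap_blocks[OF _ n, of X]) (simp_all add: comb_shape_def)
qed

section \<open>The vector product algebra\<close>

definition unit_fun :: "nat \<Rightarrow> nat \<Rightarrow> complex"
  where "unit_fun a = (\<lambda>b. of_bool (b = a))"

lemma sum_unit_fun [simp]:
  "(\<Sum>a<m. unit_fun b a * f a) = (if b < m then f b else 0)"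
proof -
  have "(\<Sum>a<m. unit_fun b a * f a) = (\<Sum>a<m. if a = b then f a else 0)"
    by (intro sum.cong) (auto simp: unit_fun_def)
  then show ?thesis by simp
qed

text \<open>Vectors are functions on all naturals, of which only the first \<open>length ws\<close>
  coordinates are read; the dimension is that of the list.\<close>

definition cmat :: "(nat \<Rightarrow> complex) list \<Rightarrow> complex mat"
  where "cmat ws = mat (length ws) (length ws) (\<lambda>(a, b). (ws ! b) a)"

abbreviation cdet :: "(nat \<Rightarrow> complex) list \<Rightarrow> complex"
  where "cdet ws \<equiv> Determinant.det (cmat ws)"

lemma cmat_carrier [simp]: "cmat ws \<in> carrier_mat (length ws) (length ws)"
  by (simp add: cmat_def)

lemma cofactor_cmat_update:
  assumes "j < length ws"
  shows "cofactor (cmat (ws[j := w])) a j = cofactor (cmat ws) a j"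
proof -
  have "mat_delete (cmat (ws[j := w])) a j = mat_delete (cmat ws) a j"
    by (rule eq_matI) (auto simp: mat_delete_def cmat_def nth_list_update)
  then show ?thesis by (simp add: cofactor_def)
qed

text \<open>Laplace expansion along column \<open>j\<close>, whose cofactors do not involve that
  column. All linearity of the determinant is derived from this.\<close>

lemma cdet_update:
  assumes j: "j < length ws"
  shows "cdet (ws[j := w]) = (\<Sum>a<length ws. w a * cofactor (cmat ws) a j)"
proof -
  have "cdet (ws[j := w]) = (\<Sum>a<length ws. cmat (ws[j := w]) $$ (a, j) * cofactor (cmat (ws[j := w])) a j)"
    using j by (intro laplace_expansion_column) (auto simp: cmat_def)
  also have "\<dots> = (\<Sum>a<length ws. w a * cofactor (cmat ws) a j)"
  proof (rule sum.cong[OF refl])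
    fix a assume "a \<in> {..<length ws}"
    then have "cmat (ws[j := w]) $$ (a, j) = w a" using j by (simp add: cmat_def)
    then show "cmat (ws[j := w]) $$ (a, j) * cofactor (cmat (ws[j := w])) a j = w a * cofactor (cmat ws) a j"
      using j by (simp add: cofactor_cmat_update)
  qed
  finally show ?thesis .
qed

lemma cdet_slot:
  "cdet (us @ w # vs) = (\<Sum>a<Suc (length us + length vs). w a * cdet (us @ unit_fun a # vs))"
proof -
  let ?ws = "us @ (\<lambda>_. 0) # vs"
  have up: "cdet (us @ w # vs) = (\<Sum>a<length ?ws. w a * cofactor (cmat ?ws) a (length us))" for w
    using cdet_update[of "length us" ?ws w] by (simp add: list_update_append)
  have cf: "cdet (us @ unit_fun a # vs) = cofactor (cmat ?ws) a (length us)" if "a < length ?ws" for a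
    unfolding up[of "unit_fun a"] sum_unit_fun using that by simp
  have "cdet (us @ w # vs) = (\<Sum>a<length ?ws. w a * cdet (us @ unit_fun a # vs))"
    unfolding up[of w] by (intro sum.cong refl) (simp only: cf lessThan_iff)
  then show ?thesis by simp
qed

lemma cdet_scale: "cdet (us @ (\<lambda>i. c * w i) # vs) = c * cdet (us @ w # vs)"
  unfolding cdet_slot[of us "\<lambda>i. c * w i"] cdet_slot[of us w] by (simp add: sum_distrib_left mult.assoc del: sum.lessThan_Suc)

lemma cdet_plin: "plin (\<lambda>t. cdet (us @ v t # vs)) f = cdet (us @ (\<lambda>a. plin (\<lambda>t. v t a) f) # vs)"
proof -
  define K where "K a = cdet (us @ unit_fun a # vs)" for a
  have slot: "cdet (us @ w # vs) = (\<Sum>a<Suc (length us + length vs). K a * w a)" for w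
    unfolding cdet_slot[of us w] K_def by (simp add: mult.commute del: sum.lessThan_Suc)
  show ?thesis unfolding slot plin_fun_sum plin_fun_mult by (rule refl)
qed

lemma cdet_permute:
  assumes p: "p permutes {..<length ws}"
  shows "cdet (permute_list p ws) = of_int (sign p) * cdet ws"
proof -
  let ?n = "length ws"
  have pp: "p permutes {0..<?n}" using p by (simp add: atLeast0LessThan)
  have "cmat (permute_list p ws) = transpose_mat (mat ?n ?n (\<lambda>(i, j). transpose_mat (cmat ws) $$ (p i, j)))"
    using p permutes_in_image[OF p]
    by (intro eq_matI) (auto simp: cmat_def permute_list_nth[OF p])
  then have "cdet (permute_list p ws) = Determinant.det (mat ?n ?n (\<lambda>(i, j). transpose_mat (cmat ws) $$ (p i, j)))"
    by (simp add: det_transpose[of _ ?n])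
  also have "\<dots> = of_int (sign p) * Determinant.det (transpose_mat (cmat ws))"
    using det_permute_rows[OF _ pp, of "transpose_mat (cmat ws)"] by simp
  finally show ?thesis by (simp add: det_transpose[of _ ?n])
qed

lemma cdet_repeat:
  assumes "i < length ws" "j < length ws" "i \<noteq> j" "ws ! i = ws ! j"
  shows "cdet ws = 0"
  by (rule det_identical_columns[of _ "length ws" i j]) (use assms in \<open>auto simp: cmat_def intro!: eq_vecI\<close>)

text \<open>The derivative of the determinant along a linear map is multiplication by its trace:
  replacing a column by \<open>w\<close> pairs \<open>w\<close> with a row of the adjugate.\<close>

lemma cdet_trace:
  fixes A :: "nat \<Rightarrow> nat \<Rightarrow> complex" and ws :: "(nat \<Rightarrow> complex) list"
  defines "m \<equiv> length ws"
  shows "(\<Sum>j<m. cdet (ws[j := (\<lambda>a. \<Sum>b<m. (ws ! j) b * A a b)])) = (\<Sum>a<m. A a a) * cdet ws"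
proof -
  let ?M = "cmat ws"
  have M: "?M \<in> carrier_mat m m" by (simp add: m_def)
  have adj: "(\<Sum>j<m. (ws ! j) b * cofactor ?M a j) = (if a = b then cdet ws else 0)" if ab: "a < m" "b < m" for a b
  proof -
    have "(?M * adj_mat ?M) $$ (b, a) = (\<Sum>j<m. (ws ! j) b * cofactor ?M a j)"
      using ab M by (auto simp: scalar_prod_def adj_mat_def cmat_def m_def atLeast0LessThan intro!: sum.cong)
    then show ?thesis using ab adj_mat(2)[OF M] by auto
  qed
  have "(\<Sum>j<m. cdet (ws[j := (\<lambda>a. \<Sum>b<m. (ws ! j) b * A a b)]))
      = (\<Sum>j<m. \<Sum>a<m. \<Sum>b<m. A a b * ((ws ! j) b * cofactor ?M a j))"
    by (intro sum.cong refl, subst cdet_update) (auto simp: m_def sum_distrib_left sum_distrib_right mult_ac intro!: sum.cong)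
  also have "\<dots> = (\<Sum>a<m. \<Sum>b<m. A a b * (\<Sum>j<m. (ws ! j) b * cofactor ?M a j))"
    by (subst sum.swap, rule sum.cong[OF refl], subst sum.swap) (simp add: sum_distrib_left)
  also have "\<dots> = (\<Sum>a<m. \<Sum>b<m. if a = b then A a b * cdet ws else 0)"
    by (intro sum.cong refl) (auto simp: adj)
  also have "\<dots> = (\<Sum>a<m. A a a) * cdet ws"
    by (simp add: sum.delta sum_distrib_right)
  finally show ?thesis .
qed

text \<open>The generalized cross product: the vector whose pairing with \<open>w\<close> is the
  determinant of \<open>vs\<close> followed by \<open>w\<close>. For \<open>n\<close> factors the
  dimension is \<open>n + 1\<close>.\<close>

definition vprod :: "(nat \<Rightarrow> complex) list \<Rightarrow> nat \<Rightarrow> complex"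
  where "vprod vs i = cdet (vs @ [unit_fun i])"

text \<open>Bracketing with \<open>ys\<close> is a linear map \<open>T\<close>. Its matrix
  \<open>A\<close> is antisymmetric, since exchanging the two indices swaps the first and last
  columns of a determinant; hence \<open>T\<close> has trace 0 and acts on determinants as a
  derivation with total 0.\<close>

lemma vprod_jacobi:
  assumes len: "length xs = n" "length ys = n - 1" and n: "n > 0" and i: "i \<le> n"
  shows "vprod (vprod xs # ys) i = (\<Sum>j<n. vprod (xs[j := vprod (xs ! j # ys)]) i)"
proof -
  define A where "A = (\<lambda>a b. cdet (unit_fun b # ys @ [unit_fun a]))"
  define T where "T v = (\<lambda>a. \<Sum>b<Suc n. v b * A a b)" for v
  have act: "vprod (v # ys) = T v" for v
    unfolding vprod_def A_def T_def using cdet_slot[of "[]" v] len n by (intro ext) simp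
  have anti: "A a b = - A b a" for a b
  proof -
    let ?ws = "unit_fun a # ys @ [unit_fun b]"
    have p: "Transposition.transpose 0 n permutes {..<length ?ws}"
      using len n by (intro permutes_swap_id) auto
    have "permute_list (Transposition.transpose 0 n) ?ws = unit_fun b # ys @ [unit_fun a]"
      using len n by (intro nth_equalityI)
        (auto simp: permute_list_nth[OF p] Transposition.transpose_def nth_Cons nth_append split: nat.splits)
    then show ?thesis using cdet_permute[OF p] n by (simp add: A_def sign_swap_id)
  qed
  have "A a a = 0" for a using anti[of a a] by simp
  \<comment> \<open>The summand in which \<open>T\<close> hits the appended vector
    \<open>unit_fun i\<close> is, by antisymmetry of \<open>A\<close>, minus the left side of the
    Jacobi identity.\<close>
  then have "0 = (\<Sum>j<Suc n. cdet ((xs @ [unit_fun i])[j := T ((xs @ [unit_fun i]) ! j)]))"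
    using cdet_trace[of "xs @ [unit_fun i]" A] len unfolding T_def by simp
  also have "\<dots> = (\<Sum>j<n. vprod (xs[j := vprod (xs ! j # ys)]) i) + cdet (xs @ [T (unit_fun i)])"
    using len by (simp add: vprod_def[of "_[_ := _]"] act list_update_append nth_append)
  also have "T (unit_fun i) = (\<lambda>a. A a i)"
    using i by (simp add: T_def del: sum.lessThan_Suc)
  also have "cdet (xs @ [\<lambda>a. A a i]) = (\<Sum>a<Suc n. A a i * vprod xs a)"
    using cdet_slot[of xs "\<lambda>a. A a i" "[]"] len by (simp add: vprod_def)
  also have "\<dots> = - (\<Sum>a<Suc n. vprod xs a * A i a)"
    unfolding sum_negf[symmetric] by (intro sum.cong refl) (simp add: anti[of _ i])
  also have "\<dots> = - vprod (vprod xs # ys) i" by (simp add: act T_def)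
  finally show ?thesis by simp
qed

lemma vprod_permute:
  assumes "p permutes {..<length vs}"
  shows "vprod (permute_list p vs) i = of_int (sign p) * vprod vs i"
proof -
  have p: "p permutes {..<length (vs @ [unit_fun i])}"
    using assms by (rule permutes_subset) auto
  have "permute_list p (vs @ [unit_fun i]) = permute_list p vs @ [unit_fun i]"
  proof (rule nth_equalityI)
    fix j assume "j < length (permute_list p (vs @ [unit_fun i]))"
    then have j: "j \<le> length vs" by simp
    show "permute_list p (vs @ [unit_fun i]) ! j = (permute_list p vs @ [unit_fun i]) ! j"
    proof (cases "j = length vs")
      case True
      then have "p j = j" using assms by (auto simp: permutes_def)
      then show ?thesis using True j by (simp add: permute_list_nth[OF p] nth_append)
    next
      case False
      then have "p j < length vs" using j permutes_in_image[OF assms, of j] by auto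
      then show ?thesis using False j by (simp add: permute_list_nth[OF p] permute_list_nth[OF assms] nth_append)
    qed
  qed simp
  then show ?thesis using cdet_permute[OF p] by (simp add: vprod_def)
qed

primrec ev :: "('a \<Rightarrow> nat) \<Rightarrow> 'a btree \<Rightarrow> nat \<Rightarrow> complex" where
  "ev r (Letter x) = unit_fun (r x)"
| "ev r (Br ts) = vprod (map (ev r) ts)"

lemma ev_map_btree: "ev r (map_btree f t) = ev (r \<circ> f) t"
  by (induction t) (simp_all add: comp_def cong: map_cong)

lemma ev_cong: "(\<And>a. a \<in> set (letters t) \<Longrightarrow> r a = r' a) \<Longrightarrow> ev r t = ev r' t"
proof (induction t)
  case (Br ts)
  have "map (ev r) ts = map (ev r') ts" by (rule map_cong[OF refl]) (use Br in auto)
  then show ?case by (simp only: ev.simps)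
qed simp

definition evl :: "('a \<Rightarrow> nat) \<Rightarrow> ('a btree \<Rightarrow>\<^sub>0 complex) \<Rightarrow> nat \<Rightarrow> complex"
  where "evl r f a = plin (\<lambda>t. ev r t a) f"

lemma mlin_cdet: "mlin (\<lambda>ts. cdet (us @ map (ev r) ts @ vs)) fs = cdet (us @ map (evl r) fs @ vs)"
proof (induction fs arbitrary: us)
  case (Cons f fs)
  have "mlin (\<lambda>ts. cdet (us @ map (ev r) ts @ vs)) (f # fs)
      = plin (\<lambda>t. mlin (\<lambda>ts. cdet ((us @ [ev r t]) @ map (ev r) ts @ vs)) fs) f" by simp
  also have "\<dots> = plin (\<lambda>t. cdet (us @ ev r t # map (evl r) fs @ vs)) f"
    unfolding Cons.IH by simp
  also have "\<dots> = cdet (us @ evl r f # map (evl r) fs @ vs)"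
    unfolding cdet_plin evl_def[abs_def] by (rule refl)
  finally show ?case by simp
qed simp

lemma evl_bracket: "evl r (bracket fs) i = vprod (map (evl r) fs) i"
  using mlin_cdet[of "[]" r "[unit_fun i]" fs] by (simp add: evl_def[of r "bracket fs"] plin_bracket vprod_def)

lemma vprod_update_zero:
  assumes "j < length vs" "\<forall>a\<le>length vs. w a = 0"
  shows "vprod (vs[j := w]) i = 0"
proof -
  have eq: "vs[j := w] @ [unit_fun i] = take j vs @ w # (drop (Suc j) vs @ [unit_fun i])"
    using assms by (simp add: upd_conv_take_nth_drop)
  show ?thesis unfolding vprod_def eq using assms by (subst cdet_slot) (auto intro!: sum.neutral)
qed

lemma fil_funct_ev:
  assumes n: "n > 0" and i: "i \<le> n"
  shows "fil_funct n X (\<lambda>t. ev r t i)"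
  unfolding kills_def
proof
  fix w assume "w \<in> filippov_ideal n X"
  \<comment> \<open>The coordinates up to \<open>n\<close> are those of the algebra of dimension
    \<open>n + 1\<close>; all of them enter the induction because the absorption case needs the
    whole inner vector to vanish.\<close>
  then have "\<forall>i\<le>n. evl r w i = 0"
  proof induction
    case (antisymmetry xs p)
    have "evl r (f - scl c g) i = evl r f i - c * evl r g i" for f g c i
      by (simp add: evl_def plin_diff)
    moreover have "complex_of_int (sign p) * complex_of_int (sign p) = 1"
      by (metis of_int_1 of_int_mult sign_idempotent)
    ultimately show ?case
      using antisymmetry vprod_permute[of p "map (evl r) xs"]
      by (simp add: evl_bracket permute_list_map)
  next
    case (jacobi xs ys)
    have e: "evl r (bracket zs) = vprod (map (evl r) zs)" for zs by (rule ext) (rule evl_bracket)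
    have s: "evl r (f - sum g A) i = evl r f i - (\<Sum>a\<in>A. evl r (g a) i)" for f A i and g :: "nat \<Rightarrow> _"
      by (simp add: evl_def plin_diff plin_sum)
    show ?case
    proof (intro allI impI)
      fix i assume "i \<le> n"
      then show "evl r (bracket (bracket xs # ys) - (\<Sum>i<n. bracket (xs[i := bracket (xs ! i # ys)]))) i = 0"
        using vprod_jacobi[of "map (evl r) xs" n "map (evl r) ys" i] jacobi n
        by (simp add: s e map_update)
    qed
  next
    case (absorb f xs i)
    then show ?case by (auto simp: evl_bracket map_update intro!: vprod_update_zero)
  qed (auto simp: evl_def plin_add)
  then show "plin (\<lambda>t. ev r t i) w = 0" using i by (simp add: evl_def)
qed

subsection \<open>Products of basis vectors\<close>

text \<open>The matrix is a permutation matrix, hence orthogonal.\<close>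

lemma cdet_units_nonzero:
  assumes d: "distinct rs" and s: "set rs \<subseteq> {..<length rs}"
  shows "cdet (map unit_fun rs) \<noteq> 0"
proof -
  let ?m = "length rs" and ?M = "cmat (map unit_fun rs)"
  have M: "?M \<in> carrier_mat ?m ?m" using cmat_carrier[of "map unit_fun rs"] by simp
  have rs: "rs ! i < ?m" if "i < ?m" for i using s that by (meson lessThan_iff nth_mem subsetD)
  have "transpose_mat ?M * ?M = 1\<^sub>m ?m"
  proof (rule eq_matI)
    fix i j assume ij: "i < dim_row (1\<^sub>m ?m :: complex mat)" "j < dim_col (1\<^sub>m ?m :: complex mat)"
    have "(transpose_mat ?M * ?M) $$ (i, j) = (\<Sum>a<?m. of_bool (a = rs ! i) * of_bool (a = rs ! j))"
      using ij by (auto simp: scalar_prod_def cmat_def unit_fun_def atLeast0LessThan intro!: sum.cong)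
    also have "\<dots> = (\<Sum>a<?m. if a = rs ! i then of_bool (rs ! i = rs ! j) else 0)"
      by (intro sum.cong) auto
    also have "\<dots> = (1\<^sub>m ?m) $$ (i, j)"
      using ij rs d by (auto simp: nth_eq_iff_index_eq)
    finally show "(transpose_mat ?M * ?M) $$ (i, j) = (1\<^sub>m ?m) $$ (i, j)" .
  qed (use M in auto)
  then have "Determinant.det (transpose_mat ?M) * Determinant.det ?M = 1"
    using M by (metis det_mult det_one transpose_carrier_mat)
  then show ?thesis by auto
qed

text \<open>Appending a basis vector that already occurs gives a repeated column, so the product of
  all basis vectors but \<open>unit_fun q\<close> can only be a multiple of
  \<open>unit_fun q\<close>.\<close>

lemma vprod_units:
  assumes d: "distinct (q # rs)" and s: "set (q # rs) = {..length rs}"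
  shows "\<exists>c. c \<noteq> 0 \<and> vprod (map unit_fun rs) = (\<lambda>i. c * unit_fun q i)"
proof (intro exI conjI ext)
  let ?c = "cdet (map unit_fun (rs @ [q]))"
  show "?c \<noteq> 0" using d s by (intro cdet_units_nonzero) auto
  fix i
  show "vprod (map unit_fun rs) i = ?c * unit_fun q i"
  proof (cases "i = q")
    case True
    then show ?thesis by (simp add: vprod_def unit_fun_def)
  next
    case False
    have "vprod (map unit_fun rs) i = 0"
    proof (cases "i \<in> set rs")
      case True
      then obtain j where "j < length rs" "rs ! j = i" by (metis in_set_conv_nth)
      then show ?thesis unfolding vprod_def
        by (intro cdet_repeat[of j _ "length rs"]) (auto simp: nth_append)
    next
      case F2: False
      \<comment> \<open>Beyond the dimension the appended column is zero.\<close>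
      with False s have "i \<notin> {..length rs}" by auto
      then show ?thesis unfolding vprod_def
        by (subst cdet_slot) (auto simp: unit_fun_def intro!: sum.neutral)
    qed
    then show ?thesis using False by (simp add: unit_fun_def)
  qed
qed

text \<open>A block of a standard comb uses up the basis vectors with indices 0 to
  \<open>n - 2\<close>. Wrapping such a block around one of the two remaining vectors gives a
  nonzero multiple of the other, so this property survives further blocks.\<close>

definition alive :: "nat \<Rightarrow> (nat \<Rightarrow> complex) \<Rightarrow> bool"
  where "alive n v \<longleftrightarrow> (\<exists>c q. c \<noteq> 0 \<and> (q = n - 1 \<or> q = n) \<and> v = (\<lambda>i. c * unit_fun q i))"

lemma map_ev_Letter: "map (ev r \<circ> Letter) B = map unit_fun (map r B)"
  by (simp add: comp_def)

lemma alive_wrap: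
  assumes n: "n > 0" and al: "alive n (ev r t)" and B: "map r B = [0..<n - 1]"
  shows "alive n (ev r (Br (map Letter B @ [t])))"
proof -
  obtain c q where c: "c \<noteq> 0" "q = n - 1 \<or> q = n" "ev r t = (\<lambda>i. c * unit_fun q i)"
    using al by (auto simp: alive_def)
  define q' where "q' = (if q = n then n - 1 else n)"
  have "\<exists>d. d \<noteq> 0 \<and> vprod (map unit_fun ([0..<n - 1] @ [q])) = (\<lambda>i. d * unit_fun q' i)"
    using n c(2) by (intro vprod_units) (auto simp: q'_def)
  then obtain d where d: "d \<noteq> 0" "vprod (map unit_fun ([0..<n - 1] @ [q])) = (\<lambda>i. d * unit_fun q' i)"
    by blast
  have "ev r (Br (map Letter B @ [t])) i = c * d * unit_fun q' i" for i
  proof -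
    have "ev r (Br (map Letter B @ [t])) i = cdet (map unit_fun [0..<n - 1] @ (\<lambda>i. c * unit_fun q i) # [unit_fun i])"
      using c B map_ev_Letter[of r B] by (simp add: vprod_def comp_def)
    also have "\<dots> = c * vprod (map unit_fun ([0..<n - 1] @ [q])) i"
      unfolding cdet_scale by (simp add: vprod_def)
    finally show ?thesis using d by simp
  qed
  then show ?thesis unfolding alive_def
    using c d by (intro exI[of _ "c * d"] exI[of _ q']) (auto simp: q'_def)
qed

lemma alive_comb:
  assumes n: "n > 0" and A: "map r A = [0..<n]" and B: "\<forall>B\<in>set Bs. map r B = [0..<n - 1]"
  shows "alive n (ev r (comb A Bs))"
  using B
proof (induction Bs)
  case Nil
  have "\<exists>c. c \<noteq> 0 \<and> vprod (map unit_fun [0..<n]) = (\<lambda>i. c * unit_fun n i)"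
    by (intro vprod_units) auto
  then show ?case using map_ev_Letter[of r A] A by (auto simp: alive_def comp_def)
next
  case (Cons B Bs)
  then show ?case using alive_wrap[OF n, of r "comb A Bs" B] by simp
qed

text \<open>On an alive value exactly one of the two coordinates is nonzero; adding them avoids
  tracking the parity of the number of blocks.\<close>

definition eval_last :: "nat \<Rightarrow> ('a \<Rightarrow> nat) \<Rightarrow> 'a btree \<Rightarrow> complex"
  where "eval_last n r t = ev r t (n - 1) + ev r t n"

lemma fil_funct_eval_last: "n > 0 \<Longrightarrow> fil_funct n X (eval_last n r)"
  using fil_funct_ev[where n = n and i = "n - 1" and X = X and r = r]
    fil_funct_ev[where n = n and i = n and X = X and r = r]
  unfolding kills_def eval_last_def by (simp add: plin_fun_add)

lemma eval_last_alive: "n > 0 \<Longrightarrow> alive n (ev r t) \<Longrightarrow> eval_last n r t \<noteq> 0"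
  by (cases n) (auto simp: alive_def eval_last_def unit_fun_def)

lemma eval_last_map_btree: "eval_last n r (map_btree f t) = eval_last n (r \<circ> f) t"
  by (simp add: eval_last_def ev_map_btree)

text \<open>The letters are row indices and are repeated: it is the common image of the combs of all
  tableaux when each letter is replaced by its row.\<close>

definition std_comb :: "nat \<Rightarrow> nat \<Rightarrow> nat btree"
  where "std_comb n l = comb [0..<n] (replicate l [0..<n - 1])"

lemma eval_last_std_comb:
  assumes "map r A = [0..<n]" "\<forall>B\<in>set Bs. map r B = [0..<n - 1]"
  shows "eval_last n r (comb A Bs) = eval_last n id (std_comb n (length Bs))"
proof -
  have "map (map r) Bs = replicate (length Bs) [0..<n - 1]"
    using assms(2) by (induction Bs) auto
  then show ?thesis using assms eval_last_map_btree[of n id r "comb A Bs"]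
    by (simp add: map_btree_comb std_comb_def)
qed

lemma eval_last_std_comb_nonzero: "n > 0 \<Longrightarrow> eval_last n id (std_comb n l) \<noteq> 0"
  unfolding std_comb_def by (intro eval_last_alive alive_comb) auto

subsection \<open>A noncomb that does not vanish\<close>

lemma upt_split: "i \<le> j \<Longrightarrow> j \<le> k \<Longrightarrow> [i..<j] @ [j..<k] = [i..<k]"
  by (metis le_add_diff_inverse upt_add_eq_append)

text \<open>For \<open>k = 3\<close> a suitable evaluation of two sibling brackets gives multiples
  of e_n and e_0, which with e_1, ..., e_(n-2) multiply to a multiple of e_(n-1). Larger
  \<open>k\<close> are reached by wrapping blocks of \<open>n - 1\<close> new letters.\<close>

lemma noncomb_alive:
  assumes n: "n \<ge> 2" and k: "k \<ge> 3"
  shows "\<exists>t\<in>bracketed_permutations n k. noncomb t \<and> (\<exists>r. alive n (ev r t))"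
  using k
proof (induction k rule: dec_induct)
  case base
  let ?A = "[1..<n + 1]" and ?B = "[n + 1..<2 * n + 1]" and ?C = "[2 * n + 1..<3 * n - 1]"
  \<comment> \<open>The blocks are sent to the rows 0 to \<open>n - 1\<close>, 1 to
    \<open>n\<close>, and 1 to \<open>n - 2\<close>. The value \<open>n\<close> is used for a
    letter, so this is not an evaluation along a tableau, which would vanish on a non-comb.\<close>
  define r where "r x = (if x \<le> n then x - 1 else if x \<le> 2 * n then x - n else x - 2 * n)" for x
  let ?t = "Br (Br (map Letter ?A) # Br (map Letter ?B) # map Letter ?C)"
  have N: "nletters n 3 = 3 * n - 2" using n by (simp add: nletters_def)
  have lt: "letters ?t = [1..<3 * n - 1]"
  proof -
    have "letters (Br (Br (map Letter A) # Br (map Letter B) # map Letter C)) = A @ B @ C" for A B C :: "nat list"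
      by simp
    then have "letters ?t = ?A @ ?B @ ?C" .
    also have "?B @ ?C = [n + 1..<3 * n - 1]"
      by (rule upt_split) (use n in auto)
    also have "?A @ \<dots> = [1..<3 * n - 1]"
      by (rule upt_split) (use n in auto)
    finally show ?thesis .
  qed
  have br: "?t \<in> bracketings n {1..nletters n 3}"
    using n by (auto simp: bracketings_Br_iff N)
  have "noncomb ?t"
    unfolding noncomb.simps
    by (intro disjI1 exI[of _ 0] exI[of _ "Suc 0"]) (use n in auto)
  moreover have "?t \<in> bracketed_permutations n 3"
    unfolding bracketed_permutations_def mem_Collect_eq lt using br n by (auto simp: N)
  moreover have "alive n (ev r ?t)"
  proof -
    have A: "map r ?A = [0..<n]" by (intro nth_equalityI) (auto simp: r_def simp del: upt_Suc)
    have B: "map r ?B = [1..<n + 1]" by (intro nth_equalityI) (auto simp: r_def simp del: upt_Suc)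
    have C: "map r ?C = [1..<n - 1]" using n by (intro nth_equalityI) (auto simp: r_def simp del: upt_Suc)
    obtain a where a: "a \<noteq> 0" "vprod (map unit_fun [0..<n]) = (\<lambda>i. a * unit_fun n i)"
      using vprod_units[of n "[0..<n]"] by (auto simp: atLeast0LessThan lessThan_Suc[symmetric] lessThan_Suc_atMost)
    have "set (0 # [1..<n + 1]) = {..length [1..<n + 1]}" using n by (auto simp: not_less_eq_eq Suc_le_eq)
    then obtain b where b: "b \<noteq> 0" "vprod (map unit_fun [1..<n + 1]) = (\<lambda>i. b * unit_fun 0 i)"
      using vprod_units[of 0 "[1..<n + 1]"] by (metis One_nat_def distinct.simps(2) distinct_upt not_one_le_zero atLeastLessThan_iff set_upt)
    have "set ((n - 1) # n # 0 # [1..<n - 1]) = {..length (n # 0 # [1..<n - 1])}" using n by (auto simp: not_less_eq_eq Suc_le_eq)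
    moreover have "distinct ((n - 1) # n # 0 # [1..<n - 1])" using n by auto
    ultimately obtain c where c: "c \<noteq> 0" "vprod (map unit_fun (n # 0 # [1..<n - 1])) = (\<lambda>i. c * unit_fun (n - 1) i)"
      using vprod_units[of "n - 1" "n # 0 # [1..<n - 1]"] by blast
    have "ev r ?t i = a * (b * (c * unit_fun (n - 1) i))" for i
    proof -
      let ?vs = "map unit_fun [1..<n - 1] @ [unit_fun i]"
      have "ev r ?t i = cdet ([] @ (\<lambda>i. a * unit_fun n i) # (\<lambda>i. b * unit_fun 0 i) # ?vs)"
        using a b A B C map_ev_Letter[of r ?A] map_ev_Letter[of r ?B] map_ev_Letter[of r ?C]
        by (simp add: vprod_def[of "_ # _"] comp_def del: upt_Suc)
      also have "\<dots> = a * cdet ([unit_fun n] @ (\<lambda>i. b * unit_fun 0 i) # ?vs)"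
        unfolding cdet_scale[of "[]"] by simp
      also have "\<dots> = a * (b * cdet ([unit_fun n] @ unit_fun 0 # ?vs))"
        unfolding cdet_scale[of "[unit_fun n]" b "unit_fun 0"] by (rule refl)
      also have "cdet ([unit_fun n] @ unit_fun 0 # map unit_fun [1..<n - 1] @ [unit_fun i])
          = vprod (map unit_fun (n # 0 # [1..<n - 1])) i"
        by (simp add: vprod_def)
      finally show ?thesis using c by simp
    qed
    then show ?thesis unfolding alive_def
      using a b c by (intro exI[of _ "a * b * c"] exI[of _ "n - 1"]) auto
  qed
  ultimately show ?case by blast
next
  case (step k)
  obtain t r where t: "t \<in> bracketed_permutations n k" "noncomb t" "alive n (ev r t)" using step by blast
  define N where "N = nletters n k"
  let ?B = "[N + 1..<N + n]"
  define r' where "r' x = (if x \<le> N then r x else x - N - 1)" for x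
  have N': "nletters n (Suc k) = N + (n - 1)" by (simp add: N_def nletters_def)
  have tl: "t \<in> bracketings n {1..N}" "distinct (letters t)" "set (letters t) = {1..N}"
    using t(1) by (auto simp: bracketed_permutations_def N_def)
  let ?t = "Br (map Letter ?B @ [t])"
  have "map_btree id t \<in> bracketings n {1..N + (n - 1)}"
    using tl(1) by (rule bracketings_map_btree) auto
  then have "?t \<in> bracketings n {1..N + (n - 1)}"
    using n by (auto simp: bracketings_Br_iff btree.map_id)
  then have "?t \<in> bracketed_permutations n (Suc k)"
    using tl n by (auto simp: bracketed_permutations_def N')
  moreover have "noncomb ?t" using t(2) by simp
  moreover have "alive n (ev r' ?t)"
  proof (rule alive_wrap)
    have "ev r' t = ev r t" using tl by (intro ev_cong) (auto simp: r'_def)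
    then show "alive n (ev r' t)" using t(3) by simp
    show "map r' ?B = [0..<n - 1]" by (intro nth_equalityI) (auto simp: r'_def simp del: upt_Suc)
  qed (use n in simp)
  ultimately show ?case by blast
qed

section \<open>Garnir relations by inclusion-exclusion\<close>

lemma sum_Pow_signs:
  "finite A \<Longrightarrow> (\<Sum>E\<in>Pow A. (-1) ^ card E) = (if A = {} then 1 else 0 :: complex)"
proof (induction A rule: finite_induct)
  case (insert a A)
  have "(\<Sum>E\<in>Pow (insert a A). (-1) ^ card E) = (\<Sum>E\<in>Pow A. (-1) ^ card E) + (\<Sum>E\<in>insert a ` Pow A. (-1) ^ card E :: complex)"
    unfolding Pow_insert using insert by (intro sum.union_disjoint) auto
  also have "(\<Sum>E\<in>insert a ` Pow A. (-1) ^ card E :: complex) = (\<Sum>E\<in>Pow A. - ((-1) ^ card E))"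
  proof (subst sum.reindex)
    show "inj_on (insert a) (Pow A)" using insert by (auto simp: inj_on_def)
    show "sum ((\<lambda>E. (-1) ^ card E) \<circ> insert a) (Pow A) = (\<Sum>E\<in>Pow A. - ((-1) ^ card E) :: complex)"
    proof (intro sum.cong refl)
      fix E assume "E \<in> Pow A"
      then have "finite E" "a \<notin> E" using insert finite_subset by auto
      then show "((\<lambda>E. (-1) ^ card E) \<circ> insert a) E = - ((-1) ^ card E :: complex)" by simp
    qed
  qed
  finally show ?case by (simp add: sum_negf)
qed simp

text \<open>After exchanging the sums, \<open>C\<close> has as weight the alternating sum over the
  subsets of \<open>D \<inter> C\<close>, which is 0 unless \<open>C\<close> misses
  \<open>D\<close>.\<close>

lemma inclusion_exclusion:
  fixes v :: "'a set \<Rightarrow> complex"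
  assumes "finite D" "finite F"
  shows "(\<Sum>C\<in>{C \<in> F. C \<inter> D = {}}. v C) = (\<Sum>E\<in>Pow D. (-1) ^ card E * (\<Sum>C\<in>{C \<in> F. E \<subseteq> C}. v C))"
proof -
  have "(\<Sum>E\<in>Pow D. (-1) ^ card E * (\<Sum>C\<in>{C \<in> F. E \<subseteq> C}. v C))
      = (\<Sum>E\<in>Pow D. \<Sum>C\<in>F. if E \<subseteq> C then (-1) ^ card E * v C else 0)"
    using assms by (intro sum.cong refl) (auto simp: sum_distrib_left sum.inter_filter intro!: sum.cong)
  also have "\<dots> = (\<Sum>C\<in>F. \<Sum>E\<in>Pow D. if E \<subseteq> C then (-1) ^ card E * v C else 0)"
    by (rule sum.swap)
  also have "\<dots> = (\<Sum>C\<in>F. (\<Sum>E\<in>Pow (D \<inter> C). (-1) ^ card E) * v C)"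
  proof (intro sum.cong refl)
    fix C
    have "{E \<in> Pow D. E \<subseteq> C} = Pow (D \<inter> C)" by auto
    then show "(\<Sum>E\<in>Pow D. if E \<subseteq> C then (-1) ^ card E * v C else 0) = (\<Sum>E\<in>Pow (D \<inter> C). (-1) ^ card E) * v C"
      using assms by (simp add: sum.inter_filter[symmetric] sum_distrib_right)
  qed
  also have "\<dots> = (\<Sum>C\<in>F. if C \<inter> D = {} then v C else 0)"
    using assms by (intro sum.cong refl, subst sum_Pow_signs) auto
  also have "\<dots> = (\<Sum>C\<in>{C \<in> F. C \<inter> D = {}}. v C)"
    using assms by (simp add: sum.inter_filter)
  finally show ?thesis by simp
qed

lemma sum_insert_one:
  fixes v :: "'a set \<Rightarrow> complex"
  assumes "finite Y" "D \<subseteq> Y"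
  shows "(\<Sum>C\<in>{C. C \<subseteq> Y \<and> card C = Suc (card D) \<and> D \<subseteq> C}. v C) = (\<Sum>x\<in>Y - D. v (insert x D))"
proof -
  have fD: "finite D" using assms finite_subset by blast
  have "{C. C \<subseteq> Y \<and> card C = Suc (card D) \<and> D \<subseteq> C} = (\<lambda>x. insert x D) ` (Y - D)"
  proof (intro equalityI subsetI)
    fix C assume "C \<in> {C. C \<subseteq> Y \<and> card C = Suc (card D) \<and> D \<subseteq> C}"
    then have C: "C \<subseteq> Y" "card C = Suc (card D)" "D \<subseteq> C" by auto
    then have "card (C - D) = 1" using fD by (simp add: card_Diff_subset)
    then obtain x where "C - D = {x}" by (auto simp: card_1_singleton_iff)
    then show "C \<in> (\<lambda>x. insert x D) ` (Y - D)" using C by (intro image_eqI[of _ _ x]) auto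
  qed (use assms fD in auto)
  moreover have "inj_on (\<lambda>x. insert x D) (Y - D)" by (auto simp: inj_on_def)
  ultimately show ?thesis by (simp add: sum.reindex)
qed

lemma sum_remove_one:
  fixes v :: "'a set \<Rightarrow> complex"
  assumes "finite S" "D \<subseteq> S"
  shows "(\<Sum>C\<in>{C. C \<subseteq> S \<and> Suc (card C) = card S \<and> D \<subseteq> C}. v C) = (\<Sum>x\<in>S - D. v (S - {x}))"
proof -
  have "{C. C \<subseteq> S \<and> Suc (card C) = card S \<and> D \<subseteq> C} = (\<lambda>x. S - {x}) ` (S - D)"
  proof (intro equalityI subsetI)
    fix C assume "C \<in> {C. C \<subseteq> S \<and> Suc (card C) = card S \<and> D \<subseteq> C}"
    then have C: "C \<subseteq> S" "Suc (card C) = card S" "D \<subseteq> C" by auto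
    have "finite C" using C assms finite_subset by blast
    then have "card (S - C) = 1" using C by (simp add: card_Diff_subset)
    then obtain x where "S - C = {x}" by (auto simp: card_1_singleton_iff)
    then show "C \<in> (\<lambda>x. S - {x}) ` (S - D)" using C by (intro image_eqI[of _ _ x]) auto
  next
    fix C assume "C \<in> (\<lambda>x. S - {x}) ` (S - D)"
    then obtain x where x: "x \<in> S" "x \<notin> D" "C = S - {x}" by auto
    then have "Suc (card C) = card S" using assms by (metis card_Suc_Diff1)
    then show "C \<in> {C. C \<subseteq> S \<and> Suc (card C) = card S \<and> D \<subseteq> C}" using x assms by auto
  qed
  moreover have "inj_on (\<lambda>x. S - {x}) (S - D)" by (auto simp: inj_on_def)
  ultimately show ?thesis by (simp add: sum.reindex)
qed

text \<open>The Jacobi identity says that \<open>v\<close> is an eigenvector of the odd graph (disjointness of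
  \<open>n - 1\<close>-subsets of a set of size \<open>2n - 1\<close>) for the eigenvalue of absolute value 1; the other
  eigenvalues have absolute value \<open>n - i\<close> with \<open>i \<le> n - 2\<close>.\<close>

lemma odd_graph:
  fixes v :: "'a set \<Rightarrow> complex"
  assumes Z: "finite Z" "card Z = 2 * n - 1"
    and rel: "\<And>C. C \<subseteq> Z \<Longrightarrow> card C = n - 1 \<Longrightarrow>
      v C = (-1) ^ (n - 1) * (\<Sum>C'\<in>{C'. C' \<subseteq> Z - C \<and> card C' = n - 1}. v C')"
    and D: "D \<subseteq> Z" "card D + 2 \<le> n"
  shows "(\<Sum>C\<in>{C. C \<subseteq> Z \<and> card C = n - 1 \<and> D \<subseteq> C}. v C) = 0"
  using D
proof (induction "card D" arbitrary: D rule: less_induct)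
  case less
  define F where "F = {C. C \<subseteq> Z \<and> card C = n - 1}"
  define s where "s D = (\<Sum>C\<in>{C \<in> F. D \<subseteq> C}. v C)" for D
  define i where "i = card D"
  have fF: "finite F" unfolding F_def using Z by simp
  have fD: "finite D" using less Z finite_subset by blast
  \<comment> \<open>The complement of \<open>C'\<close> has \<open>n\<close> elements, and
    \<open>C\<close> arises from it by omitting one element outside \<open>D\<close>; this gives
    \<open>n - i\<close> choices.\<close>
  have count: "(\<Sum>C\<in>{C \<in> F. D \<subseteq> C}. if C \<inter> C' = {} then 1 else 0 :: complex) = (if C' \<inter> D = {} then of_nat (n - i) else 0)"
    if C': "C' \<in> F" for C'
  proof (cases "C' \<inter> D = {}")
    case True
    have fC': "finite C'" using C' Z finite_subset by (auto simp: F_def)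
    have cS: "card (Z - C') = n" using C' Z less by (auto simp: F_def card_Diff_subset[OF fC'])
    have sub: "D \<subseteq> Z - C'" using True less by auto
    have "(\<Sum>C\<in>{C \<in> F. D \<subseteq> C}. if C \<inter> C' = {} then 1 else 0 :: complex)
        = (\<Sum>C\<in>{C. C \<subseteq> Z - C' \<and> Suc (card C) = card (Z - C') \<and> D \<subseteq> C}. 1)"
    proof -
      have "{C \<in> {C \<in> F. D \<subseteq> C}. C \<inter> C' = {}} = {C. C \<subseteq> Z - C' \<and> Suc (card C) = card (Z - C') \<and> D \<subseteq> C}"
        using cS less(3) by (auto simp: F_def)
      moreover have "finite {C \<in> F. D \<subseteq> C}" using fF by simp
      ultimately show ?thesis by (simp only: sum.inter_filter[symmetric])
    qed
    also have "\<dots> = (\<Sum>x\<in>Z - C' - D. 1)" using Z sub by (intro sum_remove_one) auto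
    also have "\<dots> = of_nat (n - i)" using cS sub fD by (simp add: card_Diff_subset i_def)
    finally show ?thesis using True by simp
  next
    case False
    then have "(\<Sum>C\<in>{C \<in> F. D \<subseteq> C}. if C \<inter> C' = {} then 1 else 0 :: complex) = 0"
      by (intro sum.neutral) auto
    then show ?thesis using False by simp
  qed
  have "s D = (\<Sum>C\<in>{C \<in> F. D \<subseteq> C}. (-1) ^ (n - 1) * (\<Sum>C'\<in>F. if C \<inter> C' = {} then v C' else 0))"
    unfolding s_def
  proof (intro sum.cong refl)
    fix C assume "C \<in> {C \<in> F. D \<subseteq> C}"
    then have C: "C \<subseteq> Z" "card C = n - 1" by (auto simp: F_def)
    have "{C' \<in> F. C \<inter> C' = {}} = {C'. C' \<subseteq> Z - C \<and> card C' = n - 1}"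
      by (auto simp: F_def)
    then show "v C = (-1) ^ (n - 1) * (\<Sum>C'\<in>F. if C \<inter> C' = {} then v C' else 0)"
      using rel[OF C] fF by (simp add: sum.inter_filter[symmetric])
  qed
  also have "\<dots> = (-1) ^ (n - 1) * (\<Sum>C'\<in>F. (\<Sum>C\<in>{C \<in> F. D \<subseteq> C}. if C \<inter> C' = {} then 1 else 0) * v C')"
    unfolding sum_distrib_left[symmetric] sum_distrib_right
    by (subst sum.swap) (auto intro!: arg_cong[of _ _ "(*) _"] sum.cong)
  also have "\<dots> = (-1) ^ (n - 1) * (of_nat (n - i) * (\<Sum>C'\<in>{C' \<in> F. C' \<inter> D = {}}. v C'))"
    using fF by (simp add: count sum_distrib_left sum.inter_filter if_distrib[of "\<lambda>x. x * _"] if_distrib[of "\<lambda>x. _ * x"] cong: if_cong)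
  \<comment> \<open>Avoiding \<open>D\<close> is expressed by containing subsets of
    \<open>D\<close>; the proper subsets contribute 0 by induction, so only \<open>s D\<close>
    itself is left.\<close>
  also have "(\<Sum>C'\<in>{C' \<in> F. C' \<inter> D = {}}. v C') = (\<Sum>E\<in>Pow D. (-1) ^ card E * s E)"
    unfolding s_def using fD fF by (rule inclusion_exclusion)
  also have "\<dots> = (\<Sum>E\<in>{D}. (-1) ^ card E * s E)"
  proof (rule sum.mono_neutral_right)
    show "\<forall>E\<in>Pow D - {D}. (-1) ^ card E * s E = 0"
    proof
      fix E assume "E \<in> Pow D - {D}"
      then have "E \<subset> D" by auto
      then have "card E < card D" using fD by (rule psubset_card_mono[rotated])
      then have "s E = 0" using less.hyps[of E] less.prems \<open>E \<subset> D\<close> by (auto simp: s_def F_def conj_ac)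
      then show "(-1) ^ card E * s E = 0" by simp
    qed
  qed (use fD in auto)
  \<comment> \<open>The factor of \<open>s D\<close> on the right is an integer of absolute value
    \<open>n - i\<close>, at least 2, so \<open>s D\<close> must be 0.\<close>
  finally have eq: "s D = ((-1) ^ (n - 1) * (-1) ^ i) * (of_nat (n - i) * s D)"
    by (simp add: i_def mult_ac)
  have "s D = 0"
  proof (rule ccontr)
    assume ne: "s D \<noteq> 0"
    define e where "e = (-1) ^ (n - 1) * (-1 :: complex) ^ i"
    have e: "e = 1 \<or> e = -1"
      unfolding e_def power_add[symmetric] by (cases "even (n - 1 + i)") auto
    have "(e * of_nat (n - i)) * s D = 1 * s D"
      using eq by (simp only: e_def mult.assoc mult_1)
    then have "e * of_nat (n - i) = 1" using ne by (simp only: mult_cancel_right) simp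
    then have "(of_nat (n - i) :: complex) = 1 \<or> (of_nat (n - i) :: complex) = -1"
      using e by (metis minus_minus mult_1 mult_minus_left)
    moreover have "n - i \<noteq> 1" using less.prems by (simp add: i_def)
    ultimately have "(of_nat (n - i) :: complex) = - of_nat 1"
      by (metis of_nat_1 of_nat_eq_iff)
    then have "(of_nat (n - i + 1) :: complex) = 0" by simp
    then show False by (metis add_is_0 of_nat_eq_0_iff one_neq_zero)
  qed
  then show ?case by (simp add: s_def F_def conj_ac)
qed

text \<open>For two columns of equal length, the relations with the first column kill everything beyond
  one exchange, and the symmetry of the two columns kills the rest.\<close>

lemma equal_columns:
  fixes v :: "'a set \<Rightarrow> 'a set \<Rightarrow> complex"
  assumes Z: "finite Z" "card Z = 3 * n - 2" and n: "n \<ge> 2"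
    and G1: "\<And>P A. P \<subseteq> Z \<Longrightarrow> card P = n + 1 \<Longrightarrow> A \<subseteq> Z - P \<Longrightarrow> card A = n - 2 \<Longrightarrow> (\<Sum>q\<in>P. v (P - {q}) (insert q A)) = 0"
    and G2: "\<And>P A. P \<subseteq> Z \<Longrightarrow> card P = n + 1 \<Longrightarrow> A \<subseteq> Z - P \<Longrightarrow> card A = n - 1 \<Longrightarrow> (\<Sum>q\<in>P. v (P - {q}) A) = 0"
    and S: "\<And>X A. X \<subseteq> Z \<Longrightarrow> card X = n \<Longrightarrow> A \<subseteq> Z - X \<Longrightarrow> card A = n - 1 \<Longrightarrow> v X A = (-1) ^ (n - 1) * v X (Z - X - A)"
    and X: "X \<subseteq> Z" "card X = n" and D: "D \<subseteq> Z - X" "card D = n - 2"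
  shows "(\<Sum>q\<in>Z - X - D. v X (insert q D)) = 0"
proof -
  define Y where "Y = Z - X"
  have fX: "finite X" using X Z finite_subset by blast
  have fY: "finite Y" using Z by (simp add: Y_def)
  have fD: "finite D" using D fY finite_subset by (auto simp: Y_def)
  have cY: "card Y = 2 * n - 2" using X Z by (simp add: Y_def card_Diff_subset[OF fX])
  define F where "F = {A. A \<subseteq> Y \<and> card A = n - 1}"
  have fF: "finite F" using fY by (simp add: F_def)
  define g where "g E = (\<Sum>A\<in>{A \<in> F. E \<subseteq> A}. v X A)" for E
  \<comment> \<open>The bound on \<open>E\<close> leaves at least \<open>2 * n + 1\<close> letters
    outside \<open>E\<close>. Thus after removing any part of the first column \<open>X\<close>
    there are still \<open>n + 1\<close> letters, enough for the relation \<open>wS\<close>;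
    inclusion-exclusion over \<open>X\<close> then isolates \<open>w X\<close>.\<close>
  have avoid: "(\<Sum>A\<in>{A \<in> F. A \<inter> E = {}}. v X A) = 0" if E: "E \<subseteq> Y" "card E + 3 \<le> n" for E
  proof -
    define Z' where "Z' = Z - E"
    have fZ': "finite Z'" using Z by (simp add: Z'_def)
    have XZ': "X \<subseteq> Z'" using E X by (auto simp: Z'_def Y_def)
    have cZ': "2 * n + 1 \<le> card Z'"
    proof -
      have "finite E" "E \<subseteq> Z" using E fY finite_subset by (auto simp: Y_def)
      then show ?thesis using Z E by (simp add: Z'_def card_Diff_subset)
    qed
    define w where "w X = (\<Sum>A\<in>{A. A \<subseteq> Z' - X \<and> card A = n - 1}. v X A)" for X
    \<comment> \<open>A second column disjoint from \<open>P - {q}\<close> either avoids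
      \<open>P\<close>, where \<open>G2\<close> applies, or contains \<open>q\<close>, where
      \<open>G1\<close> applies.\<close>
    have wP: "(\<Sum>q\<in>P. w (P - {q})) = 0" if P: "P \<subseteq> Z'" "card P = n + 1" for P
    proof -
      have fP: "finite P" using P fZ' finite_subset by blast
      have PZ: "P \<subseteq> Z" using P by (auto simp: Z'_def)
      let ?R = "Z' - P"
      have "w (P - {q}) = (\<Sum>A\<in>{A. A \<subseteq> ?R \<and> card A = n - 1}. v (P - {q}) A) + (\<Sum>A\<in>{A. A \<subseteq> ?R \<and> card A = n - 2}. v (P - {q}) (insert q A))"
        if q: "q \<in> P" for q
      proof -
        have split: "{A. A \<subseteq> Z' - (P - {q}) \<and> card A = n - 1} =
          {A. A \<subseteq> ?R \<and> card A = n - 1} \<union> insert q ` {A. A \<subseteq> ?R \<and> card A = n - 2}" (is "?L = ?A \<union> ?B")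
        proof (intro equalityI subsetI)
          fix A assume A: "A \<in> ?L"
          show "A \<in> ?A \<union> ?B"
          proof (cases "q \<in> A")
            case True
            have "finite A" using A fZ' finite_subset by blast
            then have "card (A - {q}) = n - 2" using A True by simp
            moreover have "A = insert q (A - {q})" using True by auto
            ultimately have "A \<in> ?B" using A by (intro image_eqI[of _ _ "A - {q}"]) auto
            then show ?thesis ..
          next
            case False then show ?thesis using A by auto
          qed
        next
          fix A assume "A \<in> ?A \<union> ?B"
          then show "A \<in> ?L"
          proof
            assume "A \<in> ?A" then show ?thesis by auto
          next
            assume "A \<in> ?B"
            then obtain B where B: "B \<subseteq> ?R" "card B = n - 2" "A = insert q B" by auto
            have "finite B" "q \<notin> B" using B q fZ' finite_subset by auto
            then show ?thesis using B q P n by auto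
          qed
        qed
        have "w (P - {q}) = (\<Sum>A\<in>?A. v (P - {q}) A) + (\<Sum>A\<in>?B. v (P - {q}) A)"
          unfolding w_def split by (rule sum.union_disjoint) (use fZ' q in auto)
        moreover have "inj_on (insert q) {A. A \<subseteq> ?R \<and> card A = n - 2}"
        proof (rule inj_onI)
          fix A B assume "A \<in> {A. A \<subseteq> ?R \<and> card A = n - 2}" "B \<in> {A. A \<subseteq> ?R \<and> card A = n - 2}"
          then have "q \<notin> A" "q \<notin> B" using q by auto
          moreover assume "insert q A = insert q B"
          ultimately show "A = B" by (metis insert_ident)
        qed
        ultimately show ?thesis by (simp add: sum.reindex)
      qed
      then have "(\<Sum>q\<in>P. w (P - {q})) = (\<Sum>A\<in>{A. A \<subseteq> ?R \<and> card A = n - 1}. \<Sum>q\<in>P. v (P - {q}) A)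
        + (\<Sum>A\<in>{A. A \<subseteq> ?R \<and> card A = n - 2}. \<Sum>q\<in>P. v (P - {q}) (insert q A))"
        by (simp add: sum.distrib sum.swap[of _ P])
      also have "(\<Sum>A\<in>{A. A \<subseteq> ?R \<and> card A = n - 1}. \<Sum>q\<in>P. v (P - {q}) A) = 0"
      proof (rule sum.neutral, rule ballI)
        fix A assume "A \<in> {A. A \<subseteq> ?R \<and> card A = n - 1}"
        then show "(\<Sum>q\<in>P. v (P - {q}) A) = 0" using P PZ by (intro G2) (auto simp: Z'_def)
      qed
      also have "(\<Sum>A\<in>{A. A \<subseteq> ?R \<and> card A = n - 2}. \<Sum>q\<in>P. v (P - {q}) (insert q A)) = 0"
      proof (rule sum.neutral, rule ballI)
        fix A assume "A \<in> {A. A \<subseteq> ?R \<and> card A = n - 2}"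
        then show "(\<Sum>q\<in>P. v (P - {q}) (insert q A)) = 0" using P PZ by (intro G1) (auto simp: Z'_def)
      qed
      finally show ?thesis by simp
    qed
    \<comment> \<open>Summing \<open>wP\<close> over all \<open>P\<close> inside \<open>S\<close>
      counts each \<open>n\<close>-subset \<open>card S - n\<close> times, a positive
      number.\<close>
    have wS: "(\<Sum>X\<in>{X. X \<subseteq> S \<and> card X = n}. w X) = 0" if S: "S \<subseteq> Z'" "n + 1 \<le> card S" for S
    proof -
      have fS: "finite S" using S fZ' finite_subset by blast
      let ?Ps = "{P. P \<subseteq> S \<and> card P = n + 1}" and ?Xs = "{X. X \<subseteq> S \<and> card X = n}"
      have "0 = (\<Sum>P\<in>?Ps. \<Sum>q\<in>P. w (P - {q}))"
      proof (rule sum.neutral[symmetric], rule ballI)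
        fix P assume "P \<in> ?Ps"
        then show "(\<Sum>q\<in>P. w (P - {q})) = 0" using S by (intro wP) auto
      qed
      also have "\<dots> = (\<Sum>P\<in>?Ps. \<Sum>X\<in>{X \<in> ?Xs. X \<subseteq> P}. w X)"
      proof (intro sum.cong refl)
        fix P assume P: "P \<in> ?Ps"
        then have fP: "finite P" using fS finite_subset by blast
        have "{X \<in> ?Xs. X \<subseteq> P} = {X. X \<subseteq> P \<and> Suc (card X) = card P \<and> {} \<subseteq> X}" using P by auto
        then show "(\<Sum>q\<in>P. w (P - {q})) = (\<Sum>X\<in>{X \<in> ?Xs. X \<subseteq> P}. w X)"
          using sum_remove_one[OF fP, of "{}" w] by simp
      qed
      also have "\<dots> = (\<Sum>X\<in>?Xs. \<Sum>P\<in>{P \<in> ?Ps. X \<subseteq> P}. w X)"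
        using fS by (intro sum.swap_restrict) auto
      also have "\<dots> = (\<Sum>X\<in>?Xs. of_nat (card S - n) * w X)"
      proof (intro sum.cong refl)
        fix X assume X: "X \<in> ?Xs"
        then have fX: "finite X" using fS finite_subset by blast
        have "{P \<in> ?Ps. X \<subseteq> P} = {P. P \<subseteq> S \<and> card P = Suc (card X) \<and> X \<subseteq> P}" using X by auto
        then have "(\<Sum>P\<in>{P \<in> ?Ps. X \<subseteq> P}. w X) = (\<Sum>x\<in>S - X. w X)"
          using sum_insert_one[OF fS, of X "\<lambda>_. w X"] X by simp
        then show "(\<Sum>P\<in>{P \<in> ?Ps. X \<subseteq> P}. w X) = of_nat (card S - n) * w X"
          using X fX by (simp add: card_Diff_subset)
      qed
      finally have "of_nat (card S - n) * (\<Sum>X\<in>?Xs. w X) = 0" by (simp add: sum_distrib_left)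
      then show ?thesis using S by auto
    qed
    let ?Xs = "{X'. X' \<subseteq> Z' \<and> card X' = n}"
    have fXs: "finite ?Xs" using fZ' by simp
    have "w X = (\<Sum>X'\<in>?Xs. if X' = X then w X' else 0)"
      using fXs XZ' X by simp
    also have "\<dots> = (\<Sum>X'\<in>?Xs. (\<Sum>D\<in>Pow (X - X'). (-1) ^ card D) * w X')"
    proof (intro sum.cong refl)
      fix X' assume X': "X' \<in> ?Xs"
      have "X - X' = {} \<longleftrightarrow> X' = X"
      proof
        assume "X - X' = {}"
        then have "X \<subseteq> X'" by auto
        moreover have "finite X'" using X' fZ' finite_subset by blast
        ultimately show "X' = X" using X X' by (metis (mono_tags, lifting) card_subset_eq mem_Collect_eq)
      qed auto
      then show "(if X' = X then w X' else 0) = (\<Sum>D\<in>Pow (X - X'). (-1) ^ card D) * w X'"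
        using fX by (simp add: sum_Pow_signs)
    qed
    also have "\<dots> = (\<Sum>X'\<in>?Xs. \<Sum>D\<in>{D \<in> Pow X. D \<inter> X' = {}}. (-1) ^ card D * w X')"
    proof (intro sum.cong refl)
      fix X'
      have "Pow (X - X') = {D \<in> Pow X. D \<inter> X' = {}}" by auto
      then show "(\<Sum>D\<in>Pow (X - X'). (-1) ^ card D) * w X' = (\<Sum>D\<in>{D \<in> Pow X. D \<inter> X' = {}}. (-1) ^ card D * w X')"
        by (simp add: sum_distrib_right)
    qed
    also have "\<dots> = (\<Sum>D\<in>Pow X. \<Sum>X'\<in>{X' \<in> ?Xs. D \<inter> X' = {}}. (-1) ^ card D * w X')"
      using fXs fX by (intro sum.swap_restrict) auto
    also have "\<dots> = 0"
    proof (rule sum.neutral, rule ballI)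
      fix D assume D: "D \<in> Pow X"
      have fD: "finite D" using D fX finite_subset by auto
      have "card D \<le> n" using D X fX card_mono by auto
      then have "n + 1 \<le> card (Z' - D)"
        using cZ' D XZ' fD by (simp add: card_Diff_subset order.trans)
      moreover have "{X' \<in> ?Xs. D \<inter> X' = {}} = {X'. X' \<subseteq> Z' - D \<and> card X' = n}" by auto
      ultimately show "(\<Sum>X'\<in>{X' \<in> ?Xs. D \<inter> X' = {}}. (-1) ^ card D * w X') = 0"
        using wS[of "Z' - D"] by (simp add: sum_distrib_left[symmetric])
    qed
    finally have "w X = 0" .
    moreover have "{A \<in> F. A \<inter> E = {}} = {A. A \<subseteq> Z' - X \<and> card A = n - 1}"
      by (auto simp: F_def Z'_def Y_def)
    ultimately show ?thesis by (simp add: w_def)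
  qed
  \<comment> \<open>Complementation in \<open>Y\<close> exchanges the two later columns and turns
    containing \<open>E\<close> into avoiding \<open>E\<close>.\<close>
  have flip: "g E = (-1) ^ (n - 1) * (\<Sum>A\<in>{A \<in> F. A \<inter> E = {}}. v X A)" if E: "E \<subseteq> Y" for E
  proof -
    have bij: "bij_betw (\<lambda>A. Y - A) {A \<in> F. E \<subseteq> A} {A \<in> F. A \<inter> E = {}}"
    proof (rule bij_betwI[where g = "\<lambda>A. Y - A"])
      have c: "card (Y - A) = n - 1" if "A \<subseteq> Y" "card A = n - 1" for A
        using that cY fY n by (simp add: card_Diff_subset finite_subset)
      show "(\<lambda>A. Y - A) \<in> {A \<in> F. E \<subseteq> A} \<rightarrow> {A \<in> F. A \<inter> E = {}}" using c by (auto simp: F_def)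
      show "(\<lambda>A. Y - A) \<in> {A \<in> F. A \<inter> E = {}} \<rightarrow> {A \<in> F. E \<subseteq> A}" using c E by (auto simp: F_def)
    qed (auto simp: F_def)
    have "g E = (\<Sum>A\<in>{A \<in> F. E \<subseteq> A}. (-1) ^ (n - 1) * v X (Y - A))"
      unfolding g_def using X by (intro sum.cong refl) (auto simp: F_def Y_def S)
    also have "\<dots> = (-1) ^ (n - 1) * (\<Sum>A\<in>{A \<in> F. A \<inter> E = {}}. v X A)"
      unfolding sum_distrib_left[symmetric] using sum.reindex_bij_betw[OF bij, of "v X"] by simp
    finally show ?thesis .
  qed
  have gE: "g E = 0" if "E \<subseteq> Y" "card E + 3 \<le> n" for E
    using flip[OF that(1)] avoid[OF that] by simp
  \<comment> \<open>Every proper subset of \<open>D\<close> has at most \<open>n - 3\<close>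
    elements and is covered by \<open>gE\<close>. What remains is \<open>g D\<close> times the sign
    \<open>(-1) ^ (n - 1) * (-1) ^ (n - 2)\<close>, which is -1.\<close>
  have "g D = (-1) ^ (n - 1) * (\<Sum>E\<in>Pow D. (-1) ^ card E * g E)"
    using flip[of D] D inclusion_exclusion[OF fD fF, of "v X"] by (simp add: g_def Y_def)
  also have "(\<Sum>E\<in>Pow D. (-1) ^ card E * g E) = (\<Sum>E\<in>{D}. (-1) ^ card E * g E)"
  proof (rule sum.mono_neutral_right)
    show "\<forall>E\<in>Pow D - {D}. (-1) ^ card E * g E = 0"
    proof
      fix E assume "E \<in> Pow D - {D}"
      then have "E \<subset> D" by auto
      then have "card E < card D" using fD by (rule psubset_card_mono[rotated])
      then have "g E = 0" using gE[of E] D \<open>E \<subset> D\<close> by (auto simp: Y_def)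
      then show "(-1) ^ card E * g E = 0" by simp
    qed
  qed (use fD in auto)
  also have "(-1) ^ (n - 1) * (\<Sum>E\<in>{D}. (-1) ^ card E * g E) = ((-1) ^ (n - 1) * (-1) ^ (n - 2)) * g D"
    using D by simp
  also have "(-1) ^ (n - 1) * (-1) ^ (n - 2) = (-1 :: complex)"
  proof -
    have "n - 1 = Suc (n - 2)" using n by simp
    then show ?thesis by (simp add: power_mult_distrib[symmetric])
  qed
  finally have "g D = 0" by simp
  moreover have "{A \<in> F. D \<subseteq> A} = {C. C \<subseteq> Y \<and> card C = Suc (card D) \<and> D \<subseteq> C}"
    using D n by (auto simp: F_def)
  ultimately show ?thesis
    using sum_insert_one[OF fY, of D "v X"] D by (simp add: g_def Y_def)
qed

section \<open>Garnir relations for functions of colorings\<close>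

definition admissible :: "nat \<Rightarrow> nat \<Rightarrow> nat set \<Rightarrow> (nat \<Rightarrow> nat) \<Rightarrow> bool"
  where "admissible n k S h \<longleftrightarrow> (\<forall>a\<in>S. h a < k) \<and> card {a\<in>S. h a = 0} = n \<and>
    (\<forall>j. 1 \<le> j \<and> j < k \<longrightarrow> card {a\<in>S. h a = j} = n - 1)"

text \<open>A coloring gives each letter its column. The assumptions are the relations between combs
  after multiplication by the sign of the word: \<open>sym\<close> comes from the commutation of
  blocks, \<open>jac\<close> from the Jacobi identity, and the factor is the sign of exchanging two
  blocks of \<open>n - 1\<close> letters. Column antisymmetry is built in, since \<open>V\<close>
  sees no order within a column.\<close>

locale garnir_coloring =
  fixes V :: "(nat \<Rightarrow> nat) \<Rightarrow> complex" and S :: "nat set" and n k :: nat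
  assumes fin: "finite S" and n: "n \<ge> 2"
    and V_cong: "\<And>h h'. (\<And>a. a \<in> S \<Longrightarrow> h a = h' a) \<Longrightarrow> V h = V h'"
    and sym: "\<And>h j l. admissible n k S h \<Longrightarrow> 1 \<le> j \<Longrightarrow> j < k \<Longrightarrow> 1 \<le> l \<Longrightarrow> l < k \<Longrightarrow> j \<noteq> l \<Longrightarrow>
      V (Transposition.transpose j l \<circ> h) = (-1) ^ (n - 1) * V h"
    and jac: "\<And>h l. admissible n k S h \<Longrightarrow> 1 \<le> l \<Longrightarrow> l < k \<Longrightarrow>
      V h = (-1) ^ (n - 1) * (\<Sum>x\<in>{x\<in>S. h x = 0}. V ((Transposition.transpose 0 l \<circ> h)(x := 0)))"
begin

abbreviation "adm \<equiv> admissible n k S"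

text \<open>Only the letters of colors 0 and \<open>l\<close> vary, so \<open>V\<close> becomes a
  function of the set of those with color \<open>l\<close>. In \<open>odd_graph\<close>, with
  \<open>D\<close> the column \<open>l\<close> without \<open>q\<close>, the sum consists of the
  given coloring and of its exchanges of \<open>q\<close> with the letters of color 0.\<close>

lemma garnir_first:
  assumes h: "adm h" and l: "1 \<le> l" "l < k" and q: "q \<in> S" "h q = l"
  shows "V h + (\<Sum>x\<in>{x\<in>S. h x = 0}. V (h(x := l, q := 0))) = 0"
proof -
  define Z where "Z = {a\<in>S. h a = 0 \<or> h a = l}"
  define hc where "hc C a = (if a \<in> C then l else if a \<in> Z then 0 else h a)" for C a
  define D where "D = {a\<in>S. h a = l} - {q}"
  have fZ: "finite Z" using fin by (simp add: Z_def)
  have cZ: "card Z = 2 * n - 1"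
  proof -
    have "Z = {a\<in>S. h a = 0} \<union> {a\<in>S. h a = l}" by (auto simp: Z_def)
    then have "card Z = card {a\<in>S. h a = 0} + card {a\<in>S. h a = l}"
      using fin l by (simp add: card_Un_disjoint disjoint_iff)
    then show ?thesis using h l n by (simp add: admissible_def)
  qed
  have adm_hc: "adm (hc C)" if C: "C \<subseteq> Z" "card C = n - 1" for C
  proof -
    have fC: "finite C" using C fZ finite_subset by blast
    have "{a\<in>S. hc C a = 0} = Z - C" using C l by (auto simp: hc_def Z_def)
    then have "card {a\<in>S. hc C a = 0} = n" using C cZ fC n by (simp add: card_Diff_subset)
    moreover have "card {a\<in>S. hc C a = j} = n - 1" if j: "1 \<le> j" "j < k" for j
    proof (cases "j = l")
      case True
      then have "{a\<in>S. hc C a = j} = C" using C l by (auto simp: hc_def Z_def)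
      then show ?thesis using C by simp
    next
      case False
      then have "{a\<in>S. hc C a = j} = {a\<in>S. h a = j}" using C j by (auto simp: hc_def Z_def)
      then show ?thesis using h j by (simp add: admissible_def)
    qed
    moreover have "\<forall>a\<in>S. hc C a < k" using h l by (auto simp: hc_def admissible_def)
    ultimately show ?thesis by (simp add: admissible_def)
  qed
  \<comment> \<open>The \<open>(n - 1)\<close>-subsets disjoint from \<open>C\<close> are the sets
    \<open>Z - C - {x}\<close>, so \<open>jac\<close> is exactly the eigenvector equation.\<close>
  have rel: "V (hc C) = (-1) ^ (n - 1) * (\<Sum>C'\<in>{C'. C' \<subseteq> Z - C \<and> card C' = n - 1}. V (hc C'))"
    if C: "C \<subseteq> Z" "card C = n - 1" for C
  proof -
    have fC: "finite C" using C fZ finite_subset by blast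
    have c: "card (Z - C) = n" using C cZ fC n by (simp add: card_Diff_subset)
    have zero: "{a\<in>S. hc C a = 0} = Z - C" using C l by (auto simp: hc_def Z_def)
    have "{C'. C' \<subseteq> Z - C \<and> card C' = n - 1} = {C'. C' \<subseteq> Z - C \<and> Suc (card C') = card (Z - C) \<and> {} \<subseteq> C'}"
      using c n by auto
    then have "(\<Sum>C'\<in>{C'. C' \<subseteq> Z - C \<and> card C' = n - 1}. V (hc C')) = (\<Sum>x\<in>Z - C. V (hc (Z - C - {x})))"
      using sum_remove_one[of "Z - C" "{}" "\<lambda>C'. V (hc C')"] fZ by simp
    also have "\<dots> = (\<Sum>x\<in>Z - C. V ((Transposition.transpose 0 l \<circ> hc C)(x := 0)))"
      using C l by (intro sum.cong refl V_cong) (auto simp: hc_def Z_def Transposition.transpose_def)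
    finally show ?thesis using jac[OF adm_hc[OF C] l] by (simp add: zero)
  qed
  have DZ: "D \<subseteq> Z" by (auto simp: D_def Z_def)
  have cD: "Suc (card D) = n - 1" using h l q fin n by (simp add: D_def admissible_def card.remove[symmetric])
  have "(\<Sum>C\<in>{C. C \<subseteq> Z \<and> card C = n - 1 \<and> D \<subseteq> C}. V (hc C)) = 0"
    using cD by (intro odd_graph[OF fZ cZ rel DZ]) auto
  then have "(\<Sum>x\<in>Z - D. V (hc (insert x D))) = 0"
    using sum_insert_one[OF fZ DZ, of "\<lambda>C. V (hc C)"] by (simp add: cD)
  moreover have "Z - D = insert q {x\<in>S. h x = 0}" using q l by (auto simp: Z_def D_def)
  moreover have "V (hc (insert q D)) = V h"
    using q l by (intro V_cong) (auto simp: hc_def Z_def D_def)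
  moreover have "V (hc (insert x D)) = V (h(x := l, q := 0))" if "x \<in> S" "h x = 0" for x
    using q l that by (intro V_cong) (auto simp: hc_def Z_def D_def)
  ultimately show ?thesis using q l fin by simp
qed

text \<open>The relations of \<open>garnir_first\<close> for the columns \<open>j\<close> and
  \<open>l\<close> are \<open>G1\<close> and \<open>G2\<close> of \<open>equal_columns\<close>, and
  \<open>sym\<close> supplies its symmetry.\<close>

lemma garnir_equal:
  assumes h: "adm h" and j: "1 \<le> j" "j < k" and l: "1 \<le> l" "l < k" "j \<noteq> l" and q: "q \<in> S" "h q = l"
  shows "V h + (\<Sum>x\<in>{x\<in>S. h x = j}. V (h(x := l, q := j))) = 0"
proof -
  define Z where "Z = {a\<in>S. h a = 0 \<or> h a = j \<or> h a = l}"
  define hc where "hc X A a = (if a \<in> X then 0 else if a \<in> A then j else if a \<in> Z then l else h a)" for X A a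
  define X where "X = {a\<in>S. h a = 0}"
  define D where "D = {a\<in>S. h a = l} - {q}"
  have fZ: "finite Z" using fin by (simp add: Z_def)
  have cZ: "card Z = 3 * n - 2"
  proof -
    define A B C where "A = {a\<in>S. h a = 0}" and "B = {a\<in>S. h a = j}" and "C = {a\<in>S. h a = l}"
    have "Z = A \<union> B \<union> C" by (auto simp: Z_def A_def B_def C_def)
    moreover have "A \<inter> B = {}" "(A \<union> B) \<inter> C = {}" using l j by (auto simp: A_def B_def C_def)
    moreover have "finite A" "finite B" "finite C" using fin by (auto simp: A_def B_def C_def)
    ultimately have "card Z = card A + card B + card C" by (simp add: card_Un_disjoint)
    moreover have "card A = n" "card B = n - 1" "card C = n - 1"
      using h l j by (auto simp: admissible_def A_def B_def C_def)
    ultimately show ?thesis using n by simp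
  qed
  have sub: "Z \<subseteq> S" by (auto simp: Z_def)
  have adm_hc: "adm (hc X A)" if X: "X \<subseteq> Z" "card X = n" and A: "A \<subseteq> Z - X" "card A = n - 1" for X A
  proof -
    have fX: "finite X" "finite A" using X A fZ finite_subset by blast+
    have "{a\<in>S. hc X A a = 0} = X" using X l j sub by (auto simp: hc_def Z_def)
    then have "card {a\<in>S. hc X A a = 0} = n" using X by simp
    moreover have "card {a\<in>S. hc X A a = i} = n - 1" if i: "1 \<le> i" "i < k" for i
    proof -
      consider "i = j" | "i = l" "i \<noteq> j" | "i \<noteq> l" "i \<noteq> j" by blast
      then show ?thesis
      proof cases
        case 1
        then have "{a\<in>S. hc X A a = i} = A" using X A l j sub by (auto simp: hc_def Z_def)
        then show ?thesis using A by simp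
      next
        case 2
        then have "{a\<in>S. hc X A a = i} = Z - X - A" using X A l j sub by (auto simp: hc_def Z_def)
        then show ?thesis using X A cZ fX n by (simp add: card_Diff_subset)
      next
        case 3
        then have "{a\<in>S. hc X A a = i} = {a\<in>S. h a = i}" using X A i by (auto simp: hc_def Z_def)
        then show ?thesis using h i by (simp add: admissible_def)
      qed
    qed
    moreover have "\<forall>a\<in>S. hc X A a < k" using h l j by (auto simp: hc_def admissible_def)
    ultimately show ?thesis by (simp add: admissible_def)
  qed
  have remove: "(\<Sum>q\<in>P. f q) = f p + (\<Sum>q\<in>P - {p}. f q)" if "p \<in> P" "P \<subseteq> Z" for P p and f :: "nat \<Rightarrow> complex"
    using that fZ finite_subset by (blast intro: sum.remove)
  have ex: "\<exists>p. p \<in> P" if "card P = n + 1" for P :: "nat set"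
    using that by (cases "P = {}") auto
  \<comment> \<open>\<open>D\<close> comes from color \<open>l\<close> but receives color
    \<open>j\<close> here; every term is therefore the wanted one with the two colors exchanged, and
    \<open>sym\<close> turns them back with a common sign.\<close>
  have "(\<Sum>q\<in>Z - X - D. V (hc X (insert q D))) = 0"
  proof (rule equal_columns[OF fZ cZ n])
    fix P A assume P: "P \<subseteq> Z" "card P = n + 1" and A: "A \<subseteq> Z - P" "card A = n - 2"
    obtain p where p: "p \<in> P" using ex[OF P(2)] by blast
    have fA: "finite A" "finite P" using A P fZ finite_subset by blast+
    let ?h = "hc (P - {p}) (insert p A)"
    have "p \<notin> A" using A p by auto
    then have adm: "adm ?h" using P A p fA n by (intro adm_hc) auto
    have "V ?h + (\<Sum>x\<in>{x\<in>S. ?h x = 0}. V (?h(x := j, p := 0))) = 0"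
      using p P sub by (intro garnir_first[OF adm j]) (auto simp: hc_def)
    moreover have "{x\<in>S. ?h x = 0} = P - {p}" using P j l sub by (auto simp: hc_def Z_def)
    moreover have "V (?h(x := j, p := 0)) = V (hc (P - {x}) (insert x A))" if "x \<in> P - {p}" for x
      using that p A by (intro V_cong) (auto simp: hc_def)
    ultimately show "(\<Sum>q\<in>P. V (hc (P - {q}) (insert q A))) = 0"
      using remove[OF p P(1)] by simp
  next
    fix P A assume P: "P \<subseteq> Z" "card P = n + 1" and A: "A \<subseteq> Z - P" "card A = n - 1"
    obtain p where p: "p \<in> P" using ex[OF P(2)] by blast
    have fA: "finite A" "finite P" using A P fZ finite_subset by blast+
    let ?h = "hc (P - {p}) A"
    have adm: "adm ?h" using P A p fA by (intro adm_hc) auto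
    have pA: "p \<notin> A" using A p by auto
    have "V ?h + (\<Sum>x\<in>{x\<in>S. ?h x = 0}. V (?h(x := l, p := 0))) = 0"
      using p P sub pA by (intro garnir_first[OF adm l(1,2)]) (auto simp: hc_def)
    moreover have "{x\<in>S. ?h x = 0} = P - {p}" using P j l sub by (auto simp: hc_def Z_def)
    moreover have "V (?h(x := l, p := 0)) = V (hc (P - {x}) A)" if "x \<in> P - {p}" for x
      using that p A P by (intro V_cong) (auto simp: hc_def)
    ultimately show "(\<Sum>q\<in>P. V (hc (P - {q}) A)) = 0"
      using remove[OF p P(1)] by simp
  next
    fix X A assume X: "X \<subseteq> Z" "card X = n" and A: "A \<subseteq> Z - X" "card A = n - 1"
    have fX: "finite X" "finite A" using X A fZ finite_subset by blast+
    have "card (Z - X - A) = n - 1" using X A cZ fX n by (simp add: card_Diff_subset)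
    then have adm: "adm (hc X (Z - X - A))" using X by (intro adm_hc) auto
    have "V (hc X A) = V (Transposition.transpose j l \<circ> hc X (Z - X - A))"
      using X A j l by (intro V_cong) (auto simp: hc_def Z_def Transposition.transpose_def)
    then show "V (hc X A) = (-1) ^ (n - 1) * V (hc X (Z - X - A))"
      using sym[OF adm j l] by simp
  next
    show "X \<subseteq> Z" "card X = n" using h by (auto simp: X_def Z_def admissible_def)
    show "D \<subseteq> Z - X" using l by (auto simp: D_def X_def Z_def)
    show "card D = n - 2" using h l q fin by (simp add: D_def admissible_def)
  qed
  moreover have "Z - X - D = insert q {x\<in>S. h x = j}" using q j l by (auto simp: Z_def X_def D_def)
  moreover have "V (hc X (insert x D)) = (-1) ^ (n - 1) * V (h(x := l, q := j))" if x: "x \<in> S" "h x = j" for x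
  proof -
    let ?h = "h(x := l, q := j)"
    have "adm ?h"
    proof -
      have "?h = h \<circ> Transposition.transpose x q" using x q j l by (auto simp: Transposition.transpose_def)
      moreover have "card {a\<in>S. (h \<circ> Transposition.transpose x q) a = i} = card {a\<in>S. h a = i}" for i
        by (rule bij_betw_same_card[of "Transposition.transpose x q"],
            rule bij_betwI[where g = "Transposition.transpose x q"])
          (use x q in \<open>auto simp: Transposition.transpose_def\<close>)
      moreover have "\<forall>a\<in>S. ?h a < k" using h j l by (auto simp: admissible_def)
      ultimately show ?thesis using h by (simp add: admissible_def)
    qed
    moreover have "V (hc X (insert x D)) = V (Transposition.transpose j l \<circ> ?h)"
      using x q j l by (intro V_cong) (auto simp: hc_def Z_def X_def D_def Transposition.transpose_def)
    ultimately show ?thesis using sym j l by simp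
  qed
  moreover have "V (hc X (insert q D)) = (-1) ^ (n - 1) * V h"
  proof -
    have "V (hc X (insert q D)) = V (Transposition.transpose j l \<circ> h)"
      using q j l by (intro V_cong) (auto simp: hc_def Z_def X_def D_def Transposition.transpose_def)
    then show ?thesis using sym[OF h] j l by simp
  qed
  ultimately have "(-1) ^ (n - 1) * (V h + (\<Sum>x\<in>{x\<in>S. h x = j}. V (h(x := l, q := j)))) = 0"
    using q j l fin by (simp add: distrib_left sum_distrib_left)
  then show ?thesis by simp
qed

lemma garnir:
  assumes "adm h" "j < l" "l < k" "q \<in> S" "h q = l"
  shows "V h + (\<Sum>x\<in>{x\<in>S. h x = j}. V (h(x := l, q := j))) = 0"
  using assms garnir_first[of h l q] garnir_equal[of h j l q] by (cases "j = 0") auto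

end

section \<open>Signs of words\<close>

text \<open>For a word with distinct letters this is -1 to the number of inversions, computed on the
  list itself instead of on a permutation.\<close>

primrec sgnl :: "nat list \<Rightarrow> complex" where
  "sgnl [] = 1"
| "sgnl (x # xs) = (-1) ^ card {y \<in> set xs. y < x} * sgnl xs"

lemma sgnl_square [simp]: "sgnl xs * sgnl xs = 1"
proof (induction xs)
  case (Cons x xs)
  have "sgnl (x # xs) * sgnl (x # xs) = ((-1) ^ card {y \<in> set xs. y < x} * (-1) ^ card {y \<in> set xs. y < x}) * (sgnl xs * sgnl xs)"
    by simp
  then show ?case using Cons by (simp flip: power_mult_distrib)
qed simp

lemma sgnl_nonzero [simp]: "sgnl xs \<noteq> 0"
  using sgnl_square[of xs] by fastforce

lemma sgnl_adj:
  assumes "x \<noteq> y" "x \<notin> set bs" "y \<notin> set bs"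
  shows "sgnl (as @ x # y # bs) = - sgnl (as @ y # x # bs)"
proof (induction as)
  case Nil
  have "{z \<in> set (u # bs). z < v} = (if u < v then insert u {z \<in> set bs. z < v} else {z \<in> set bs. z < v})" for u v
    by auto
  then have c: "card {z \<in> set (u # bs). z < v} = (if u < v then Suc (card {z \<in> set bs. z < v}) else card {z \<in> set bs. z < v})"
    if "u \<notin> set bs" for u v using that by simp
  show ?case using assms c[of y x] c[of x y] by auto
next
  case (Cons a as)
  have "set (as @ x # y # bs) = set (as @ y # x # bs)" by auto
  then show ?case using Cons by simp
qed

lemma sgnl_move:
  assumes "distinct (as @ x # bs @ cs)"
  shows "sgnl (as @ x # bs @ cs) = (-1) ^ length bs * sgnl (as @ bs @ x # cs)"
  using assms
proof (induction bs arbitrary: as)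
  case (Cons b bs)
  have "sgnl (as @ x # b # bs @ cs) = - sgnl ((as @ [b]) @ x # bs @ cs)"
    using Cons.prems sgnl_adj[of x b "bs @ cs" as] by auto
  also have "\<dots> = - ((-1) ^ length bs * sgnl ((as @ [b]) @ bs @ x # cs))"
    using Cons.prems by (subst Cons.IH) auto
  finally show ?case by simp
qed simp

lemma sgnl_blocks:
  assumes "distinct (ps @ as @ bs @ cs)"
  shows "sgnl (ps @ as @ bs @ cs) = (-1) ^ (length as * length bs) * sgnl (ps @ bs @ as @ cs)"
  using assms
proof (induction as arbitrary: cs rule: rev_induct)
  case (snoc a as)
  have "sgnl (ps @ (as @ [a]) @ bs @ cs) = (-1) ^ length bs * sgnl ((ps @ as) @ bs @ a # cs)"
    using snoc.prems sgnl_move[of "ps @ as" a bs cs] by simp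
  also have "sgnl ((ps @ as) @ bs @ a # cs) = (-1) ^ (length as * length bs) * sgnl (ps @ bs @ as @ a # cs)"
    using snoc.prems snoc.IH[of "a # cs"] by auto
  finally show ?case by (simp add: power_add)
qed simp

text \<open>With equal lengths the two passages across \<open>ms\<close> cancel, and the passage of
  \<open>as\<close> across \<open>bs\<close> costs the square of the length, which has the parity of
  the length.\<close>

lemma sgnl_swap_blocks:
  assumes d: "distinct (ps @ as @ ms @ bs @ qs)" and len: "length as = length bs"
  shows "sgnl (ps @ as @ ms @ bs @ qs) = (-1) ^ length as * sgnl (ps @ bs @ ms @ as @ qs)"
proof -
  have "sgnl (ps @ as @ (ms @ bs) @ qs) = (-1) ^ (length as * length (ms @ bs)) * sgnl (ps @ (ms @ bs) @ as @ qs)"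
    using d by (intro sgnl_blocks) auto
  also have "sgnl (ps @ (ms @ bs) @ as @ qs) = (-1) ^ (length ms * length bs) * sgnl (ps @ bs @ ms @ as @ qs)"
    using d sgnl_blocks[of ps ms bs "as @ qs"] by auto
  also have "(-1) ^ (length as * length (ms @ bs)) * ((-1) ^ (length ms * length bs) * sgnl (ps @ bs @ ms @ as @ qs))
      = ((-1) ^ (length as * length (ms @ bs)) * (-1) ^ (length ms * length bs)) * sgnl (ps @ bs @ ms @ as @ qs)"
    by simp
  also have "(-1) ^ (length as * length (ms @ bs)) * (-1) ^ (length ms * length bs) = ((-1) ^ length as :: complex)"
    unfolding power_add[symmetric] using len by (cases "even (length as)"; cases "even (length ms)") auto
  finally show ?thesis by simp
qed

text \<open>Exchanging two values of a distinct word is exchanging two blocks of length 1.\<close>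

lemma sgnl_transpose:
  assumes "distinct xs" "a \<in> set xs" "b \<in> set xs" "a \<noteq> b"
  shows "sgnl (map (Transposition.transpose a b) xs) = - sgnl xs"
proof -
  have *: "sgnl (map (Transposition.transpose a b) (as @ a # bs @ b # cs)) = - sgnl (as @ a # bs @ b # cs)"
    if d: "distinct (as @ a # bs @ b # cs)" for as bs cs a b
  proof -
    have id: "map (Transposition.transpose a b) us = us" if "a \<notin> set us" "b \<notin> set us" for us
      using that by (intro map_idI) (metis transpose_apply_other)
    have "map (Transposition.transpose a b) (as @ a # bs @ b # cs) = as @ b # bs @ a # cs"
      using d by (auto simp: id)
    moreover have "sgnl (as @ [a] @ bs @ [b] @ cs) = (-1) ^ length [a] * sgnl (as @ [b] @ bs @ [a] @ cs)"
      using d by (intro sgnl_swap_blocks) auto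
    ultimately show ?thesis by simp
  qed
  obtain as cs where xs: "xs = as @ a # cs" using assms by (meson split_list)
  show ?thesis
  proof (cases "b \<in> set cs")
    case True
    then obtain us vs where "cs = us @ b # vs" by (meson split_list)
    then show ?thesis using *[of as a us b vs] assms xs by simp
  next
    case False
    then have "b \<in> set as" using assms xs by auto
    then obtain us vs where "as = us @ b # vs" by (meson split_list)
    then show ?thesis using *[of us b vs a cs] assms xs by (simp add: transpose_commute)
  qed
qed

section \<open>Combs as functions of colorings\<close>

text \<open>A comb given by the list of its columns, the head being the innermost bracket.\<close>

definition combl :: "'a list list \<Rightarrow> 'a btree"
  where "combl Cs = comb (hd Cs) (tl Cs)"

lemma letters_combl: "Cs \<noteq> [] \<Longrightarrow> mset (letters (combl Cs)) = mset (concat Cs)"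
  by (cases Cs) (auto simp: combl_def letters_comb)

lemma map_btree_combl: "Cs \<noteq> [] \<Longrightarrow> map_btree f (combl Cs) = combl (map (map f) Cs)"
  by (cases Cs) (auto simp: combl_def map_btree_comb)

definition cols_ok :: "nat \<Rightarrow> nat \<Rightarrow> 'a set \<Rightarrow> 'a list list \<Rightarrow> bool"
  where "cols_ok n k S Cs \<longleftrightarrow> Cs \<noteq> [] \<and> length Cs = k \<and> distinct (concat Cs) \<and> set (concat Cs) = S \<and>
    length (hd Cs) = n \<and> (\<forall>B\<in>set (tl Cs). length B = n - 1)"

lemma cols_ok_shape: "cols_ok n k S Cs \<Longrightarrow> comb_shape n S (hd Cs) (tl Cs)"
  by (cases Cs) (auto simp: cols_ok_def comb_shape_def)

lemma cols_ok_bracketing: "n > 0 \<Longrightarrow> cols_ok n k S Cs \<Longrightarrow> combl Cs \<in> bracketings n S"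
  unfolding combl_def by (intro comb_bracketing cols_ok_shape)

lemma cols_ok_permute:
  assumes "cols_ok n k S Cs" "p permutes S"
  shows "cols_ok n k S (map (map p) Cs)"
proof -
  have "distinct (map p (concat Cs))" "set (map p (concat Cs)) = S"
    using assms inj_on_subset[OF permutes_inj[OF assms(2)] subset_UNIV] permutes_image[OF assms(2)]
    by (auto simp: cols_ok_def distinct_map)
  then show ?thesis using assms(1) by (cases Cs) (auto simp: cols_ok_def map_concat)
qed

locale comb_functional =
  fixes n k :: nat and S :: "nat set" and L :: "nat btree \<Rightarrow> complex"
  assumes n: "n \<ge> 2" and fin: "finite S"
    and L: "comb_funct n S (mset_set S) L"
begin

abbreviation "ok \<equiv> cols_ok n k S"

text \<open>Twisting by the sign of the word makes the value depend only on the sets of letters of the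
  columns, that is, on a coloring of the letters.\<close>

definition tw :: "nat list list \<Rightarrow> complex"
  where "tw Cs = sgnl (concat Cs) * L (combl Cs)"

lemma fil_funct_L: "fil_funct n S L"
  using L by (simp add: comb_funct_def)

lemma ok_mset: "ok Cs \<Longrightarrow> mset (letters (combl Cs)) = mset_set S"
  by (metis cols_ok_def letters_combl mset_set_set)

text \<open>The two letters are siblings, so \<open>L\<close> changes sign, and so does the sign of
  the word.\<close>

lemma tw_swap_in_column:
  assumes ok: "ok (Ps @ (as @ x # y # bs) # Qs)"
  shows "tw (Ps @ (as @ x # y # bs) # Qs) = tw (Ps @ (as @ y # x # bs) # Qs)"
proof -
  let ?Cs = "Ps @ (as @ x # y # bs) # Qs"
  let ?p = "Transposition.transpose x y"
  have d: "distinct (concat ?Cs)" using ok by (simp add: cols_ok_def)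
  have id: "map ?p us = us" if "x \<notin> set us" "y \<notin> set us" for us
    using that by (intro map_idI) (metis transpose_apply_other)
  have "map (map ?p) Ps = Ps" "map (map ?p) Qs = Qs"
    by (rule map_idI, rule id; use d in auto)+
  moreover have "map ?p (as @ x # y # bs) = as @ y # x # bs" using d by (auto simp: id)
  ultimately have "map (map ?p) ?Cs = Ps @ (as @ y # x # bs) # Qs" by simp
  then have "combl (Ps @ (as @ y # x # bs) # Qs) = map_btree ?p (combl ?Cs)"
    by (simp add: map_btree_combl)
  moreover have "L (map_btree ?p (combl ?Cs)) = - L (combl ?Cs)"
  proof (rule sib_antisym)
    show "sib x y (combl ?Cs)"
    proof -
      have "as @ x # y # bs \<in> set (hd ?Cs # tl ?Cs)" by (cases Ps) simp_all
      then show ?thesis unfolding combl_def by (rule sib_comb) simp_all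
    qed
    show "distinct (letters (combl ?Cs))" 
    proof -
      have "mset (letters (combl ?Cs)) = mset (concat ?Cs)" by (rule letters_combl) simp
      from mset_eq_imp_distinct_iff[OF this] d show ?thesis by blast
    qed
    show "combl ?Cs \<in> bracketings n S" using n by (intro cols_ok_bracketing[OF _ ok]) simp
    show "x \<noteq> y" using d by auto
  qed (rule fil_funct_L)
  moreover have "sgnl (concat ?Cs) = - sgnl (concat (Ps @ (as @ y # x # bs) # Qs))"
    using sgnl_adj[of x y "bs @ concat Qs" "concat Ps @ as"] d by auto
  ultimately show ?thesis by (simp add: tw_def)
qed

lemma ok_replace_column:
  assumes "ok (Ps @ C # Qs)" "mset C' = mset C"
  shows "ok (Ps @ C' # Qs)"
proof -
  have "distinct (concat (Ps @ C' # Qs)) = distinct (concat (Ps @ C # Qs))"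
    using assms(2) by (intro mset_eq_imp_distinct_iff) simp
  moreover have "set C' = set C" "length C' = length C" using assms(2) by (metis mset_eq_setD mset_eq_length)+
  ultimately show ?thesis using assms(1) by (cases Ps) (auto simp: cols_ok_def)
qed

lemma tw_replace_column:
  assumes "ok (Ps @ C # Qs)" "mset C' = mset C"
  shows "tw (Ps @ C' # Qs) = tw (Ps @ C # Qs)"
proof (rule adjacent_swaps_invariant[where f = "\<lambda>C. tw (Ps @ C # Qs)", OF _ assms(2) refl])
  fix as x y bs assume "mset (as @ x # y # bs) = mset C"
  then show "tw (Ps @ (as @ x # y # bs) # Qs) = tw (Ps @ (as @ y # x # bs) # Qs)"
    by (intro tw_swap_in_column ok_replace_column[OF assms(1)])
qed

lemma tw_replace_columns:
  assumes "list_all2 (\<lambda>C C'. mset C' = mset C) Qs Qs'" "ok (Ps @ Qs)"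
  shows "tw (Ps @ Qs') = tw (Ps @ Qs)"
  using assms
proof (induction arbitrary: Ps rule: list_all2_induct)
  case (Cons C Cs C' Cs')
  have "tw ((Ps @ [C']) @ Cs') = tw ((Ps @ [C']) @ Cs)"
    using ok_replace_column[of Ps C Cs C'] Cons by (intro Cons.IH) auto
  also have "\<dots> = tw (Ps @ C # Cs)"
    using tw_replace_column[of Ps C Cs C'] Cons by simp
  finally show ?case by simp
qed simp

definition columns :: "(nat \<Rightarrow> nat) \<Rightarrow> nat list list"
  where "columns h = map (\<lambda>j. sorted_list_of_set {a \<in> S. h a = j}) [0..<k]"

definition V :: "(nat \<Rightarrow> nat) \<Rightarrow> complex"
  where "V h = tw (columns h)"

text \<open>The sorted columns in \<open>V\<close> are an arbitrary choice; any arrangement with the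
  same column sets has the same twisted value.\<close>

lemma V_eq_tw:
  assumes ok: "ok Cs" and h: "\<And>j. j < k \<Longrightarrow> set (Cs ! j) = {a \<in> S. h a = j}"
  shows "V h = tw Cs"
proof -
  have "mset (columns h ! j) = mset (Cs ! j)" if j: "j < k" for j
  proof -
    have "distinct (Cs ! j)" using ok j by (auto simp: cols_ok_def distinct_concat_iff)
    then show ?thesis using j h[OF j] fin
      by (intro set_eq_iff_mset_eq_distinct[THEN iffD1]) (auto simp: columns_def)
  qed
  then have "list_all2 (\<lambda>C C'. mset C' = mset C) Cs (columns h)"
    using ok by (auto simp: list_all2_conv_all_nth cols_ok_def columns_def)
  from tw_replace_columns[OF this, of "[]"] ok show ?thesis by (simp add: V_def)
qed

lemma columns_nth: "j < k \<Longrightarrow> columns h ! j = sorted_list_of_set {a \<in> S. h a = j}"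
  by (simp add: columns_def)

lemma ok_columns:
  assumes "admissible n k S h" "k \<ge> 1"
  shows "ok (columns h)"
proof -
  have len: "length (columns h) = k" by (simp add: columns_def)
  have ne: "columns h \<noteq> []" using assms(2) len by auto
  have "distinct (concat (map (\<lambda>j. sorted_list_of_set {a \<in> S. h a = j}) [0..<m]))" for m
    using fin by (induction m) auto
  then have "distinct (concat (columns h))" by (simp add: columns_def)
  moreover have "set (concat (columns h)) = S"
    using assms fin by (auto simp: columns_def admissible_def)
  moreover have "length (hd (columns h)) = n"
    using assms ne fin by (simp add: hd_conv_nth columns_nth admissible_def)
  moreover have "length B = n - 1" if B: "B \<in> set (tl (columns h))" for B
  proof -
    obtain j where "j < length (tl (columns h))" "B = tl (columns h) ! j"
      using B by (metis in_set_conv_nth)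
    then have "j < k - 1" "B = columns h ! Suc j" using len by (auto simp: nth_tl)
    then show ?thesis using assms fin by (simp add: columns_nth admissible_def)
  qed
  ultimately show ?thesis using len ne by (simp add: cols_ok_def)
qed

lemma L_permute_blocks:
  assumes "ok (A # Bs)" "mset Bs' = mset Bs"
  shows "L (combl (A # Bs')) = L (combl (A # Bs))"
  using comb_permute_blocks[of n S A Bs L Bs'] L n assms ok_mset[OF assms(1)] cols_ok_shape[OF assms(1)]
  by (simp add: combl_def)

text \<open>\<open>L\<close> is unchanged because blocks commute; the sign is that of exchanging two
  blocks of \<open>n - 1\<close> letters in the word.\<close>

lemma V_sym:
  assumes h: "admissible n k S h" and jl: "1 \<le> j" "j < l" "l < k"
  shows "V (Transposition.transpose j l \<circ> h) = (-1) ^ (n - 1) * V h"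
proof -
  define Cs where "Cs = columns h"
  have ok: "ok Cs" using ok_columns[OF h] jl by (simp add: Cs_def)
  have len: "length Cs = k" using ok by (simp add: cols_ok_def)
  obtain A Bs where Cs: "Cs = A # Bs" using ok by (cases Cs) (auto simp: cols_ok_def)
  define M1 M2 M3 where "M1 = take (j - 1) Bs" and "M2 = take (l - j - 1) (drop j Bs)" and "M3 = drop l Bs"
  define B C where "B = Cs ! j" and "C = Cs ! l"
  have Bs: "Bs = M1 @ B # M2 @ C # M3"
  proof -
    have "Bs = take (j - 1) Bs @ Bs ! (j - 1) # drop (Suc (j - 1)) Bs"
      using jl len Cs by (intro id_take_nth_drop) auto
    moreover have "drop j Bs = take (l - j - 1) (drop j Bs) @ drop j Bs ! (l - j - 1) # drop (Suc (l - j - 1)) (drop j Bs)"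
      using jl len Cs by (intro id_take_nth_drop) auto
    moreover have "drop j Bs ! (l - j - 1) = C" "Bs ! (j - 1) = B" "drop (Suc (l - j - 1)) (drop j Bs) = M3" "Suc (j - 1) = j"
      using jl len Cs by (auto simp: B_def C_def M3_def nth_Cons')
    ultimately show ?thesis by (simp add: M1_def M2_def)
  qed
  define Cs' where "Cs' = A # M1 @ C # M2 @ B # M3"
  have lM: "length M1 = j - 1" "length M2 = l - j - 1" using jl len Cs by (auto simp: M1_def M2_def)
  have Cs': "Cs' = Cs[j := C, l := B]"
  proof -
    have lj: "j = length (A # M1)" "l = length ((A # M1) @ C # M2)" using jl lM by simp_all
    have "Cs = (A # M1) @ B # M2 @ C # M3" by (simp add: Cs Bs)
    then have "Cs[j := C] = (A # M1) @ C # M2 @ C # M3" unfolding lj(1) by (simp only: list_update_length)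
    also have "\<dots> = ((A # M1) @ C # M2) @ C # M3" by simp
    finally have "Cs[j := C, l := B] = ((A # M1) @ C # M2) @ B # M3"
      unfolding lj(2) by (simp only: list_update_length)
    then show ?thesis by (simp add: Cs'_def)
  qed
  have ms: "mset (concat Cs') = mset (concat Cs)" by (simp add: Cs'_def Cs Bs)
  have ok': "ok Cs'"
    using ok mset_eq_imp_distinct_iff[OF ms] mset_eq_setD[OF ms] unfolding cols_ok_def by (auto simp: Cs'_def Cs Bs)
  have "V (Transposition.transpose j l \<circ> h) = tw Cs'"
  proof (rule V_eq_tw[OF ok'])
    fix i assume i: "i < k"
    have "Cs' ! i = Cs ! (Transposition.transpose j l i)"
      using i jl len unfolding Cs' B_def C_def by (auto simp: nth_list_update Transposition.transpose_def)
    also have "\<dots> = sorted_list_of_set {a \<in> S. h a = Transposition.transpose j l i}"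
      unfolding Cs_def using i jl by (intro columns_nth) (auto simp: Transposition.transpose_def)
    finally show "set (Cs' ! i) = {a \<in> S. (Transposition.transpose j l \<circ> h) a = i}"
      using fin by (auto simp: Transposition.transpose_def split: if_splits)
  qed
  also have "L (combl Cs') = L (combl Cs)"
    unfolding Cs'_def Cs Bs using ok[unfolded Cs Bs] by (intro L_permute_blocks) auto
  then have "tw Cs' = sgnl (concat Cs') * L (combl Cs)" by (simp add: tw_def)
  also have "sgnl (concat Cs') = (-1) ^ (n - 1) * sgnl (concat Cs)"
  proof -
    have "length B = n - 1" "length C = n - 1" using ok by (auto simp: cols_ok_def Cs Bs)
    moreover have "distinct (concat Cs')" using ok' by (simp add: cols_ok_def)
    ultimately show ?thesis
      using sgnl_swap_blocks[of "A @ concat M1" C "concat M2" B "concat M3"] by (simp add: Cs'_def Cs Bs)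
  qed
  finally show ?thesis by (simp only: V_def[of h] tw_def Cs_def mult.assoc)
qed

text \<open>This is \<open>comb_jacobi\<close> rewritten for colorings: in the term of
  \<open>x\<close>, the letter \<open>x\<close> stays in the first column and the two columns
  otherwise trade places.\<close>

lemma V_jac:
  assumes h: "admissible n k S h" and l: "1 \<le> l" "l < k"
  shows "V h = (-1) ^ (n - 1) * (\<Sum>x\<in>{x\<in>S. h x = 0}. V ((Transposition.transpose 0 l \<circ> h)(x := 0)))"
proof -
  define Cs where "Cs = columns h"
  have ok: "ok Cs" using ok_columns[OF h] l by (simp add: Cs_def)
  have len: "length Cs = k" using ok by (simp add: cols_ok_def)
  obtain A Bs where Cs: "Cs = A # Bs" using ok by (cases Cs) (auto simp: cols_ok_def)
  define B M Q where "B = Bs ! (l - 1)" and "M = take (l - 1) Bs" and "Q = drop l Bs"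
  have Bs: "Bs = M @ B # Q"
    using id_take_nth_drop[of "l - 1" Bs] l len Cs by (auto simp: B_def M_def Q_def)
  have lA: "length A = n" "length B = n - 1" using ok by (auto simp: cols_ok_def Cs Bs)
  have lM: "length M = l - 1" using l len Cs by (auto simp: M_def)
  have dA: "distinct (concat Cs)" using ok by (simp add: cols_ok_def)
  have setCs: "set (Cs ! i) = {a \<in> S. h a = i}" if "i < k" for i
    using that fin by (simp add: Cs_def columns_nth)
  have setA: "set A = {x \<in> S. h x = 0}" using setCs[of 0] l by (simp add: Cs)
  have setB: "set B = {x \<in> S. h x = l}" using setCs[of l] l by (simp add: Cs B_def nth_Cons')
  have sh: "comb_shape n S A (M @ Q @ [B])"
    using cols_ok_shape[OF ok] by (auto simp: Cs Bs comb_shape_def)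
  \<comment> \<open>Blocks commute, so column \<open>l\<close> may be brought next to the innermost
    bracket, the place where \<open>comb_jacobi\<close> acts.\<close>
  have "L (combl Cs) = L (combl (A # M @ Q @ [B]))"
    unfolding Cs Bs using ok[unfolded Cs Bs] by (intro L_permute_blocks[symmetric]) auto
  also have "\<dots> = (\<Sum>i<n. (-1) ^ i * L (comb (A ! i # B) ((M @ Q) @ [take i A @ drop (Suc i) A])))"
    using comb_jacobi[OF fil_funct_L _, of A "M @ Q" B] n sh by (simp add: combl_def)
  finally have Leq: "L (combl Cs) = (\<Sum>i<n. (-1) ^ i * L (comb (A ! i # B) ((M @ Q) @ [take i A @ drop (Suc i) A])))" .
  have "V h = (\<Sum>i<n. sgnl (concat Cs) * ((-1) ^ i * L (comb (A ! i # B) ((M @ Q) @ [take i A @ drop (Suc i) A]))))"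
    by (simp add: V_def tw_def Cs_def[symmetric] Leq sum_distrib_left)
  also have "\<dots> = (\<Sum>i<n. (-1) ^ (n - 1) * V ((Transposition.transpose 0 l \<circ> h)(A ! i := 0)))"
  proof (intro sum.cong refl)
    fix i assume "i \<in> {..<n}"
    then have i: "i < n" by simp
    define x A' where "x = A ! i" and "A' = take i A @ drop (Suc i) A"
    have A: "A = take i A @ x # drop (Suc i) A" using i lA by (simp add: x_def id_take_nth_drop)
    define Cs' where "Cs' = (x # B) # M @ A' # Q"
    have ms: "mset (concat Cs') = mset (concat Cs)"
      unfolding Cs'_def Cs Bs A'_def by (subst (3) A) simp
    have lA': "length A' = n - 1" using i lA by (simp add: A'_def)
    have ok': "ok Cs'"
      using ok mset_eq_imp_distinct_iff[OF ms] mset_eq_setD[OF ms] lA lA' n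
      unfolding cols_ok_def by (auto simp: Cs'_def Cs Bs)
    have "x \<in> set A" using i lA by (simp add: x_def)
    then have x: "x \<in> S" "h x = 0" unfolding setA by simp_all
    have dAx: "distinct A" using dA by (simp add: Cs)
    have setA': "set A' = {a \<in> S. h a = 0 \<and> a \<noteq> x}"
    proof -
      have "distinct (take i A @ x # drop (Suc i) A)" using dAx A by metis
      moreover have "set A = set (take i A @ x # drop (Suc i) A)" by (rule arg_cong[OF A])
      ultimately have "set A' = set A - {x}" unfolding A'_def by auto
      then show ?thesis unfolding setA by auto
    qed
    have VV: "V ((Transposition.transpose 0 l \<circ> h)(x := 0)) = tw Cs'"
    proof (rule V_eq_tw[OF ok'])
      fix j assume j: "j < k"
      let ?h = "(Transposition.transpose 0 l \<circ> h)(x := 0)"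
      have h0: "?h a = 0 \<longleftrightarrow> a = x \<or> h a = l" and hl: "?h a = l \<longleftrightarrow> h a = 0 \<and> a \<noteq> x"
        and hj: "j \<noteq> 0 \<Longrightarrow> j \<noteq> l \<Longrightarrow> ?h a = j \<longleftrightarrow> h a = j \<and> a \<noteq> x" for a
        using l by (auto simp: Transposition.transpose_def)
      consider "j = 0" | "j = l" | "j \<noteq> 0" "j \<noteq> l" by blast
      then show "set (Cs' ! j) = {a \<in> S. ?h a = j}"
      proof cases
        case 1
        have "set (Cs' ! 0) = insert x (set B)" by (simp add: Cs'_def)
        then show ?thesis unfolding 1 h0 using x(1) setB by auto
      next
        case 2
        have "Cs' ! l = A'" using lM l by (simp add: Cs'_def nth_Cons' nth_append)
        then show ?thesis unfolding 2 hl using setA' by auto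
      next
        case 3
        then have "Cs' ! j = Cs ! j" using lM l by (auto simp: Cs'_def Cs Bs nth_Cons' nth_append)
        then show ?thesis unfolding hj[OF 3] using setCs[OF j] x(2) 3(1) by auto
      qed
    qed
    have "L (comb (A ! i # B) ((M @ Q) @ [take i A @ drop (Suc i) A])) = L (combl Cs')"
      using L_permute_blocks[OF ok'[unfolded Cs'_def], of "(M @ Q) @ [A']"]
      by (simp add: Cs'_def combl_def x_def A'_def)
    \<comment> \<open>Bringing \<open>x\<close> to the front of the first column costs
      \<open>i\<close> signs, exchanging the blocks \<open>A'\<close> and \<open>B\<close> costs
      \<open>n - 1\<close> more.\<close>
    moreover have "sgnl (concat Cs) * (-1) ^ i = (-1) ^ (n - 1) * sgnl (concat Cs')"
    proof -
      let ?R = "drop (Suc i) A @ concat M @ B @ concat Q"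
      have e: "concat Cs = [] @ take i A @ [x] @ ?R"
        using arg_cong[OF A, of "\<lambda>A. A @ concat M @ B @ concat Q"] by (simp add: Cs Bs)
      have "distinct ([] @ take i A @ [x] @ ?R)" using dA unfolding e .
      then have "sgnl ([] @ take i A @ [x] @ ?R) = (-1) ^ (length (take i A) * length [x]) * sgnl ([] @ [x] @ take i A @ ?R)"
        by (rule sgnl_blocks)
      then have s1: "sgnl (concat Cs) = (-1) ^ i * sgnl ([x] @ A' @ concat M @ B @ concat Q)"
        unfolding e using i lA by (simp add: A'_def)
      have "sgnl ([x] @ B @ concat M @ A' @ concat Q) = (-1) ^ length B * sgnl ([x] @ A' @ concat M @ B @ concat Q)"
        using ok' lA lA' by (intro sgnl_swap_blocks) (auto simp: cols_ok_def Cs'_def)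
      then have "sgnl (concat Cs') = (-1) ^ (n - 1) * sgnl ([x] @ A' @ concat M @ B @ concat Q)"
        using lA by (simp add: Cs'_def)
      moreover have "(-1 :: complex) ^ i * (-1) ^ i = 1" "(-1 :: complex) ^ (n - 1) * (-1) ^ (n - 1) = 1"
        by (simp_all flip: power_mult_distrib)
      ultimately show ?thesis unfolding s1 by (metis (no_types, lifting) mult.assoc mult.commute mult_1)
    qed
    ultimately show "sgnl (concat Cs) * ((-1) ^ i * L (comb (A ! i # B) ((M @ Q) @ [take i A @ drop (Suc i) A])))
      = (-1) ^ (n - 1) * V ((Transposition.transpose 0 l \<circ> h)(A ! i := 0))"
      unfolding x_def[symmetric] VV tw_def by (simp add: mult.assoc[symmetric])
  qed
  also have "\<dots> = (-1) ^ (n - 1) * (\<Sum>x\<in>{x\<in>S. h x = 0}. V ((Transposition.transpose 0 l \<circ> h)(x := 0)))"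
  proof -
    have "bij_betw ((!) A) {..<n} {x\<in>S. h x = 0}"
      using bij_betw_nth[of A "{..<n}" "{x\<in>S. h x = 0}"] dA lA setA by (simp add: Cs)
    then show ?thesis unfolding sum_distrib_left by (rule sum.reindex_bij_betw)
  qed
  finally show ?thesis .
qed

sublocale garnir_coloring V S n k
proof (unfold_locales)
  show "V h = V h'" if "\<And>a. a \<in> S \<Longrightarrow> h a = h' a" for h h'
  proof -
    have "{a \<in> S. h a = j} = {a \<in> S. h' a = j}" for j using that by auto
    then show ?thesis by (simp add: V_def columns_def)
  qed
  show "V (Transposition.transpose j l \<circ> h) = (-1) ^ (n - 1) * V h"
    if "admissible n k S h" "1 \<le> j" "j < k" "1 \<le> l" "l < k" "j \<noteq> l" for h j l
    using V_sym[of h j l] V_sym[of h l j] that by (cases "j < l") (auto simp: transpose_commute)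
  show "V h = (-1) ^ (n - 1) * (\<Sum>x\<in>{x\<in>S. h x = 0}. V ((Transposition.transpose 0 l \<circ> h)(x := 0)))"
    if "admissible n k S h" "1 \<le> l" "l < k" for h l using V_jac that by blast
qed (use n fin in auto)

text \<open>The coloring relation has a plus sign on every term. Undoing the twist makes the
  exchange terms negative, because the transposition of \<open>x\<close> and \<open>q\<close>
  changes the sign of the word.\<close>

lemma L_garnir:
  assumes ok: "ok Cs" and jl: "j < l" "l < k" and q: "q \<in> set (Cs ! l)"
  shows "L (combl Cs) = (\<Sum>x\<in>set (Cs ! j). L (combl (map (map (Transposition.transpose x q)) Cs)))"
proof -
  have len: "length Cs = k" "Cs \<noteq> []" "distinct (concat Cs)" "set (concat Cs) = S" using ok by (auto simp: cols_ok_def)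
  define h where "h a = (THE j. j < k \<and> a \<in> set (Cs ! j))" for a
  have uniq: "i = i'" if "i < k" "i' < k" "a \<in> set (Cs ! i)" "a \<in> set (Cs ! i')" for i i' a
  proof (rule ccontr)
    assume "i \<noteq> i'"
    have "False" if ii: "i < i'" "i' < k" "a \<in> set (Cs ! i)" "a \<in> set (Cs ! i')" for i i'
    proof -
      have "Cs = take i' Cs @ Cs ! i' # drop (Suc i') Cs" using ii len by (simp add: id_take_nth_drop)
      then have "concat Cs = concat (take i' Cs) @ Cs ! i' @ concat (drop (Suc i') Cs)"
        by (metis concat.simps(2) concat_append)
      then have "set (concat (take i' Cs)) \<inter> set (Cs ! i') = {}" using len by auto
      moreover have "Cs ! i \<in> set (take i' Cs)" using ii len by (auto simp: in_set_conv_nth intro!: exI[of _ i])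
      ultimately show False using ii by auto
    qed
    then show False using that \<open>i \<noteq> i'\<close> by (metis nat_neq_iff)
  qed
  have h_eq: "h a = i" if "i < k" "a \<in> set (Cs ! i)" for a i
    unfolding h_def using that uniq by (intro the_equality) auto
  have hS: "h a < k \<and> a \<in> set (Cs ! h a)" if "a \<in> S" for a
  proof -
    have "a \<in> set (concat Cs)" using that len by simp
    then obtain C where "C \<in> set Cs" "a \<in> set C" by auto
    then obtain i where "i < k" "a \<in> set (Cs ! i)" using len by (metis in_set_conv_nth)
    then show ?thesis using h_eq by simp
  qed
  have sets: "set (Cs ! i) = {a \<in> S. h a = i}" if "i < k" for i
  proof -
    have "set (Cs ! i) \<subseteq> S" using len that by (metis nth_mem concat_eq_append_conv UN_I set_concat subsetI)
    then show ?thesis using h_eq hS that by auto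
  qed
  have adm: "admissible n k S h"
  proof -
    have d: "distinct (Cs ! i)" if "i < k" for i using len that by (auto simp: distinct_concat_iff)
    have "length (Cs ! 0) = n" using ok hd_conv_nth[OF len(2)] by (simp add: cols_ok_def)
    moreover have "length (Cs ! i) = n - 1" if "1 \<le> i" "i < k" for i
    proof -
      have "Cs ! i = tl Cs ! (i - 1)" "i - 1 < length (tl Cs)" using that len by (auto simp: nth_tl)
      then show ?thesis using ok by (auto simp: cols_ok_def)
    qed
    ultimately show ?thesis
      using hS sets d jl distinct_card by (fastforce simp: admissible_def)
  qed
  have qS: "q \<in> S" "h q = l" using q sets[OF jl(2)] by auto
  have Vh: "V h = tw Cs" by (rule V_eq_tw[OF ok sets])
  have term_eq: "V (h(x := l, q := j)) = - (sgnl (concat Cs) * L (combl (map (map (Transposition.transpose x q)) Cs)))"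
    if x: "x \<in> set (Cs ! j)" for x
  proof -
    have xS: "x \<in> S" "h x = j" using x sets[of j] jl by auto
    have xq: "x \<noteq> q" using xS qS jl by auto
    have p: "Transposition.transpose x q permutes S" using xS qS by (intro permutes_swap_id)
    let ?Cs = "map (map (Transposition.transpose x q)) Cs"
    have ok': "ok ?Cs" by (rule cols_ok_permute[OF ok p])
    have "V (h(x := l, q := j)) = tw ?Cs"
    proof (rule V_eq_tw[OF ok'])
      fix i assume i: "i < k"
      have "set (?Cs ! i) = Transposition.transpose x q ` {a \<in> S. h a = i}" using i len sets by simp
      also have "\<dots> = {a \<in> S. (h(x := l, q := j)) a = i}"
        using xS qS xq by (auto simp: image_iff Transposition.transpose_def split: if_splits; metis)
      finally show "set (?Cs ! i) = {a \<in> S. (h(x := l, q := j)) a = i}" .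
    qed
    moreover have "sgnl (concat ?Cs) = - sgnl (concat Cs)"
      unfolding map_concat[symmetric]
      by (rule sgnl_transpose[OF len(3) _ _ xq]) (simp_all only: len(4) xS qS)
    ultimately show ?thesis by (simp add: tw_def)
  qed
  have "0 = tw Cs + (\<Sum>x\<in>set (Cs ! j). V (h(x := l, q := j)))"
    using garnir[OF adm jl qS] sets[of j] jl Vh by simp
  also have "(\<Sum>x\<in>set (Cs ! j). V (h(x := l, q := j)))
      = - (sgnl (concat Cs) * (\<Sum>x\<in>set (Cs ! j). L (combl (map (map (Transposition.transpose x q)) Cs))))"
    by (simp add: term_eq sum_negf sum_distrib_left)
  finally have "sgnl (concat Cs) * L (combl Cs) = sgnl (concat Cs) * (\<Sum>x\<in>set (Cs ! j). L (combl (map (map (Transposition.transpose x q)) Cs)))"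
    by (simp add: tw_def)
  then show ?thesis by simp
qed

end

section \<open>Tableaux\<close>

text \<open>A Young subgroup is generated by the transpositions within its classes; the induction is
  on the number of moved points.\<close>

lemma label_preserving_induct [consumes 3, case_names id swap]:
  assumes "finite S" "p permutes S" "\<And>x. x \<in> S \<Longrightarrow> f (p x) = f x"
    and id: "P id"
    and swap: "\<And>a b q. a \<in> S \<Longrightarrow> b \<in> S \<Longrightarrow> a \<noteq> b \<Longrightarrow> f a = f b \<Longrightarrow> q permutes S \<Longrightarrow>
      (\<And>x. x \<in> S \<Longrightarrow> f (q x) = f x) \<Longrightarrow> P q \<Longrightarrow> P (Transposition.transpose a b \<circ> q)"
  shows "P p"
  using assms(2,3)
proof (induction "card {x. p x \<noteq> x}" arbitrary: p rule: less_induct)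
  case less
  show ?case
  proof (cases "p = id")
    case True
    then show ?thesis using id by simp
  next
    case False
    then obtain a where a: "p a \<noteq> a" by (auto simp: fun_eq_iff)
    have aS: "a \<in> S" using a less.prems(1) by (meson permutes_not_in)
    have pS: "p x \<in> S" if "x \<in> S" for x using that permutes_in_image[OF less.prems(1)] by simp
    \<comment> \<open>\<open>q\<close> fixes \<open>a\<close> and every fixed point of
      \<open>p\<close>, so it moves fewer points.\<close>
    define q where "q = Transposition.transpose a (p a) \<circ> p"
    have q: "q permutes S"
      unfolding q_def using less.prems(1) aS pS by (intro permutes_compose permutes_swap_id) auto
    have inj: "p x = p y \<longleftrightarrow> x = y" for x y using permutes_inj[OF less.prems(1)] by (auto simp: inj_def)
    have fq: "f (q x) = f x" if "x \<in> S" for x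
      using less.prems(2)[OF that] less.prems(2)[OF aS] by (auto simp: q_def Transposition.transpose_def)
    have sub: "{x. q x \<noteq> x} \<subset> {x. p x \<noteq> x}"
    proof (rule psubsetI)
      show "{x. q x \<noteq> x} \<subseteq> {x. p x \<noteq> x}"
      proof (rule subsetI, rule CollectI, rule notI)
        fix x assume "x \<in> {x. q x \<noteq> x}" "p x = x"
        then show False using a inj by (auto simp: q_def Transposition.transpose_def split: if_splits)
      qed
      have "q a = a" by (simp add: q_def)
      then show "{x. q x \<noteq> x} \<noteq> {x. p x \<noteq> x}" using a by auto
    qed
    have "finite {x. p x \<noteq> x}"
      using assms(1) less.prems(1) by (rule_tac finite_subset[of _ S]) (auto dest: permutes_not_in)
    then have "P q" using less.hyps[OF psubset_card_mono[OF _ sub] q fq] by simp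
    then have "P (Transposition.transpose a (p a) \<circ> q)"
      using a aS pS less.prems(2)[OF aS] q fq by (intro swap) auto
    moreover have "Transposition.transpose a (p a) \<circ> q = p" by (auto simp: q_def fun_eq_iff)
    ultimately show ?thesis by simp
  qed
qed

text \<open>The Young subgroup of the fibers of \<open>f\<close>. Row and column stabilizers arise
  for \<open>f\<close> the row and the column of a letter; the set \<open>A\<close> makes it
  possible to build up the row group one letter at a time.\<close>

definition label_perms :: "('a \<Rightarrow> 'b) \<Rightarrow> 'a set \<Rightarrow> ('a \<Rightarrow> 'a) set"
  where "label_perms f A = {r. r permutes A \<and> (\<forall>x\<in>A. f (r x) = f x)}"

lemma label_perms_empty: "label_perms f {} = {id}"
  by (auto simp: label_perms_def)

lemma finite_label_perms: "finite A \<Longrightarrow> finite (label_perms f A)"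
  by (rule finite_subset[OF _ finite_permutations]) (auto simp: label_perms_def)

lemma label_perms_comp:
  "p \<in> label_perms f A \<Longrightarrow> q \<in> label_perms f A \<Longrightarrow> p \<circ> q \<in> label_perms f A"
  using permutes_in_image by (fastforce simp: label_perms_def intro: permutes_compose)

lemma label_perms_transpose:
  "a \<in> A \<Longrightarrow> b \<in> A \<Longrightarrow> f a = f b \<Longrightarrow> Transposition.transpose a b \<in> label_perms f A"
  unfolding label_perms_def using permutes_swap_id[of a A b] by (auto simp: Transposition.transpose_def)

lemma sum_label_perms_right:
  assumes "q \<in> label_perms f A"
  shows "(\<Sum>r\<in>label_perms f A. F (r \<circ> q)) = sum F (label_perms f A)"
proof (rule sum.reindex_bij_betw)
  have q: "q permutes A" using assms by (simp add: label_perms_def)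
  have "f (inv' q x) = f x" if x: "x \<in> A" for x
  proof -
    have "inv' q x \<in> A" using x permutes_in_image[OF permutes_inv[OF q]] by simp
    then have "f (q (inv' q x)) = f (inv' q x)" using assms by (simp add: label_perms_def)
    then show ?thesis by (simp add: permutes_inverses(1)[OF q])
  qed
  then have "inv' q \<in> label_perms f A"
    using permutes_inv[OF q] by (simp add: label_perms_def)
  then show "bij_betw (\<lambda>r. r \<circ> q) (label_perms f A) (label_perms f A)"
    using label_perms_comp[of _ f A q] label_perms_comp[of _ f A "inv' q"] assms permutes_inv_o[OF q]
    by (intro bij_betwI[where g = "\<lambda>r. r \<circ> inv' q"]) (simp_all add: comp_assoc)
qed

text \<open>Coset decomposition: a permutation of the larger set factors uniquely as
  \<open>r\<close> after the transposition of \<open>a\<close> with the preimage \<open>b\<close> of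
  \<open>a\<close>, the case \<open>b = a\<close> being the identity. The transpositions form a
  Jucys-Murphy element.\<close>

lemma sum_label_perms_insert:
  assumes a: "a \<notin> A"
  shows "(\<Sum>r\<in>label_perms f (insert a A). F r)
    = (\<Sum>b\<in>{b \<in> insert a A. f b = f a}. \<Sum>r\<in>label_perms f A. F (r \<circ> Transposition.transpose a b))"
proof -
  let ?B = "{b \<in> insert a A. f b = f a}"
  let ?t = "Transposition.transpose a"
  have up: "r permutes insert a A" if "r permutes A" for r
    using that by (rule permutes_subset) auto
  have "(\<Sum>b\<in>?B. \<Sum>r\<in>label_perms f A. F (r \<circ> ?t b)) = (\<Sum>(b, r)\<in>?B \<times> label_perms f A. F (r \<circ> ?t b))"
    by (rule sum.cartesian_product)
  also have "\<dots> = (\<Sum>r\<in>label_perms f (insert a A). F r)"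
  proof (rule sum.reindex_bij_witness[where j = "\<lambda>(b, r). r \<circ> ?t b" and i = "\<lambda>r. (inv' r a, r \<circ> ?t (inv' r a))"])
    fix x assume "x \<in> ?B \<times> label_perms f A"
    then obtain b r where x: "x = (b, r)" and b: "b \<in> insert a A" "f b = f a" and r: "r permutes A" "\<forall>x\<in>A. f (r x) = f x"
      by (auto simp: label_perms_def)
    have ra: "r a = a" using r a by (meson permutes_not_in)
    have perm: "r \<circ> ?t b permutes insert a A"
      using up[OF r(1)] b by (intro permutes_compose permutes_swap_id) auto
    have "(r \<circ> ?t b) b = a" using ra by simp
    then have ib: "inv' (r \<circ> ?t b) a = b" using permutes_inv_eq[OF perm] by blast
    show "(case x of (b, r) \<Rightarrow> r \<circ> ?t b) \<in> label_perms f (insert a A)"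
      using perm r b ra by (auto simp: x label_perms_def Transposition.transpose_def)
    show "(inv' (case x of (b, r) \<Rightarrow> r \<circ> ?t b) a, (case x of (b, r) \<Rightarrow> r \<circ> ?t b) \<circ> ?t (inv' (case x of (b, r) \<Rightarrow> r \<circ> ?t b) a)) = x"
      unfolding x prod.case ib by (simp add: comp_assoc)
    show "F (case x of (b, r) \<Rightarrow> r \<circ> ?t b) = (case x of (b, r) \<Rightarrow> F (r \<circ> ?t b))" by (simp add: x)
  next
    fix r assume r: "r \<in> label_perms f (insert a A)"
    then have rp: "r permutes insert a A" by (simp add: label_perms_def)
    define b where "b = inv' r a"
    have rb: "r b = a" unfolding b_def using permutes_inverses[OF rp] by simp
    have b: "b \<in> insert a A" unfolding b_def using permutes_in_image[OF permutes_inv[OF rp], of a] by simp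
    have fb: "f b = f a" using r b rb by (auto simp: label_perms_def)
    have perm: "r \<circ> ?t b permutes insert a A"
      using rp b by (intro permutes_compose permutes_swap_id) auto
    have "r \<circ> ?t b permutes A"
    proof (rule permutes_superset[OF perm])
      fix x assume "x \<in> insert a A - A"
      then have "x = a" by auto
      then show "(r \<circ> ?t b) x = x" using rb by simp
    qed
    moreover have "f ((r \<circ> ?t b) x) = f x" if "x \<in> A" for x
      using r b fb that by (auto simp: label_perms_def Transposition.transpose_def)
    ultimately have "r \<circ> ?t b \<in> label_perms f A" by (simp add: label_perms_def)
    then show "(inv' r a, r \<circ> ?t (inv' r a)) \<in> ?B \<times> label_perms f A"
      using b fb by (simp add: b_def)
    show "(case (inv' r a, r \<circ> ?t (inv' r a)) of (b, r) \<Rightarrow> r \<circ> ?t b) = r"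
      by (simp add: comp_assoc)
  qed
  finally show ?thesis by simp
qed

section \<open>The shape \<open>k^(n-1) 1\<close>, its tableaux and their combs\<close>

locale hook_shape =
  fixes n k :: nat
  assumes n: "n \<ge> 2" and k: "k \<ge> 1"
begin

definition "lam = replicate (n - 1) k @ [1::nat]"
definition "letters_set = {1..nletters n k}"
definition col_length :: "nat \<Rightarrow> nat" where "col_length j = (if j = 0 then n else n - 1)"

abbreviation "S \<equiv> letters_set"
abbreviation "D \<equiv> diagram lam"

lemma finite_S [simp]: "finite S"
  by (simp add: letters_set_def)

lemma sum_list_lam: "sum_list lam = nletters n k"
  by (simp add: lam_def nletters_def sum_list_replicate)

lemma length_lam: "length lam = n"
  using n by (simp add: lam_def)

lemma diagram_iff: "(i, j) \<in> D \<longleftrightarrow> j < k \<and> i < col_length j"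
proof -
  have "lam ! i = (if i < n - 1 then k else 1)" if "i < n"
    using that n by (auto simp: lam_def nth_append)
  then show ?thesis using n k by (auto simp: diagram_def length_lam col_length_def split: if_splits)
qed

lemma diagram_row: "(i, j) \<in> D \<Longrightarrow> i < n"
  using n by (auto simp: diagram_iff col_length_def split: if_splits)

definition positions :: "(nat \<times> nat) list"
  where "positions = concat (map (\<lambda>j. map (\<lambda>i. (i, j)) [0..<col_length j]) [0..<k])"

lemma set_positions: "set positions = D"
  by (auto simp: positions_def diagram_iff)

lemma distinct_positions: "distinct positions"
proof -
  have "distinct (concat (map (\<lambda>j. map (\<lambda>i. (i, j)) [0..<col_length j]) [0..<m]))" for m
    by (induction m) (auto simp: distinct_map inj_on_def)
  then show ?thesis by (simp add: positions_def)
qed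

lemma finite_D [simp]: "finite D"
  unfolding set_positions[symmetric] by simp

definition colist :: "(nat \<times> nat \<Rightarrow> nat) \<Rightarrow> nat list list"
  where "colist t = map (\<lambda>j. map (\<lambda>i. t (i, j)) [0..<col_length j]) [0..<k]"

lemma concat_colist: "concat (colist t) = map t positions"
  by (simp add: colist_def positions_def map_concat comp_def)

lemma colist_comp: "colist (p \<circ> t) = map (map p) (colist t)"
  by (simp add: colist_def)

lemma colist_nth: "j < k \<Longrightarrow> colist t ! j = map (\<lambda>i. t (i, j)) [0..<col_length j]"
  by (simp add: colist_def)

lemma colist_nonempty [simp]: "colist t \<noteq> []"
  using k by (simp add: colist_def)

definition tcomb :: "(nat \<times> nat \<Rightarrow> nat) \<Rightarrow> nat btree"
  where "tcomb t = combl (colist t)"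

lemma tcomb_comp: "tcomb (p \<circ> t) = map_btree p (tcomb t)"
  by (simp add: tcomb_def map_btree_combl colist_comp)

lemma tcomb_cong: "(\<And>x. x \<in> D \<Longrightarrow> t x = t' x) \<Longrightarrow> tcomb t = tcomb t'"
  by (auto simp: tcomb_def colist_def diagram_iff intro!: arg_cong[of _ _ combl])

abbreviation "tabs \<equiv> tableaux lam"

lemma tableau_bij: "t \<in> tabs \<Longrightarrow> bij_betw t D S"
  by (simp add: tableaux_def sum_list_lam letters_set_def)

lemma tableau_comp: "t \<in> tabs \<Longrightarrow> p permutes S \<Longrightarrow> p \<circ> t \<in> tabs"
  using bij_betw_trans[of t D S p S] permutes_imp_bij[of p S]
  by (auto simp: tableaux_def sum_list_lam letters_set_def)

lemma tableau_inj: "t \<in> tabs \<Longrightarrow> x \<in> D \<Longrightarrow> y \<in> D \<Longrightarrow> t x = t y \<longleftrightarrow> x = y"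
  using tableau_bij[of t] by (auto simp: bij_betw_def inj_on_def)

lemma tableau_in: "t \<in> tabs \<Longrightarrow> x \<in> D \<Longrightarrow> t x \<in> S"
  using tableau_bij[of t] by (auto simp: bij_betw_def)

lemma tableau_surj: "t \<in> tabs \<Longrightarrow> a \<in> S \<Longrightarrow> \<exists>i j. (i, j) \<in> D \<and> a = t (i, j)"
  using tableau_bij[of t] by (force simp: bij_betw_def)

lemma cols_ok_colist:
  assumes t: "t \<in> tabs"
  shows "cols_ok n k S (colist t)"
proof -
  have "distinct (concat (colist t))" "set (concat (colist t)) = S"
    using tableau_bij[OF t] distinct_positions unfolding concat_colist
    by (auto simp: distinct_map set_positions bij_betw_def)
  moreover have "length (hd (colist t)) = n" using k by (simp add: hd_conv_nth colist_nth col_length_def)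
  moreover have "length B = n - 1" if "B \<in> set (tl (colist t))" for B
  proof -
    have "tl (colist t) = map (\<lambda>j. map (\<lambda>i. t (i, j)) [0..<col_length j]) [1..<k]"
      using k by (simp add: colist_def upt_conv_Cons flip: map_tl)
    then show ?thesis using that by (auto simp: col_length_def)
  qed
  ultimately show ?thesis by (simp add: cols_ok_def) (simp add: colist_def)
qed

lemma tcomb_bracketing: "t \<in> tabs \<Longrightarrow> tcomb t \<in> bracketings n S"
  unfolding tcomb_def using n by (intro cols_ok_bracketing[OF _ cols_ok_colist]) auto

lemma letters_tcomb: "t \<in> tabs \<Longrightarrow> distinct (letters (tcomb t)) \<and> set (letters (tcomb t)) = S"
proof -
  assume t: "t \<in> tabs"
  have ms: "mset (letters (tcomb t)) = mset (concat (colist t))"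
    unfolding tcomb_def by (rule letters_combl) simp
  show ?thesis
    using cols_ok_colist[OF t] mset_eq_imp_distinct_iff[OF ms] mset_eq_setD[OF ms] by (auto simp: cols_ok_def)
qed

lemma sib_tcomb:
  assumes "(i, j) \<in> D" "(i', j) \<in> D"
  shows "sib (t (i, j)) (t (i', j)) (tcomb t)"
proof -
  have j: "j < k" "i < col_length j" "i' < col_length j" using assms by (auto simp: diagram_iff)
  have "colist t ! j \<in> set (colist t)" using j by (intro nth_mem) (simp add: colist_def)
  then have "colist t ! j \<in> set (hd (colist t) # tl (colist t))" by simp
  then show ?thesis unfolding tcomb_def combl_def
    by (rule sib_comb) (use j in \<open>auto simp: colist_nth\<close>)
qed

definition pos :: "(nat \<times> nat \<Rightarrow> nat) \<Rightarrow> nat \<Rightarrow> nat \<times> nat"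
  where "pos t = inv_into D t"

abbreviation "rowt t a \<equiv> fst (pos t a)"
abbreviation "colt t a \<equiv> snd (pos t a)"

lemma pos_tableau [simp]: "t \<in> tabs \<Longrightarrow> x \<in> D \<Longrightarrow> pos t (t x) = x"
  using tableau_bij[of t] by (simp add: pos_def bij_betw_def)

lemma tableau_pos: "t \<in> tabs \<Longrightarrow> a \<in> S \<Longrightarrow> pos t a \<in> D \<and> t (pos t a) = a"
  using tableau_surj[of t a] by auto

definition col_stab :: "(nat \<times> nat \<Rightarrow> nat) \<Rightarrow> (nat \<Rightarrow> nat) set"
  where "col_stab t = label_perms (colt t) S"

definition row_stab :: "(nat \<times> nat \<Rightarrow> nat) \<Rightarrow> (nat \<Rightarrow> nat) set"
  where "row_stab t = label_perms (rowt t) S"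

lemma column_stabilizer_eq:
  assumes t: "t \<in> tabs"
  shows "column_stabilizer lam t = col_stab t"
proof -
  have col: "t ` {(i, j') \<in> D. j' = j} = {a \<in> S. colt t a = j}" for j
  proof (intro equalityI subsetI)
    fix a assume "a \<in> {a \<in> S. colt t a = j}"
    then show "a \<in> t ` {(i, j') \<in> D. j' = j}"
      using tableau_pos[OF t, of a] by (intro image_eqI[of _ _ "pos t a"]) auto
  qed (use t tableau_in in auto)
  have "(\<forall>j. p ` {a \<in> S. colt t a = j} = {a \<in> S. colt t a = j}) \<longleftrightarrow> (\<forall>x\<in>S. colt t (p x) = colt t x)"
    if p: "p permutes S" for p
  proof
    assume *: "\<forall>j. p ` {a \<in> S. colt t a = j} = {a \<in> S. colt t a = j}"
    show "\<forall>x\<in>S. colt t (p x) = colt t x"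
    proof
      fix x assume "x \<in> S"
      then have "p x \<in> p ` {a \<in> S. colt t a = colt t x}" by auto
      then show "colt t (p x) = colt t x" using * by auto
    qed
  next
    assume *: "\<forall>x\<in>S. colt t (p x) = colt t x"
    show "\<forall>j. p ` {a \<in> S. colt t a = j} = {a \<in> S. colt t a = j}"
    proof
      fix j
      have "p ` {a \<in> S. colt t a = j} \<subseteq> {a \<in> S. colt t a = j}"
        using * permutes_in_image[OF p] by auto
      moreover have "card (p ` {a \<in> S. colt t a = j}) = card {a \<in> S. colt t a = j}"
        by (rule card_image) (rule inj_on_subset[OF permutes_inj[OF p] subset_UNIV])
      ultimately show "p ` {a \<in> S. colt t a = j} = {a \<in> S. colt t a = j}"
        by (intro card_subset_eq) auto
    qed
  qed
  moreover have "carrier (sym_group (sum_list lam)) = {p. p permutes S}"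
    by (simp add: sym_group_def sum_list_lam letters_set_def)
  ultimately show ?thesis
    unfolding column_stabilizer_def col_stab_def label_perms_def col by auto
qed

lemma tcomb_transpose:
  assumes L: "fil_funct n S L" and t: "t \<in> tabs" and ab: "a \<in> S" "b \<in> S" "a \<noteq> b" "colt t a = colt t b"
  shows "L (tcomb (Transposition.transpose a b \<circ> t)) = - L (tcomb t)"
proof -
  have a: "pos t a \<in> D" "t (pos t a) = a" and b: "pos t b \<in> D" "t (pos t b) = b"
    using tableau_pos[OF t] ab by auto
  have "sib (t (rowt t a, colt t a)) (t (rowt t b, colt t a)) (tcomb t)"
    using a b ab(4) by (intro sib_tcomb) (metis prod.collapse)+
  then have "sib a b (tcomb t)" using a b ab(4) by (metis prod.collapse)
  then show ?thesis unfolding tcomb_comp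
    using letters_tcomb[OF t] tcomb_bracketing[OF t] ab(3) by (intro sib_antisym[OF _ L]) auto
qed

lemma tcomb_col_stab:
  assumes L: "fil_funct n S L" and t: "t \<in> tabs" and p: "p \<in> col_stab t"
  shows "L (tcomb (p \<circ> t)) = of_int (sign p) * L (tcomb t)"
proof -
  have pp: "p permutes S" "\<And>x. x \<in> S \<Longrightarrow> colt t (p x) = colt t x"
    using p by (auto simp: col_stab_def label_perms_def)
  let ?P = "\<lambda>p. \<forall>t'\<in>tabs. (\<forall>a\<in>S. colt t' a = colt t a) \<longrightarrow> L (tcomb (p \<circ> t')) = of_int (sign p) * L (tcomb t')"
  have "?P p"
  proof (rule label_preserving_induct[where P = ?P and f = "colt t", OF finite_S pp])
    show "?P id" by simp
  next
    fix a b q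
    assume swap: "a \<in> S" "b \<in> S" "a \<noteq> b" "colt t a = colt t b" "q permutes S" "\<And>x. x \<in> S \<Longrightarrow> colt t (q x) = colt t x" "?P q"
    have "L (tcomb (Transposition.transpose a b \<circ> q \<circ> t')) = of_int (sign (Transposition.transpose a b \<circ> q)) * L (tcomb t')"
      if t': "t' \<in> tabs" "\<forall>a\<in>S. colt t' a = colt t a" for t'
    proof -
      have qt: "q \<circ> t' \<in> tabs" by (rule tableau_comp[OF t'(1) swap(5)])
      \<comment> \<open>\<open>q\<close> preserves columns, so \<open>a\<close> and \<open>b\<close>
        also share a column of \<open>q \<circ> t'\<close>.\<close>
      have col: "colt (q \<circ> t') x = colt t x" if x: "x \<in> S" for x
      proof -
        obtain y where y: "y \<in> S" "q y = x" using x permutes_image[OF swap(5)] by (metis imageE)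
        have "pos (q \<circ> t') x = pos t' y"
          using pos_tableau[OF qt, of "pos t' y"] tableau_pos[OF t'(1) y(1)] y by simp
        then show ?thesis using y swap(6)[OF y(1)] t'(2) by simp
      qed
      have "permutation q" using swap(5) permutation_permutes finite_S by blast
      then have sg: "sign (Transposition.transpose a b \<circ> q) = - sign q"
        using swap(3) by (simp add: sign_compose permutation_swap_id sign_swap_id)
      have "L (tcomb (Transposition.transpose a b \<circ> (q \<circ> t'))) = - L (tcomb (q \<circ> t'))"
        using swap col by (intro tcomb_transpose[OF L qt]) auto
      then show ?thesis using swap(7) t' sg by (simp add: comp_assoc)
    qed
    then show "?P (Transposition.transpose a b \<circ> q)" by simp
  qed
  then show ?thesis using t by blast
qed

end

context hook_shape
begin

subsection \<open>Tabloids\<close>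

lemma pos_comp:
  assumes "t \<in> tabs" "p permutes S" "a \<in> S"
  shows "pos (p \<circ> t) a = pos t (inv' p a)"
proof -
  have "inv' p a \<in> S" using assms permutes_in_image[OF permutes_inv[OF assms(2)]] by simp
  from tableau_pos[OF assms(1) this] have "pos t (inv' p a) \<in> D" "(p \<circ> t) (pos t (inv' p a)) = a"
    by (simp_all add: permutes_inverses(1)[OF assms(2)])
  then show ?thesis using pos_tableau[OF tableau_comp[OF assms(1,2)], of "pos t (inv' p a)"] by simp
qed

lemma length_tabloid: "length (tabloid lam t) = n"
  by (simp add: tabloid_def length_lam)

lemma tabloid_nth:
  assumes "t \<in> tabs" "i < n"
  shows "tabloid lam t ! i = {a \<in> S. rowt t a = i}"
proof -
  have "tabloid lam t ! i = t ` {(i', j) \<in> D. i' = i}"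
    using assms(2) by (simp add: tabloid_def length_lam)
  also have "\<dots> = {a \<in> S. rowt t a = i}"
  proof (intro equalityI subsetI)
    fix a assume "a \<in> {a \<in> S. rowt t a = i}"
    then show "a \<in> t ` {(i', j) \<in> D. i' = i}"
      using tableau_pos[OF assms(1), of a] by (intro image_eqI[of _ _ "pos t a"]) auto
  qed (use assms tableau_in in auto)
  finally show ?thesis .
qed

lemma rowt_less: "t \<in> tabs \<Longrightarrow> a \<in> S \<Longrightarrow> rowt t a < n"
  using tableau_pos[of t a] diagram_row by (metis prod.collapse)

lemma tabloid_eq_iff:
  assumes "t \<in> tabs" "t' \<in> tabs"
  shows "tabloid lam t' = tabloid lam t \<longleftrightarrow> (\<forall>a\<in>S. rowt t' a = rowt t a)"
proof
  assume eq: "tabloid lam t' = tabloid lam t"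
  show "\<forall>a\<in>S. rowt t' a = rowt t a"
  proof
    fix a assume a: "a \<in> S"
    have "a \<in> tabloid lam t' ! rowt t' a" using a assms rowt_less by (simp add: tabloid_nth)
    then show "rowt t' a = rowt t a" using a assms rowt_less by (simp add: eq tabloid_nth)
  qed
next
  assume "\<forall>a\<in>S. rowt t' a = rowt t a"
  then show "tabloid lam t' = tabloid lam t"
    using assms by (intro nth_equalityI) (auto simp: length_tabloid tabloid_nth)
qed

lemma tabloid_row_stab:
  assumes t: "t \<in> tabs" and r: "r permutes S"
  shows "tabloid lam (r \<circ> t) = tabloid lam t \<longleftrightarrow> r \<in> row_stab t"
proof -
  have inv: "inv' r a \<in> S" if "a \<in> S" for a using that permutes_in_image[OF permutes_inv[OF r]] by simp
  have "(\<forall>a\<in>S. rowt t (inv' r a) = rowt t a) \<longleftrightarrow> (\<forall>a\<in>S. rowt t (r a) = rowt t a)"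
    using inv permutes_in_image[OF r] permutes_inverses[OF r] by metis
  then show ?thesis
    using r pos_comp[OF t r] by (simp add: tabloid_eq_iff[OF t tableau_comp[OF t r]] row_stab_def label_perms_def)
qed

lemma map_image_tabloid: "map (image p) (tabloid lam t) = tabloid lam (p \<circ> t)"
  by (auto simp: tabloid_def image_comp comp_def)

lemma tableaux_transitive:
  assumes "u \<in> tabs" "s \<in> tabs"
  shows "\<exists>r. r permutes S \<and> (\<forall>x\<in>D. r (u x) = s x)"
proof -
  define r where "r a = (if a \<in> S then s (pos u a) else a)" for a
  have "bij_betw (\<lambda>a. s (pos u a)) S S"
    unfolding pos_def
    using bij_betw_trans[OF bij_betw_inv_into[OF tableau_bij[OF assms(1)]] tableau_bij[OF assms(2)]] by (simp add: comp_def)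
  then have "bij_betw r S S" by (rule bij_betw_cong[THEN iffD1, rotated]) (simp add: r_def)
  then have "r permutes S" by (rule bij_imp_permutes) (simp add: r_def)
  then show ?thesis using assms tableau_in[OF assms(1)] by (intro exI[of _ r]) (simp add: r_def)
qed

lemma tableau_last_row:
  assumes "t \<in> tabs" "a \<in> S" "b \<in> S" "rowt t a = n - 1" "rowt t b = n - 1"
  shows "a = b"
proof -
  have "pos t x = (n - 1, 0)" if "x \<in> S" "rowt t x = n - 1" for x
  proof -
    have "(n - 1, colt t x) \<in> D" using tableau_pos[OF assms(1) that(1)] that(2) by (metis prod.collapse)
    then have "colt t x = 0" by (auto simp: diagram_iff col_length_def split: if_splits)
    then show ?thesis using that(2) by (metis prod.collapse)
  qed
  then show ?thesis using tableau_pos[OF assms(1)] assms by metis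
qed

text \<open>If the letters of every column of \<open>t\<close> lie in distinct rows of \<open>u\<close>, then moving each letter
  within its column to its row in \<open>u\<close> gives a tableau with the tabloid of \<open>u\<close>.\<close>

lemma column_row_dichotomy:
  assumes t: "t \<in> tabs" and u: "u \<in> tabs"
  shows "(\<exists>p\<in>col_stab t. tabloid lam (p \<circ> t) = tabloid lam u) \<or>
    (\<exists>a\<in>S. \<exists>b\<in>S. a \<noteq> b \<and> colt t a = colt t b \<and> rowt u a = rowt u b)"
proof (rule disjCI)
  assume no: "\<not> (\<exists>a\<in>S. \<exists>b\<in>S. a \<noteq> b \<and> colt t a = colt t b \<and> rowt u a = rowt u b)"
  define C0 where "C0 = {a \<in> S. colt t a = 0}"
  \<comment> \<open>The first column has \<open>n\<close> letters in distinct rows of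
    \<open>u\<close>, so it meets every row. In particular it contains the only letter of the last
    row, and the letters of the shorter columns have a cell to move to.\<close>
  have "rowt u ` C0 = {..<n}"
  proof (rule card_subset_eq)
    have "C0 = t ` ((\<lambda>i. (i, 0)) ` {..<n})"
    proof (intro equalityI subsetI)
      fix a assume "a \<in> C0"
      then have a: "pos t a \<in> D" "t (pos t a) = a" "colt t a = 0" using tableau_pos[OF t] by (auto simp: C0_def)
      then have "pos t a = (rowt t a, 0)" by (metis prod.collapse)
      moreover have "rowt t a < n" using a diagram_row by (metis prod.collapse)
      ultimately have "(rowt t a, 0) \<in> (\<lambda>i. (i, 0)) ` {..<n}" "a = t (rowt t a, 0)" using a(2) by auto
      then show "a \<in> t ` ((\<lambda>i. (i, 0)) ` {..<n})" by (rule rev_image_eqI)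
    next
      fix a assume "a \<in> t ` ((\<lambda>i. (i, 0)) ` {..<n})"
      then obtain i where i: "i < n" "a = t (i, 0)" by auto
      then have "(i, 0) \<in> D" using k by (simp add: diagram_iff col_length_def)
      then show "a \<in> C0" using i t tableau_in by (simp add: C0_def)
    qed
    moreover have "inj_on t ((\<lambda>i. (i, 0)) ` {..<n})"
    proof -
      have "(\<lambda>i. (i, 0)) ` {..<n} \<subseteq> D" using k by (auto simp: diagram_iff col_length_def)
      then show ?thesis using tableau_bij[OF t] inj_on_subset by (auto simp: bij_betw_def)
    qed
    ultimately have "card C0 = n" by (simp add: card_image inj_on_def)
    moreover have "inj_on (rowt u) C0"
    proof (rule inj_onI)
      fix a b assume "a \<in> C0" "b \<in> C0" "rowt u a = rowt u b"
      then show "a = b" using no unfolding C0_def by (metis (mono_tags, lifting) mem_Collect_eq)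
    qed
    ultimately show "card (rowt u ` C0) = card {..<n}" by (simp add: card_image)
  qed (use rowt_less[OF u] in \<open>auto simp: C0_def\<close>)
  then have "n - 1 \<in> rowt u ` C0" using n by simp
  then obtain z where z: "z \<in> S" "colt t z = 0" "rowt u z = n - 1"
    unfolding C0_def by auto
  \<comment> \<open>\<open>q\<close> sends a letter to the one that \<open>t\<close> has in the same
    column and in the row prescribed by \<open>u\<close>; the column permutation sought is its
    inverse.\<close>
  define q where "q a = (if a \<in> S then t (rowt u a, colt t a) else a)" for a
  have inD: "(rowt u a, colt t a) \<in> D" if a: "a \<in> S" for a
  proof -
    have c: "colt t a < k" using tableau_pos[OF t a] by (metis diagram_iff prod.collapse)
    have "rowt u a < col_length (colt t a)"
    proof (cases "colt t a = 0")
      case True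
      then show ?thesis using rowt_less[OF u a] by (simp add: col_length_def)
    next
      case False
      then have "rowt u a \<noteq> n - 1" using tableau_last_row[OF u a z(1)] z by auto
      then show ?thesis using rowt_less[OF u a] False by (simp add: col_length_def)
    qed
    then show ?thesis using c by (simp add: diagram_iff)
  qed
  have "inj_on q S"
    using inD no tableau_inj[OF t] by (auto simp: inj_on_def q_def)
  moreover have "q ` S \<subseteq> S" using inD tableau_in[OF t] by (auto simp: q_def)
  ultimately have "bij_betw q S S" by (simp add: bij_betw_def endo_inj_surj)
  then have q: "q permutes S" by (rule bij_imp_permutes) (simp add: q_def)
  have posq: "pos t (q a) = (rowt u a, colt t a)" if "a \<in> S" for a
    using that inD t by (simp add: q_def)
  define p where "p = inv' q"
  have p: "p permutes S" unfolding p_def by (rule permutes_inv[OF q])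
  have invp: "inv' p = q" unfolding p_def by (rule inv_inv_eq[OF permutes_bij[OF q]])
  have "tabloid lam (p \<circ> t) = tabloid lam u"
    using posq by (simp add: tabloid_eq_iff[OF u tableau_comp[OF t p]] pos_comp[OF t p] invp)
  moreover have "p \<in> col_stab t"
  proof -
    have "colt t (p x) = colt t x" if x: "x \<in> S" for x
    proof -
      have "p x \<in> S" using x permutes_in_image[OF p] by simp
      from posq[OF this] show ?thesis unfolding p_def using permutes_inverses(1)[OF q] by simp
    qed
    then show ?thesis using p by (simp add: col_stab_def label_perms_def)
  qed
  ultimately show "\<exists>p\<in>col_stab t. tabloid lam (p \<circ> t) = tabloid lam u" by blast
qed

subsection \<open>Combs and tableaux\<close>

lemma bracketed_permutationsD:
  "x \<in> bracketed_permutations n k \<Longrightarrow> x \<in> bracketings n S \<and> distinct (letters x) \<and> set (letters x) = S"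
  by (simp add: bracketed_permutations_def letters_set_def)

lemma bracketed_permutationsI:
  "x \<in> bracketings n S \<Longrightarrow> distinct (letters x) \<Longrightarrow> set (letters x) = S \<Longrightarrow> x \<in> bracketed_permutations n k"
  by (simp add: bracketed_permutations_def letters_set_def)

lemma tcomb_bracketed: "t \<in> tabs \<Longrightarrow> tcomb t \<in> bracketed_permutations n k"
  using letters_tcomb tcomb_bracketing by (simp add: bracketed_permutationsI)

lemma bracketed_relabel:
  assumes "x \<in> bracketed_permutations n k" "p permutes S"
  shows "map_btree p x \<in> bracketed_permutations n k"
proof (rule bracketed_permutationsI)
  note x = bracketed_permutationsD[OF assms(1)]
  show "map_btree p x \<in> bracketings n S"
    using x permutes_image[OF assms(2)] by (intro bracketings_map_btree[of _ _ S]) auto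
  show "distinct (letters (map_btree p x))" "set (letters (map_btree p x)) = S"
    using x permutes_image[OF assms(2)] inj_on_subset[OF permutes_inj[OF assms(2)] subset_UNIV]
    by (auto simp: letters_map_btree distinct_map)
qed

lemma noncomb_relabel: "noncomb (map_btree p x) = noncomb x"
proof (induction x)
  case (Br ts)
  have "(\<exists>t\<in>set ts. noncomb (map_btree p t)) = (\<exists>t\<in>set ts. noncomb t)" using Br by auto
  then show ?case by (simp add: letters_map_btree cong: conj_cong)
qed simp

lemma cols_ok_tableau:
  assumes "cols_ok n k S Cs"
  shows "\<exists>s\<in>tabs. tcomb s = combl Cs"
proof -
  define s where "s = (\<lambda>(i, j). Cs ! j ! i)"
  have len: "length Cs = k" "Cs \<noteq> []" using assms by (auto simp: cols_ok_def)
  have cl: "length (Cs ! j) = col_length j" if j: "j < k" for j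
  proof (cases j)
    case 0 then show ?thesis using assms len by (simp add: cols_ok_def col_length_def hd_conv_nth[symmetric])
  next
    case (Suc i)
    then have "i < length (tl Cs)" using j len by simp
    then have "tl Cs ! i \<in> set (tl Cs)" by (rule nth_mem)
    moreover have "tl Cs ! i = Cs ! j" using \<open>i < length (tl Cs)\<close> Suc by (simp add: nth_tl)
    ultimately have "Cs ! j \<in> set (tl Cs)" by metis
    then show ?thesis using assms Suc by (simp add: cols_ok_def col_length_def)
  qed
  have co: "colist s = Cs"
  proof (rule nth_equalityI)
    fix j assume "j < length (colist s)"
    then have j: "j < k" by (simp add: colist_def)
    have "map (\<lambda>i. Cs ! j ! i) [0..<col_length j] = Cs ! j"
      using map_nth[of "Cs ! j"] by (simp add: cl[OF j])
    then show "colist s ! j = Cs ! j" using j by (simp add: colist_nth s_def)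
  qed (simp add: colist_def len)
  have "distinct (map s positions)" "set (map s positions) = S"
    using assms unfolding concat_colist[symmetric] co by (auto simp: cols_ok_def)
  then have "bij_betw s D S" using set_positions by (auto simp: bij_betw_def distinct_map)
  then have "s \<in> tabs" by (simp add: tableaux_def sum_list_lam letters_set_def)
  then show ?thesis using co by (intro bexI[of _ s]) (auto simp: tcomb_def)
qed

lemma bracketed_comb:
  assumes x: "x \<in> bracketed_permutations n k" "\<not> noncomb x"
  shows "\<exists>c. \<exists>s\<in>tabs. (c = 1 \<or> c = -1) \<and> (\<forall>L. fil_funct n S L \<longrightarrow> L x = c * L (tcomb s))"
proof -
  note xx = bracketed_permutationsD[OF x(1)]
  have cS: "card S = k * (n - 1) + 1" by (simp add: letters_set_def nletters_def)
  have lx: "length (letters x) = k * (n - 1) + 1" using xx cS distinct_card by metis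
  obtain ts where "x = Br ts"
  proof (cases x)
    case (Letter a)
    then show thesis using lx n k by simp
  qed
  then obtain A Bs c where A: "c = 1 \<or> c = -1" "comb_shape n S A Bs" "mset (letters x) = mset (letters (comb A Bs))"
    "\<forall>L. fil_funct n S L \<longrightarrow> L x = c * L (comb A Bs)"
    using comb_normal_form[of x n S] xx x(2) n by blast
  have ms: "mset (letters x) = mset (concat (A # Bs))" using A(3) by (simp add: letters_comb)
  have "length (concat Bs) = length Bs * (n - 1)"
    using A(2) by (induction Bs) (auto simp: comb_shape_def)
  \<comment> \<open>Counting letters: the innermost bracket has \<open>n\<close> and each block
    \<open>n - 1\<close>, which forces \<open>k\<close> columns.\<close>
  then have "k * (n - 1) + 1 = n + length Bs * (n - 1)"
    using lx mset_eq_length[OF ms] A(2) by (simp add: comb_shape_def)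
  moreover obtain m where m: "n = Suc m" "m \<noteq> 0" using n by (cases n) auto
  ultimately have "k * m = (length Bs + 1) * m" by simp
  then have "length Bs + 1 = k" using m(2) by (simp only: mult_cancel2) simp
  then have "cols_ok n k S (A # Bs)"
    using A(2) xx mset_eq_imp_distinct_iff[OF ms] mset_eq_setD[OF ms]
    by (simp add: cols_ok_def comb_shape_def)
  then obtain s where "s \<in> tabs" "tcomb s = combl (A # Bs)" using cols_ok_tableau by blast
  then show ?thesis using A by (intro exI[of _ c] bexI[of _ s]) (simp_all add: combl_def)
qed

text \<open>The value of every \<open>tcomb t\<close> in the evaluation along the rows of
  \<open>t\<close> itself; it serves to normalize \<open>phi\<close>.\<close>

definition comb_value :: complex
  where "comb_value = eval_last n id (std_comb n (k - 1))"

lemma comb_value_nonzero: "comb_value \<noteq> 0"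
  unfolding comb_value_def using n by (intro eval_last_std_comb_nonzero) simp

lemma eval_last_tcomb:
  assumes t: "t \<in> tabs"
  shows "eval_last n (rowt t) (tcomb t) = comb_value"
proof -
  have row: "map (rowt t) (map (\<lambda>i. t (i, j)) [0..<col_length j]) = [0..<col_length j]" if "j < k" for j
    using that t by (auto simp: comp_def diagram_iff intro!: map_idI)
  have hd: "hd (colist t) = map (\<lambda>i. t (i, 0)) [0..<col_length 0]" using k by (simp add: hd_conv_nth colist_nth)
  have tl: "tl (colist t) = map (\<lambda>j. map (\<lambda>i. t (i, j)) [0..<col_length j]) [1..<k]"
    using k by (simp add: colist_def upt_conv_Cons)
  have "eval_last n (rowt t) (comb (hd (colist t)) (tl (colist t))) = eval_last n id (std_comb n (length (tl (colist t))))"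
  proof (rule eval_last_std_comb)
    show "map (rowt t) (hd (colist t)) = [0..<n]" unfolding hd using row[of 0] k by (simp add: col_length_def)
    show "\<forall>B\<in>set (tl (colist t)). map (rowt t) B = [0..<n - 1]"
    proof
      fix B assume "B \<in> set (tl (colist t))"
      then obtain j where j: "1 \<le> j" "j < k" "B = map (\<lambda>i. t (i, j)) [0..<col_length j]" unfolding tl by auto
      then show "map (rowt t) B = [0..<n - 1]" using row[of j] by (simp add: col_length_def)
    qed
  qed
  then show ?thesis by (simp add: tcomb_def combl_def comb_value_def) (simp add: colist_def)
qed

text \<open>Row invariance and antisymmetry conflict whenever two letters of a row of
  \<open>u\<close> are siblings, which kills non-combs and many combs. A remaining comb is, up to
  sign, a row permutation of \<open>tcomb u\<close>. Hence any two such functionals are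
  proportional, and \<open>L\<close> is compared with the evaluation along the rows of
  \<open>u\<close>.\<close>

lemma row_invariant_functional:
  assumes u: "u \<in> tabs" and L: "fil_funct n S L"
    and inv: "\<And>r x. r \<in> row_stab u \<Longrightarrow> x \<in> bracketed_permutations n k \<Longrightarrow> L (map_btree r x) = L x"
    and x: "x \<in> bracketed_permutations n k"
  shows "comb_value * L x = eval_last n (rowt u) x * L (tcomb u)" and "noncomb x \<Longrightarrow> L x = 0"
proof -
  have E: "fil_funct n S (eval_last n (rowt u))" using n by (intro fil_funct_eval_last) simp
  have Einv: "eval_last n (rowt u) (map_btree r x) = eval_last n (rowt u) x"
    if r: "r \<in> row_stab u" and x: "x \<in> bracketed_permutations n k" for r x
  proof -
    have "ev (rowt u \<circ> r) x = ev (rowt u) x"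
      using r bracketed_permutationsD[OF x] by (intro ev_cong) (auto simp: row_stab_def label_perms_def)
    then show ?thesis unfolding eval_last_map_btree by (simp add: eval_last_def)
  qed
  \<comment> \<open>Stated for an arbitrary functional, as it is applied both to \<open>L\<close>
    and to the evaluation.\<close>
  have nc: "L x = 0" if "noncomb x" "x \<in> bracketed_permutations n k" "fil_funct n S L"
    "\<And>r x. r \<in> row_stab u \<Longrightarrow> x \<in> bracketed_permutations n k \<Longrightarrow> L (map_btree r x) = L x" for x L
  proof -
    note xx = bracketed_permutationsD[OF that(2)]
    have "\<exists>a b. a \<noteq> b \<and> rowt u a = rowt u b \<and> sib a b x"
      using xx rowt_less[OF u] tableau_last_row[OF u]
      by (intro noncomb_same_row[of x n S, OF that(1)]) auto
    then obtain a b where ab: "a \<noteq> b" "rowt u a = rowt u b" "sib a b x" by blast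
    then have "Transposition.transpose a b \<in> row_stab u"
      using sib_letters[OF ab(3)] xx by (auto simp: row_stab_def intro!: label_perms_transpose)
    then have "L (map_btree (Transposition.transpose a b) x) = L x" using that by blast
    moreover have "L (map_btree (Transposition.transpose a b) x) = - L x"
      using xx ab by (intro sib_antisym[OF ab(3) that(3)]) auto
    ultimately show ?thesis by simp
  qed
  show ncx: "L x = 0" if "noncomb x" by (rule nc[OF that x L inv])
  show "comb_value * L x = eval_last n (rowt u) x * L (tcomb u)"
  proof (cases "noncomb x")
    case True
    then show ?thesis using ncx nc[OF True x E Einv] by simp
  next
    case False
    obtain c s where c: "s \<in> tabs" "\<forall>L. fil_funct n S L \<longrightarrow> L x = c * L (tcomb s)"
      using bracketed_comb[OF x False] by blast
    have "comb_value * L (tcomb s) = eval_last n (rowt u) (tcomb s) * L (tcomb u)"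
      using column_row_dichotomy[OF c(1) u]
    proof
      assume "\<exists>p\<in>col_stab s. tabloid lam (p \<circ> s) = tabloid lam u"
      then obtain p where p: "p \<in> col_stab s" "tabloid lam (p \<circ> s) = tabloid lam u" by blast
      have pp: "p permutes S" using p(1) by (simp add: col_stab_def label_perms_def)
      have ps: "p \<circ> s \<in> tabs" by (rule tableau_comp[OF c(1) pp])
      obtain r where r: "r permutes S" "\<forall>y\<in>D. r (u y) = (p \<circ> s) y" using tableaux_transitive[OF u ps] by blast
      have tc: "tcomb (p \<circ> s) = tcomb (r \<circ> u)" using r by (intro tcomb_cong) simp
      have "tabloid lam (r \<circ> u) = tabloid lam (p \<circ> s)"
        using r(2) by (auto simp: tabloid_def intro!: image_cong)
      then have rs: "r \<in> row_stab u" using p(2) tabloid_row_stab[OF u r(1)] by simp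
      have *: "L (tcomb u) = of_int (sign p) * L (tcomb s)"
        if "fil_funct n S L" "\<And>r x. r \<in> row_stab u \<Longrightarrow> x \<in> bracketed_permutations n k \<Longrightarrow> L (map_btree r x) = L x" for L
        using tcomb_col_stab[OF that(1) c(1) p(1)] that(2)[OF rs tcomb_bracketed[OF u]] tc by (simp add: tcomb_comp)
      have "(of_int (sign p) :: complex) * of_int (sign p) = 1" by (metis of_int_1 of_int_mult sign_idempotent)
      then show ?thesis using *[OF L inv] *[OF E Einv] eval_last_tcomb[OF u] by (simp add: mult.commute mult.left_commute)
    next
      assume "\<exists>a\<in>S. \<exists>b\<in>S. a \<noteq> b \<and> colt s a = colt s b \<and> rowt u a = rowt u b"
      then obtain a b where ab: "a \<in> S" "b \<in> S" "a \<noteq> b" "colt s a = colt s b" "rowt u a = rowt u b" by blast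
      have rs: "Transposition.transpose a b \<in> row_stab u"
        using ab by (auto simp: row_stab_def intro!: label_perms_transpose)
      have "L (tcomb s) = 0"
        if "fil_funct n S L" "\<And>r x. r \<in> row_stab u \<Longrightarrow> x \<in> bracketed_permutations n k \<Longrightarrow> L (map_btree r x) = L x" for L
        using tcomb_transpose[OF that(1) c(1) ab(1-4)] that(2)[OF rs tcomb_bracketed[OF c(1)]] by (simp add: tcomb_comp)
      from this[OF L inv] this[OF E Einv] show ?thesis by simp
    qed
    moreover have "L x = c * L (tcomb s)" "eval_last n (rowt u) x = c * eval_last n (rowt u) (tcomb s)"
      using c(2) L E by blast+
    ultimately show ?thesis by (simp add: mult.left_commute mult.assoc)
  qed
qed

end

section \<open>Column antisymmetrization of row symmetrization\<close>

lemma transpose_comp_inj: "inj g \<Longrightarrow> Transposition.transpose (g a) (g b) \<circ> g = g \<circ> Transposition.transpose a b"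
  by (auto simp: fun_eq_iff Transposition.transpose_def inj_eq)

context hook_shape
begin

lemma tcomb_garnir:
  assumes L: "comb_funct n S (mset_set S) L" and t: "t \<in> tabs" and jl: "j < l" and q: "(i0, l) \<in> D"
  shows "L (tcomb t) = (\<Sum>i<col_length j. L (tcomb (Transposition.transpose (t (i, j)) (t (i0, l)) \<circ> t)))"
proof -
  interpret comb_functional n k S L by unfold_locales (use n L in auto)
  have l: "l < k" "i0 < col_length l" using q by (auto simp: diagram_iff)
  have "L (tcomb t) = (\<Sum>x\<in>set (colist t ! j). L (combl (map (map (Transposition.transpose x (t (i0, l)))) (colist t))))"
    unfolding tcomb_def using l jl by (intro L_garnir[OF cols_ok_colist[OF t], of j l]) (auto simp: colist_nth)
  also have "\<dots> = (\<Sum>x\<in>(\<lambda>i. t (i, j)) ` {..<col_length j}. L (tcomb (Transposition.transpose x (t (i0, l)) \<circ> t)))"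
    using l jl by (intro sum.cong) (auto simp: colist_nth tcomb_def colist_comp)
  also have "\<dots> = (\<Sum>i<col_length j. L (tcomb (Transposition.transpose (t (i, j)) (t (i0, l)) \<circ> t)))"
  proof (subst sum.reindex)
    show "inj_on (\<lambda>i. t (i, j)) {..<col_length j}"
      using l jl tableau_inj[OF t] by (auto simp: inj_on_def diagram_iff)
  qed simp
  finally show ?thesis .
qed

text \<open>Column antisymmetry and the Garnir relations abstract \<open>g \<mapsto> L (tcomb (g \<circ> t))\<close>.\<close>

definition specht_like :: "(nat \<times> nat \<Rightarrow> nat) \<Rightarrow> ((nat \<Rightarrow> nat) \<Rightarrow> complex) \<Rightarrow> bool"
  where "specht_like t U \<longleftrightarrow>
    (\<forall>g p. g permutes S \<longrightarrow> p \<in> col_stab t \<longrightarrow> U (g \<circ> p) = of_int (sign p) * U g) \<and>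
    (\<forall>g i0 j l. g permutes S \<longrightarrow> j < l \<longrightarrow> (i0, l) \<in> D \<longrightarrow>
      U g = (\<Sum>i<col_length j. U (g \<circ> Transposition.transpose (t (i, j)) (t (i0, l)))))"

lemma comp_col_stab:
  assumes L: "fil_funct n S L" and t: "t \<in> tabs" and g: "g permutes S" and p: "p \<in> col_stab t"
  shows "L (tcomb (g \<circ> p \<circ> t)) = of_int (sign p) * L (tcomb (g \<circ> t))"
proof -
  have "fil_funct n S (\<lambda>x. L (map_btree g x))"
    using L permutes_image[OF g] by (intro fil_funct_relabel) auto
  from tcomb_col_stab[OF this t p] show ?thesis by (simp add: comp_assoc flip: tcomb_comp)
qed

lemma specht_like_tcomb:
  assumes L: "comb_funct n S (mset_set S) L" and t: "t \<in> tabs"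
  shows "specht_like t (\<lambda>g. L (tcomb (g \<circ> t)))"
  unfolding specht_like_def
proof (intro conjI allI impI)
  fix g p assume "g permutes S" "p \<in> col_stab t"
  then show "L (tcomb (g \<circ> p \<circ> t)) = of_int (sign p) * L (tcomb (g \<circ> t))"
    using L t by (intro comp_col_stab) (auto simp: comb_funct_def)
next
  fix g i0 j l assume g: "g permutes S" and jl: "j < l" "(i0, l) \<in> D"
  have "Transposition.transpose ((g \<circ> t) (i, j)) ((g \<circ> t) (i0, l)) \<circ> (g \<circ> t) = g \<circ> Transposition.transpose (t (i, j)) (t (i0, l)) \<circ> t" for i
    using transpose_comp_inj[OF permutes_inj[OF g], of "t (i, j)" "t (i0, l)"] by (simp add: comp_assoc[symmetric])
  then show "L (tcomb (g \<circ> t)) = (\<Sum>i<col_length j. L (tcomb (g \<circ> Transposition.transpose (t (i, j)) (t (i0, l)) \<circ> t)))"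
    using tcomb_garnir[OF L tableau_comp[OF t g] jl] by simp
qed

text \<open>For \<open>A = S\<close> this is \<open>U\<close> on the Young symmetrizer, column
  antisymmetrization times row symmetrization. Restricting the row group to \<open>A\<close> allows
  an induction over the cells.\<close>

definition kappa_sum :: "(nat \<times> nat \<Rightarrow> nat) \<Rightarrow> nat set \<Rightarrow> ((nat \<Rightarrow> nat) \<Rightarrow> complex) \<Rightarrow> complex"
  where "kappa_sum t A U = (\<Sum>p\<in>col_stab t. \<Sum>r\<in>label_perms (rowt t) A. of_int (sign p) * U (p \<circ> r))"

lemma col_stab_permutes: "p \<in> col_stab t \<Longrightarrow> p permutes S"
  by (simp add: col_stab_def label_perms_def)

lemma finite_col_stab: "finite (col_stab t)"
  unfolding col_stab_def by (rule finite_label_perms) simp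

lemma transpose_col_stab:
  "a \<in> S \<Longrightarrow> b \<in> S \<Longrightarrow> colt t a = colt t b \<Longrightarrow> Transposition.transpose a b \<in> col_stab t"
  unfolding col_stab_def by (rule label_perms_transpose)

lemma label_perms_subset:
  assumes "r \<in> label_perms f A" "A \<subseteq> S"
  shows "r permutes S"
  using assms permutes_subset by (auto simp: label_perms_def)

lemma kappa_sum_empty:
  assumes "specht_like t U"
  shows "kappa_sum t {} U = of_nat (card (col_stab t)) * U id"
proof -
  have "of_int (sign p) * U (p \<circ> id) = U id" if p: "p \<in> col_stab t" for p
  proof -
    have "U (id \<circ> p) = of_int (sign p) * U id" using assms p permutes_id unfolding specht_like_def by blast
    moreover have "(of_int (sign p) :: complex) * of_int (sign p) = 1" by (metis of_int_1 of_int_mult sign_idempotent)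
    ultimately show ?thesis by (simp add: mult.assoc[symmetric])
  qed
  then show ?thesis by (simp add: kappa_sum_def label_perms_empty)
qed

text \<open>Letters are added row by row from the top, and from right to left within a row. The sum over
  the transpositions of the new letter with the letters to its right is evaluated by the Garnir
  relation for the two columns, in which the letters above row \<open>m\<close> contribute 0 and the other
  letters contribute equally.\<close>

lemma kappa_sum_insert:
  assumes t: "t \<in> tabs" and U: "specht_like t U"
    and mj: "(m, j) \<in> D"
    and A: "A = {a \<in> S. rowt t a < m \<or> rowt t a = m \<and> j < colt t a}"
  shows "kappa_sum t (insert (t (m, j)) A) U
    = (1 + of_nat (card {l. j < l \<and> (m, l) \<in> D}) / of_nat (col_length j - m)) * kappa_sum t A U"
proof -
  define a where "a = t (m, j)"
  let ?R = "label_perms (rowt t) A" and ?C = "col_stab t"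
  let ?t = "Transposition.transpose"
  have AS: "A \<subseteq> S" using A by auto
  have fA: "finite A" using AS finite_S finite_subset by blast
  have aS: "a \<in> S" and posa: "pos t a = (m, j)" using t mj by (auto simp: a_def tableau_in)
  have aA: "a \<notin> A" using posa A by auto
  have RS: "r permutes S" if "r \<in> ?R" for r by (rule label_perms_subset[OF that AS])
  have U1: "U (g \<circ> p) = of_int (sign p) * U g" if "g permutes S" "p \<in> ?C" for g p
    using U that unfolding specht_like_def by blast
  have U2: "U g = (\<Sum>i<col_length j. U (g \<circ> ?t (t (i, j)) (t (i0, l))))" if "g permutes S" "j < l" "(i0, l) \<in> D" for g i0 j l
    using U that unfolding specht_like_def by blast
  \<comment> \<open>The contribution of exchanging the cells \<open>(i, j)\<close> and
    \<open>(m, l)\<close>. For \<open>i = m\<close> these are the new terms of the larger row group;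
    over all \<open>i\<close> they form a Garnir sum.\<close>
  define Y where "Y i l = (\<Sum>p\<in>?C. \<Sum>r\<in>?R. of_int (sign p) * U (p \<circ> r \<circ> ?t (t (i, j)) (t (m, l))))" for i l
  have total: "kappa_sum t A U = (\<Sum>i<col_length j. Y i l)" if l: "j < l" "(m, l) \<in> D" for l
  proof -
    have "kappa_sum t A U = (\<Sum>p\<in>?C. \<Sum>r\<in>?R. \<Sum>i<col_length j. of_int (sign p) * U (p \<circ> r \<circ> ?t (t (i, j)) (t (m, l))))"
      unfolding kappa_sum_def
    proof (intro sum.cong refl)
      fix p r assume "p \<in> ?C" "r \<in> ?R"
      then have "p \<circ> r permutes S" using col_stab_permutes RS by (intro permutes_compose) auto
      from U2[OF this l] show "of_int (sign p) * U (p \<circ> r) = (\<Sum>i<col_length j. of_int (sign p) * U (p \<circ> r \<circ> ?t (t (i, j)) (t (m, l))))"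
        by (simp add: sum_distrib_left)
    qed
    also have "\<dots> = (\<Sum>i<col_length j. Y i l)"
      unfolding Y_def by (simp add: sum.swap[of _ "{..<col_length j}"])
    finally show ?thesis .
  qed
  \<comment> \<open>\<open>ai\<close> and \<open>a'\<close> lie in a row above \<open>m\<close>, so
    their transposition can be absorbed into \<open>r\<close>. Moved past the transposition of
    \<open>ai\<close> and \<open>b\<close> it becomes that of \<open>b\<close> and
    \<open>a'\<close>, which share a column: the sum equals its negative.\<close>
  have low: "Y i l = 0" if i: "i < m" and l: "j < l" "(m, l) \<in> D" for i l
  proof -
    define ai b a' where "ai = t (i, j)" and "b = t (m, l)" and "a' = t (i, l)"
    have D: "(i, j) \<in> D" "(i, l) \<in> D" using i mj l by (auto simp: diagram_iff)
    have inS: "ai \<in> S" "b \<in> S" "a' \<in> S" using D l t by (auto simp: ai_def b_def a'_def tableau_in)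
    have ps: "pos t ai = (i, j)" "pos t b = (m, l)" "pos t a' = (i, l)"
      using D l t by (auto simp: ai_def b_def a'_def)
    have neq: "ai \<noteq> b" "ai \<noteq> a'" "b \<noteq> a'" using ps i l by auto
    have tr: "?t ai a' \<in> ?R" using inS ps i by (intro label_perms_transpose) (auto simp: A)
    have conj: "?t ai a' \<circ> ?t ai b = ?t ai b \<circ> ?t b a'"
      using neq by (auto simp: fun_eq_iff Transposition.transpose_def)
    have bc: "?t b a' \<in> ?C" using inS ps by (intro transpose_col_stab) auto
    have "(\<Sum>r\<in>?R. of_int (sign p) * U (p \<circ> r \<circ> ?t ai b)) = 0" if p: "p \<in> ?C" for p
    proof -
      have "(\<Sum>r\<in>?R. of_int (sign p) * U (p \<circ> r \<circ> ?t ai b)) = (\<Sum>r\<in>?R. of_int (sign p) * U (p \<circ> (r \<circ> ?t ai a') \<circ> ?t ai b))"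
        by (rule sum_label_perms_right[OF tr, symmetric])
      also have "\<dots> = (\<Sum>r\<in>?R. - (of_int (sign p) * U (p \<circ> r \<circ> ?t ai b)))"
      proof (intro sum.cong refl)
        fix r assume r: "r \<in> ?R"
        have g: "p \<circ> r \<circ> ?t ai b permutes S"
          using col_stab_permutes[OF p] RS[OF r] inS by (intro permutes_compose permutes_swap_id) auto
        have "p \<circ> (r \<circ> ?t ai a') \<circ> ?t ai b = (p \<circ> r \<circ> ?t ai b) \<circ> ?t b a'"
          using conj by (metis comp_assoc)
        then show "of_int (sign p) * U (p \<circ> (r \<circ> ?t ai a') \<circ> ?t ai b) = - (of_int (sign p) * U (p \<circ> r \<circ> ?t ai b))"
          using U1[OF g bc] neq by (simp add: sign_swap_id)
      qed
      finally show ?thesis by (simp add: sum_negf)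
    qed
    then show ?thesis by (simp add: Y_def ai_def b_def)
  qed
  \<comment> \<open>The transposition of \<open>a\<close> and \<open>ai\<close> commutes with
    \<open>r\<close>, since neither letter is in \<open>A\<close>. Conjugating with it replaces
    \<open>ai\<close> by \<open>a\<close>; one copy is absorbed into \<open>p\<close>, the other
    gives the compensating sign.\<close>
  have high: "Y i l = Y m l" if i: "m < i" "i < col_length j" and l: "j < l" "(m, l) \<in> D" for i l
  proof -
    define ai b where "ai = t (i, j)" and "b = t (m, l)"
    have D: "(i, j) \<in> D" using i mj by (auto simp: diagram_iff)
    have inS: "ai \<in> S" "b \<in> S" using D l t by (auto simp: ai_def b_def tableau_in)
    have ps: "pos t ai = (i, j)" "pos t b = (m, l)" using D l t by (auto simp: ai_def b_def)
    have neq: "ai \<noteq> b" "ai \<noteq> a" "b \<noteq> a" using ps posa i l by auto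
    have aiA: "ai \<notin> A" using ps i by (auto simp: A)
    let ?q = "?t a ai"
    have q: "?q \<in> ?C" using inS aS ps posa by (intro transpose_col_stab) auto
    have e: "p \<circ> r \<circ> ?t ai b = ((p \<circ> ?q) \<circ> r \<circ> ?t a b) \<circ> ?q" if r: "r \<in> ?R" for p r
    proof -
      have ra: "r a = a" "r ai = ai" using r aA aiA by (auto simp: label_perms_def dest: permutes_not_in)
      have inj: "inj r" using r permutes_inj by (auto simp: label_perms_def)
      have "?q \<circ> r = r \<circ> ?q" using transpose_comp_inj[OF inj, of a ai] ra by simp
      moreover have "?t ai b = ?q \<circ> ?t a b \<circ> ?q" using neq by (auto simp: fun_eq_iff Transposition.transpose_def)
      ultimately show ?thesis by (metis comp_assoc)
    qed
    have "Y i l = (\<Sum>p\<in>?C. \<Sum>r\<in>?R. of_int (sign (p \<circ> ?q)) * U ((p \<circ> ?q) \<circ> r \<circ> ?t a b))"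
      unfolding Y_def ai_def[symmetric] b_def[symmetric]
    proof (intro sum.cong refl)
      fix p r assume p: "p \<in> ?C" and r: "r \<in> ?R"
      have g: "(p \<circ> ?q) \<circ> r \<circ> ?t a b permutes S"
        using col_stab_permutes[OF p] RS[OF r] inS aS by (intro permutes_compose permutes_swap_id) auto
      have "permutation p" using col_stab_permutes[OF p] finite_S permutation_permutes by blast
      then have sg: "sign (p \<circ> ?q) = sign p * sign ?q" by (simp add: sign_compose permutation_swap_id)
      show "of_int (sign p) * U (p \<circ> r \<circ> ?t ai b) = of_int (sign (p \<circ> ?q)) * U ((p \<circ> ?q) \<circ> r \<circ> ?t a b)"
        unfolding e[OF r] U1[OF g q] sg by simp
    qed
    also have "\<dots> = (\<Sum>p\<in>?C. \<Sum>r\<in>?R. of_int (sign p) * U (p \<circ> r \<circ> ?t a b))"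
      using sum_label_perms_right[OF q[unfolded col_stab_def], of "\<lambda>p. \<Sum>r\<in>?R. of_int (sign p) * U (p \<circ> r \<circ> ?t a b)"]
      by (simp add: col_stab_def)
    finally show ?thesis by (simp add: Y_def a_def b_def)
  qed
  \<comment> \<open>\<open>col_length j - m\<close> is one plus the leg of the cell, and the set
    counted in the statement is its arm, so the factor is hook length over one plus leg.\<close>
  have hook: "col_length j - m > 0" using mj by (simp add: diagram_iff)
  have X: "Y m l = kappa_sum t A U / of_nat (col_length j - m)" if l: "j < l" "(m, l) \<in> D" for l
  proof -
    have mc: "m < col_length j" using hook by simp
    have "kappa_sum t A U = (\<Sum>i<col_length j. if m \<le> i then Y m l else 0)"
      unfolding total[OF l]
    proof (intro sum.cong refl)
      fix i assume "i \<in> {..<col_length j}"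
      then show "Y i l = (if m \<le> i then Y m l else 0)" using low[OF _ l, of i] high[OF _ _ l, of i] by (cases "i = m") auto
    qed
    also have "\<dots> = (\<Sum>i\<in>{m..<col_length j}. Y m l)"
    proof -
      have "{i \<in> {..<col_length j}. m \<le> i} = {m..<col_length j}" by auto
      then show ?thesis using sum.inter_filter[of "{..<col_length j}" "\<lambda>_. Y m l" "\<lambda>i. m \<le> i"] by (simp only: finite_lessThan)
    qed
    also have "\<dots> = of_nat (col_length j - m) * Y m l" by simp
    finally show ?thesis using hook by simp
  qed
  let ?B = "{b \<in> insert a A. rowt t b = rowt t a}"
  let ?Ls = "{l. j < l \<and> (m, l) \<in> D}"
  have fLs: "finite ?Ls" by (rule finite_subset[of _ "{..<k}"]) (auto simp: diagram_iff)
  have B: "?B = insert a ((\<lambda>l. t (m, l)) ` ?Ls)"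
  proof (intro equalityI subsetI)
    fix b assume b: "b \<in> ?B"
    show "b \<in> insert a ((\<lambda>l. t (m, l)) ` ?Ls)"
    proof (cases "b = a")
      case False
      then have bA: "b \<in> A" "rowt t b = m" using b posa by auto
      then have "pos t b \<in> D" "t (pos t b) = b" using AS tableau_pos[OF t] by auto
      moreover have "pos t b = (m, colt t b)" using bA by (metis prod.collapse)
      moreover have "j < colt t b" using bA by (auto simp: A)
      ultimately show ?thesis by (intro insertI2 image_eqI[of _ _ "colt t b"]) auto
    qed simp
  next
    fix b assume "b \<in> insert a ((\<lambda>l. t (m, l)) ` ?Ls)"
    then show "b \<in> ?B" using posa t tableau_in[OF t] by (auto simp: A)
  qed
  have "a \<notin> (\<lambda>l. t (m, l)) ` ?Ls" using posa t by force
  moreover have "inj_on (\<lambda>l. t (m, l)) ?Ls" using tableau_inj[OF t] by (auto simp: inj_on_def)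
  ultimately have sB: "(\<Sum>b\<in>?B. F b) = F a + (\<Sum>l\<in>?Ls. F (t (m, l)))" for F :: "nat \<Rightarrow> complex"
    unfolding B using fLs by (simp add: sum.reindex)
  have "kappa_sum t (insert a A) U = (\<Sum>p\<in>?C. \<Sum>b\<in>?B. \<Sum>r\<in>?R. of_int (sign p) * U (p \<circ> (r \<circ> ?t a b)))"
    unfolding kappa_sum_def by (intro sum.cong refl sum_label_perms_insert[OF aA])
  also have "\<dots> = (\<Sum>b\<in>?B. \<Sum>p\<in>?C. \<Sum>r\<in>?R. of_int (sign p) * U (p \<circ> (r \<circ> ?t a b)))"
    by (rule sum.swap)
  also have "\<dots> = kappa_sum t A U + (\<Sum>l\<in>?Ls. Y m l)"
    unfolding sB by (simp add: kappa_sum_def Y_def a_def comp_assoc)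
  also have "\<dots> = kappa_sum t A U + of_nat (card ?Ls) * (kappa_sum t A U / of_nat (col_length j - m))"
    using X by simp
  finally show ?thesis using hook by (simp add: a_def field_simps)
qed

text \<open>The value starts as the order of the column stabilizer times \<open>U id\<close>, and
  every cell contributes a positive factor independent of \<open>U\<close>. The result is the
  product of the hook lengths; the real constant in \<open>good\<close> keeps track of
  positivity.\<close>

lemma kappa_sum_full:
  assumes t: "t \<in> tabs"
  shows "\<exists>K. K \<noteq> 0 \<and> (\<forall>U. specht_like t U \<longrightarrow> kappa_sum t S U = K * U id)"
proof -
  define good where "good A \<longleftrightarrow> (\<exists>K :: real. K > 0 \<and> (\<forall>U. specht_like t U \<longrightarrow> kappa_sum t A U = of_real K * U id))" for A
  \<comment> \<open>The letters present once the rows above \<open>m\<close> and the cells of row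
    \<open>m\<close> from column \<open>j\<close> on have been added.\<close>
  define act where "act m j = {a \<in> S. rowt t a < m \<or> rowt t a = m \<and> j \<le> colt t a}" for m j
  have colk: "colt t a < k" if "a \<in> S" for a
    using tableau_pos[OF t that] by (metis diagram_iff prod.collapse)
  have step: "good (act m j)" if g: "good (act m (Suc j))" for m j
  proof (cases "(m, j) \<in> D")
    case True
    let ?A = "{a \<in> S. rowt t a < m \<or> rowt t a = m \<and> j < colt t a}"
    have A: "act m (Suc j) = ?A" by (auto simp: act_def Suc_le_eq)
    have ins: "act m j = insert (t (m, j)) ?A"
    proof (intro equalityI subsetI)
      fix a assume a: "a \<in> act m j"
      show "a \<in> insert (t (m, j)) ?A"
      proof (cases "pos t a = (m, j)")
        case True
        then show ?thesis using a tableau_pos[OF t, of a] by (auto simp: act_def)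
      next
        case False
        then show ?thesis using a by (cases "pos t a") (auto simp: act_def)
      qed
    next
      fix a assume "a \<in> insert (t (m, j)) ?A"
      then show "a \<in> act m j" using True t tableau_in[OF t True] by (auto simp: act_def)
    qed
    obtain K where K: "K > 0" "\<forall>U. specht_like t U \<longrightarrow> kappa_sum t ?A U = of_real K * U id"
      using g unfolding good_def A by blast
    define c :: real where "c = 1 + of_nat (card {l. j < l \<and> (m, l) \<in> D}) / of_nat (col_length j - m)"
    have "c > 0" unfolding c_def by (rule add_pos_nonneg) auto
    moreover have "kappa_sum t (act m j) U = of_real (c * K) * U id" if U: "specht_like t U" for U
      using kappa_sum_insert[OF t U True refl] K(2) U unfolding ins by (simp add: c_def)
    ultimately show ?thesis unfolding good_def using K(1) by (intro exI[of _ "c * K"]) auto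
  next
    case False
    have "pos t a \<noteq> (m, j)" if "a \<in> S" for a using tableau_pos[OF t that] False by auto
    then have "\<not> (rowt t a = m \<and> colt t a = j)" if "a \<in> S" for a
      using that by (metis prod.collapse)
    then have "act m j = act m (Suc j)" by (auto simp: act_def Suc_le_eq le_less)
    then show ?thesis using g by simp
  qed
  have row: "good (act m 0)" if "good (act m k)" for m
  proof -
    have "good (act m (k - i))" if "i \<le> k" for i
      using that
    proof (induction i)
      case 0
      then show ?case using \<open>good (act m k)\<close> by simp
    next
      case (Suc i)
      then have "Suc (k - Suc i) = k - i" by simp
      then show ?case using step[of m "k - Suc i"] Suc by simp
    qed
    from this[of k] show ?thesis by simp
  qed
  have next_row: "act (Suc m) k = act m 0" for m
    by (auto simp: act_def less_Suc_eq dest: colk)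
  have "good {}"
  proof -
    have "id \<in> col_stab t" by (simp add: col_stab_def label_perms_def permutes_id)
    then have "card (col_stab t) > 0" using finite_col_stab by (auto simp: card_gt_0_iff)
    then show ?thesis unfolding good_def
      using kappa_sum_empty by (intro exI[of _ "real (card (col_stab t))"]) auto
  qed
  moreover have "act 0 k = {}" by (auto simp: act_def dest: colk)
  ultimately have "good (act m k)" for m
    using row next_row by (induction m) auto
  moreover have "act n k = S" using rowt_less[OF t] by (auto simp: act_def)
  ultimately have "good S" by metis
  then show ?thesis unfolding good_def by (metis less_irrefl of_real_eq_0_iff)
qed

end

section \<open>Free spaces, quotients and spans as modules\<close>

lemma cring_complex: "cring (class_ring :: complex ring)"
  by (rule class_cring.is_cring)

lemma free_space_simps [simp]:
  "carrier (free_space B) = {f. keys f \<subseteq> B}" "zero (free_space B) = 0"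
  "add (free_space B) = (+)" "module.smult (free_space B) = scl"
  by (simp_all add: free_space_def)

lemma pm_subspace_keys: "pm_subspace {f. keys f \<subseteq> B}"
  unfolding pm_subspace_def
  by (auto dest!: keys_scl_subset[THEN subsetD] Poly_Mapping.keys_add[THEN subsetD])

lemma scl_distribs:
  "scl c (x + y) = scl c x + scl c y" "scl (a + b) x = scl a x + scl b x"
  "scl (a * b) x = scl a (scl b x)" "scl 1 x = x" "scl c (x - y) = scl c x - scl c y" "scl 0 x = 0" "scl c 0 = 0"
  by (auto intro!: poly_mapping_eqI simp: lookup_add lookup_minus algebra_simps)

lemma module_free_space: "Module.module class_ring (free_space B)"
proof (rule module_criteria[OF cring_complex], goal_cases)
  case 1
  show ?case using pm_subspaceD(1)[OF pm_subspace_keys[of B]] by simp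
next
  case 2
  show ?case using pm_subspaceD(2)[OF pm_subspace_keys[of B]] by simp
next
  case 3
  show ?case
  proof
    fix v assume "v \<in> carrier (free_space B)"
    then show "\<exists>w\<in>carrier (free_space B). v \<oplus>\<^bsub>free_space B\<^esub> w = \<zero>\<^bsub>free_space B\<^esub>"
      by (intro bexI[of _ "- v"]) simp_all
  qed
next
  case 4
  show ?case using pm_subspaceD(3)[OF pm_subspace_keys[of B]] by simp
next
  case 5
  show ?case by (simp add: add.commute)
next
  case 6
  show ?case by (simp add: add.assoc)
next
  case 7
  show ?case by simp
next
  case 8
  show ?case by (auto intro: scl_distribs(3))
next
  case 9
  show ?case by (auto intro: scl_distribs(4))
next
  case 10
  show ?case by (auto intro: scl_distribs(2))
next
  case 11
  show ?case by (auto intro: scl_distribs(1))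
qed

lemma pm_subspace_iff_submodule:
  assumes "W \<subseteq> {f. keys f \<subseteq> B}"
  shows "submodule class_ring W (free_space B) \<longleftrightarrow> pm_subspace W"
  using assms module_free_space by (auto simp: submodule_def pm_subspace_def)

lemma pm_subspace_span: "pm_subspace (pm.span T)"
  by (simp add: pm_subspace_def pm.span_zero pm.span_add pm.span_scale)

lemma pm_span_minimal: "T \<subseteq> W \<Longrightarrow> pm_subspace W \<Longrightarrow> pm.span T \<subseteq> W"
  by (rule pm.span_minimal) (auto simp: pm.subspace_def pm_subspace_def)

text \<open>The bridge from the span of the record-based modules to the span on the type.\<close>

lemma vspan_free_space:
  assumes T: "T \<subseteq> {f. keys f \<subseteq> B}"
  shows "vspan (free_space B) T = pm.span T"
proof
  interpret M: Module.module class_ring "free_space B" by (rule module_free_space)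
  have sub: "pm.span T \<subseteq> {f. keys f \<subseteq> B}"
    using pm_span_minimal[OF T pm_subspace_keys] .
  show "vspan (free_space B) T \<subseteq> pm.span T"
    using pm_subspace_iff_submodule[OF sub] pm_subspace_span
    by (intro M.span_is_subset) (auto intro: pm.span_base)
  have "vspan (free_space B) T \<subseteq> carrier (free_space B)" using T by (intro M.span_is_subset2) simp
  moreover have "submodule class_ring (vspan (free_space B) T) (free_space B)"
    using T by (intro M.span_is_submodule) simp
  ultimately have "pm_subspace (vspan (free_space B) T)"
    using pm_subspace_iff_submodule[of "vspan (free_space B) T" B] by simp
  then show "pm.span T \<subseteq> vspan (free_space B) T"
    using M.in_own_span[of T] T by (intro pm_span_minimal) auto
qed

lemma span_basis_vec: "pm.span (basis_vec ` T) = {f. keys f \<subseteq> T}"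
proof
  show "pm.span (basis_vec ` T) \<subseteq> {f. keys f \<subseteq> T}"
    by (rule pm_span_minimal[OF _ pm_subspace_keys]) auto
  show "{f. keys f \<subseteq> T} \<subseteq> pm.span (basis_vec ` T)"
  proof
    fix f assume "f \<in> {f. keys f \<subseteq> T}"
    then have "pext basis_vec f \<in> pm.span (basis_vec ` T)"
      by (intro pm_subspace_pext[OF pm_subspace_span]) (auto intro: pm.span_base)
    then show "f \<in> pm.span (basis_vec ` T)" by (simp add: pext_basis_vec)
  qed
qed

section \<open>Quotients by subspaces\<close>

definition pm_coset :: "('b \<Rightarrow>\<^sub>0 complex) set \<Rightarrow> ('b \<Rightarrow>\<^sub>0 complex) \<Rightarrow> ('b \<Rightarrow>\<^sub>0 complex) set"
  where "pm_coset W x = (\<lambda>w. w + x) ` W"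

lemma a_r_coset_free: "W +>\<^bsub>free_space B\<^esub> x = pm_coset W x"
  by (auto simp: a_r_coset_def' pm_coset_def)

lemma mem_pm_coset: "y \<in> pm_coset W x \<longleftrightarrow> y - x \<in> W"
proof
  assume "y - x \<in> W"
  then have "y - x + x \<in> pm_coset W x" unfolding pm_coset_def by (rule imageI)
  then show "y \<in> pm_coset W x" by simp
qed (auto simp: pm_coset_def)

lemma pm_coset_eq_iff:
  assumes W: "pm_subspace W"
  shows "pm_coset W x = pm_coset W y \<longleftrightarrow> x - y \<in> W"
proof
  assume "pm_coset W x = pm_coset W y"
  moreover have "x \<in> pm_coset W x" using pm_subspaceD(1)[OF W] by (simp add: mem_pm_coset)
  ultimately show "x - y \<in> W" by (simp add: mem_pm_coset)
next
  assume d: "x - y \<in> W"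
  show "pm_coset W x = pm_coset W y"
  proof (intro Set.set_eqI)
    fix z
    have "z - y = (z - x) + (x - y)" "z - x = (z - y) - (x - y)" by simp_all
    then show "z \<in> pm_coset W x \<longleftrightarrow> z \<in> pm_coset W y"
      unfolding mem_pm_coset using d pm_subspaceD[OF W] by metis
  qed
qed

lemma set_add_pm_coset:
  assumes W: "pm_subspace W"
  shows "set_add (free_space B) (pm_coset W x) (pm_coset W y) = pm_coset W (x + y)"
proof (intro Set.set_eqI iffI)
  fix z assume "z \<in> set_add (free_space B) (pm_coset W x) (pm_coset W y)"
  then obtain u v where uv: "u - x \<in> W" "v - y \<in> W" "z = u + v"
    by (auto simp: set_add_def' mem_pm_coset)
  have "z - (x + y) = (u - x) + (v - y)" using uv by simp
  then show "z \<in> pm_coset W (x + y)"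
    using pm_subspaceD(2)[OF W uv(1,2)] by (simp only: mem_pm_coset)
next
  fix z assume "z \<in> pm_coset W (x + y)"
  moreover have "z - y - x = z - (x + y)" by (simp add: diff_diff_eq add.commute)
  ultimately have "z - y \<in> pm_coset W x" by (simp only: mem_pm_coset)
  moreover have "y \<in> pm_coset W y" using pm_subspaceD(1)[OF W] by (simp add: mem_pm_coset)
  ultimately show "z \<in> set_add (free_space B) (pm_coset W x) (pm_coset W y)"
    unfolding set_add_def' by (intro UN_I[of "z - y"] UN_I[of y]) auto
qed

lemma scale_pm_coset:
  assumes W: "pm_subspace W"
  shows "(\<Union>a\<in>pm_coset W x. pm_coset W (scl c a)) = pm_coset W (scl c x)"
proof -
  have "pm_coset W (scl c a) = pm_coset W (scl c x)" if "a \<in> pm_coset W x" for a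
    using that pm_subspaceD(3)[OF W, of "a - x" c] by (simp add: pm_coset_eq_iff[OF W] mem_pm_coset scl_distribs(5))
  moreover have "x \<in> pm_coset W x" using pm_subspaceD(1)[OF W] by (simp add: mem_pm_coset)
  ultimately show ?thesis by blast
qed

lemma quotient_space_simps:
  assumes W: "pm_subspace W"
  shows "carrier (quotient_space (free_space B) W) = pm_coset W ` {f. keys f \<subseteq> B}"
    "zero (quotient_space (free_space B) W) = pm_coset W 0"
    "add (quotient_space (free_space B) W) (pm_coset W x) (pm_coset W y) = pm_coset W (x + y)"
    "module.smult (quotient_space (free_space B) W) c (pm_coset W x) = pm_coset W (scl c x)"
  using set_add_pm_coset[OF W] scale_pm_coset[OF W]
  by (auto simp: quotient_space_def A_RCOSETS_def' a_r_coset_free) (auto simp: pm_coset_def)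

lemma module_quotient_space:
  assumes W: "pm_subspace W"
  shows "Module.module class_ring (quotient_space (free_space B) W)"
proof (rule module_criteria[OF cring_complex])
  let ?Q = "quotient_space (free_space B) W"
  note Q = quotient_space_simps[OF W, of B]
  note K = pm_subspaceD[OF pm_subspace_keys[of B]]
  show "\<forall>v\<in>carrier ?Q. \<exists>w\<in>carrier ?Q. v \<oplus>\<^bsub>?Q\<^esub> w = \<zero>\<^bsub>?Q\<^esub>"
  proof
    fix v assume "v \<in> carrier ?Q"
    then obtain x where x: "keys x \<subseteq> B" "v = pm_coset W x" by (auto simp: Q)
    then show "\<exists>w\<in>carrier ?Q. v \<oplus>\<^bsub>?Q\<^esub> w = \<zero>\<^bsub>?Q\<^esub>"
      by (intro bexI[of _ "pm_coset W (- x)"]) (auto simp: Q)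
  qed
  show "\<forall>v w. v \<in> carrier ?Q \<and> w \<in> carrier ?Q \<longrightarrow> v \<oplus>\<^bsub>?Q\<^esub> w \<in> carrier ?Q"
    unfolding Q(1)
  proof (intro allI impI)
    fix v w assume "v \<in> pm_coset W ` {f. keys f \<subseteq> B} \<and> w \<in> pm_coset W ` {f. keys f \<subseteq> B}"
    then obtain x y where "keys x \<subseteq> B" "keys y \<subseteq> B" "v = pm_coset W x" "w = pm_coset W y" by auto
    then show "v \<oplus>\<^bsub>?Q\<^esub> w \<in> pm_coset W ` {f. keys f \<subseteq> B}" using K(2)[of x y] by (simp add: Q)
  qed
  show "\<forall>c v. c \<in> carrier class_ring \<and> v \<in> carrier ?Q \<longrightarrow> c \<odot>\<^bsub>?Q\<^esub> v \<in> carrier ?Q"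
    unfolding Q(1)
  proof (intro allI impI)
    fix c v assume "c \<in> carrier (class_ring :: complex ring) \<and> v \<in> pm_coset W ` {f. keys f \<subseteq> B}"
    then obtain x where "keys x \<subseteq> B" "v = pm_coset W x" by auto
    then show "c \<odot>\<^bsub>?Q\<^esub> v \<in> pm_coset W ` {f. keys f \<subseteq> B}" using K(3)[of x c] by (simp add: Q)
  qed
qed (auto simp: quotient_space_simps[OF W] scl_distribs(1,2,4) add_ac intro: arg_cong[OF scl_distribs(3), of "pm_coset W"])

lemma vspan_quotient_space:
  assumes W: "pm_subspace W" and T: "T \<subseteq> B"
  shows "vspan (quotient_space (free_space B) W) (pm_coset W ` basis_vec ` T) = pm_coset W ` {f. keys f \<subseteq> T}"
proof
  let ?Q = "quotient_space (free_space B) W"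
  note Q = quotient_space_simps[OF W, of B]
  interpret M: Module.module class_ring ?Q by (rule module_quotient_space[OF W])
  have TB: "{f :: 'a \<Rightarrow>\<^sub>0 complex. keys f \<subseteq> T} \<subseteq> {f. keys f \<subseteq> B}" using T by auto
  note K = pm_subspaceD[OF pm_subspace_keys[of T]]
  have "submodule class_ring (pm_coset W ` {f. keys f \<subseteq> T}) ?Q"
    unfolding submodule_def
  proof (intro conjI allI impI)
    show "pm_coset W ` {f. keys f \<subseteq> T} \<subseteq> carrier ?Q" using TB by (auto simp: Q)
    show "Module.module class_ring ?Q" by (rule M.module_axioms)
    show "\<zero>\<^bsub>?Q\<^esub> \<in> pm_coset W ` {f. keys f \<subseteq> T}" using K(1) by (simp add: Q)
  next
    fix v w assume "v \<in> pm_coset W ` {f. keys f \<subseteq> T}" "w \<in> pm_coset W ` {f. keys f \<subseteq> T}"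
    then obtain x y where "keys x \<subseteq> T" "keys y \<subseteq> T" "v = pm_coset W x" "w = pm_coset W y" by auto
    then show "v \<oplus>\<^bsub>?Q\<^esub> w \<in> pm_coset W ` {f. keys f \<subseteq> T}" using K(2)[of x y] by (simp add: Q)
  next
    fix c v assume "v \<in> pm_coset W ` {f. keys f \<subseteq> T}"
    then obtain x where "keys x \<subseteq> T" "v = pm_coset W x" by auto
    then show "c \<odot>\<^bsub>?Q\<^esub> v \<in> pm_coset W ` {f. keys f \<subseteq> T}" using K(3)[of x c] by (simp add: Q)
  qed
  then show "vspan ?Q (pm_coset W ` basis_vec ` T) \<subseteq> pm_coset W ` {f. keys f \<subseteq> T}"
    by (intro M.span_is_subset) auto
  have car: "pm_coset W ` basis_vec ` T \<subseteq> carrier ?Q" using T by (auto simp: Q)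
  have sub: "submodule class_ring (vspan ?Q (pm_coset W ` basis_vec ` T)) ?Q"
    by (rule M.span_is_submodule[OF car])
  \<comment> \<open>The preimage of the span is a subspace containing the basis vectors of
    \<open>T\<close>, hence all combinations of them.\<close>
  have "pm_subspace {x. keys x \<subseteq> B \<and> pm_coset W x \<in> vspan ?Q (pm_coset W ` basis_vec ` T)}"
    unfolding pm_subspace_def
  proof (intro conjI ballI allI CollectI)
    show "pm_coset W 0 \<in> vspan ?Q (pm_coset W ` basis_vec ` T)"
      using submodule.zero_closed[OF sub] by (simp add: Q)
  next
    fix x y assume *: "x \<in> {x. keys x \<subseteq> B \<and> pm_coset W x \<in> vspan ?Q (pm_coset W ` basis_vec ` T)}"
      "y \<in> {x. keys x \<subseteq> B \<and> pm_coset W x \<in> vspan ?Q (pm_coset W ` basis_vec ` T)}"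
    then show "keys (x + y) \<subseteq> B" using pm_subspaceD(2)[OF pm_subspace_keys[of B], of x y] by simp
    show "pm_coset W (x + y) \<in> vspan ?Q (pm_coset W ` basis_vec ` T)"
      using submodule.m_closed[OF sub, of "pm_coset W x" "pm_coset W y"] * by (simp add: Q)
  next
    fix c x assume *: "x \<in> {x. keys x \<subseteq> B \<and> pm_coset W x \<in> vspan ?Q (pm_coset W ` basis_vec ` T)}"
    then show "keys (scl c x) \<subseteq> B" using pm_subspaceD(3)[OF pm_subspace_keys[of B], of x c] by simp
    show "pm_coset W (scl c x) \<in> vspan ?Q (pm_coset W ` basis_vec ` T)"
      using submodule.smult_closed[OF sub, of c "pm_coset W x"] * by (simp add: Q)
  qed simp
  moreover have "basis_vec ` T \<subseteq> {x. keys x \<subseteq> B \<and> pm_coset W x \<in> vspan ?Q (pm_coset W ` basis_vec ` T)}"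
    using M.in_own_span[OF car] T by auto
  ultimately have "pm.span (basis_vec ` T) \<subseteq> {x. keys x \<subseteq> B \<and> pm_coset W x \<in> vspan ?Q (pm_coset W ` basis_vec ` T)}"
    by (intro pm_span_minimal)
  then show "pm_coset W ` {f. keys f \<subseteq> T} \<subseteq> vspan ?Q (pm_coset W ` basis_vec ` T)"
    unfolding span_basis_vec by auto
qed

lemma push_linear:
  "push h (x + y) = push h x + push h y" "push h (x - y) = push h x - push h y"
  "push h (scl c x) = scl c (push h x)" "push h 0 = 0"
  by (rule plin_eqI; simp add: plin_push plin_add plin_diff)+

lemma push_single [simp]: "push h (Poly_Mapping.single b c) = Poly_Mapping.single (h b) c"
  by (rule plin_eqI) (simp add: plin_push)

lemma push_push: "push g (push h x) = push (g \<circ> h) x"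
  by (rule plin_eqI) (simp add: plin_push comp_def)

lemma push_id [simp]: "push (\<lambda>a. a) x = x"
  by (rule plin_eqI) (simp add: plin_push)

lemma push_sum: "push h (sum f A) = (\<Sum>a\<in>A. push h (f a))"
  by (rule plin_eqI) (simp add: plin_push plin_sum)

lemma pext_push: "pext F (push h x) = pext (\<lambda>b. F (h b)) x"
  by (rule plin_eqI) (simp add: plin_pext plin_push)

lemma push_pext: "push h (pext F x) = pext (\<lambda>b. push h (F b)) x"
  by (rule plin_eqI) (simp add: plin_pext plin_push)

lemma pext_cong: "(\<And>b. b \<in> keys x \<Longrightarrow> F b = G b) \<Longrightarrow> pext F x = pext G x"
  unfolding pext_def by (intro sum.cong refl) auto

section \<open>The maps between the multilinear component and the Specht module\<close>

lemma lookup_sum_single: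
  assumes "finite A"
  shows "lookup (\<Sum>b\<in>A. Poly_Mapping.single b (c b)) a = (if a \<in> A then c a else 0)"
  using assms by (simp add: lookup_sum lookup_single when_def)

lemma map_image_inv:
  assumes "p permutes A"
  shows "map (image (inv' p)) (map (image p) T) = T" "map (image p) (map (image (inv' p)) T) = T"
  using permutes_inverses[OF assms] by (simp_all add: map_idI image_image)

context hook_shape
begin

lemma tabs_nonempty: "\<exists>t. t \<in> tabs"
proof -
  have "sum_list (map col_length [0..<m]) = (if m = 0 then 0 else m * (n - 1) + 1)" for m
    by (induction m) (use n in \<open>auto simp: col_length_def\<close>)
  then have "length positions = k * (n - 1) + 1"
    using k by (simp add: positions_def length_concat comp_def)
  then have "card D = card S"
    using distinct_card[OF distinct_positions] by (simp add: set_positions letters_set_def nletters_def)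
  then obtain t where "bij_betw t D S" using finite_same_card_bij[OF finite_D finite_S] by blast
  then have "t \<in> tabs" by (simp add: tableaux_def sum_list_lam letters_set_def)
  then show ?thesis by blast
qed

definition t0 :: "nat \<times> nat \<Rightarrow> nat" where "t0 = (SOME t. t \<in> tabs)"

lemma t0: "t0 \<in> tabs"
  unfolding t0_def using tabs_nonempty by (rule someI_ex)

abbreviation "BP \<equiv> bracketed_permutations n k"
abbreviation "NC \<equiv> {x \<in> BP. noncomb x}"
abbreviation "Tabl \<equiv> tabloid lam ` tabs"
abbreviation "I \<equiv> filippov_ideal n S"

lemma tabloid_comp_cong: "(\<And>x. x \<in> D \<Longrightarrow> t x = t' x) \<Longrightarrow> tabloid lam t = tabloid lam t'"
  by (auto simp: tabloid_def intro!: image_cong)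

lemma Tabl_orbit: "Tabl = (\<lambda>p. tabloid lam (p \<circ> t0)) ` {p. p permutes S}"
proof (intro equalityI subsetI)
  fix T assume "T \<in> Tabl"
  then obtain t where t: "t \<in> tabs" "T = tabloid lam t" by auto
  obtain r where r: "r permutes S" "\<forall>x\<in>D. r (t0 x) = t x" using tableaux_transitive[OF t0 t(1)] by blast
  then have "T = tabloid lam (r \<circ> t0)" unfolding t(2) by (intro tabloid_comp_cong) simp
  then show "T \<in> (\<lambda>p. tabloid lam (p \<circ> t0)) ` {p. p permutes S}" using r by blast
next
  fix T assume "T \<in> (\<lambda>p. tabloid lam (p \<circ> t0)) ` {p. p permutes S}"
  then show "T \<in> Tabl" using tableau_comp[OF t0] by blast
qed

lemma finite_Tabl: "finite Tabl"
  unfolding Tabl_orbit using finite_permutations[OF finite_S] by simp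

text \<open>The evaluation along the rows of an arbitrary tableau with tabloid \<open>T\<close>; by
  \<open>chi_tabloid\<close> its values on words in \<open>S\<close> do not depend on the
  choice.\<close>

definition chi :: "nat set list \<Rightarrow> nat btree \<Rightarrow> complex"
  where "chi T = eval_last n (rowt (SOME u. u \<in> tabs \<and> tabloid lam u = T))"

lemma chi_tabloid:
  assumes u: "u \<in> tabs" and x: "set (letters x) \<subseteq> S"
  shows "chi (tabloid lam u) x = eval_last n (rowt u) x"
proof -
  define v where "v = (SOME v. v \<in> tabs \<and> tabloid lam v = tabloid lam u)"
  have v: "v \<in> tabs \<and> tabloid lam v = tabloid lam u"
    unfolding v_def by (rule someI[of _ u]) (simp add: u)
  then have "\<forall>a\<in>S. rowt v a = rowt u a" using tabloid_eq_iff[OF u] by blast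
  then have "ev (rowt v) x = ev (rowt u) x" using x by (intro ev_cong) auto
  then show ?thesis by (simp add: chi_def v_def[symmetric] eval_last_def)
qed

lemma fil_funct_chi: "fil_funct n S (chi T)"
  unfolding chi_def using n by (intro fil_funct_eval_last) simp

lemma chi_relabel:
  assumes T: "T \<in> Tabl" and p: "p permutes S" and x: "set (letters x) \<subseteq> S"
  shows "chi (map (image p) T) (map_btree p x) = chi T x"
proof -
  obtain u where u: "u \<in> tabs" "T = tabloid lam u" using T by auto
  have pu: "p \<circ> u \<in> tabs" by (rule tableau_comp[OF u(1) p])
  have px: "set (letters (map_btree p x)) \<subseteq> S" using x permutes_image[OF p] by (auto simp: letters_map_btree)
  have "ev (rowt (p \<circ> u) \<circ> p) x = ev (rowt u) x"
  proof (rule ev_cong)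
    fix a assume "a \<in> set (letters x)"
    then have a: "a \<in> S" "p a \<in> S" using x permutes_in_image[OF p] by auto
    then show "(rowt (p \<circ> u) \<circ> p) a = rowt u a"
      using pos_comp[OF u(1) p a(2)] permutes_inverses(2)[OF p] by simp
  qed
  then show ?thesis unfolding u(2) map_image_tabloid chi_tabloid[OF pu px] chi_tabloid[OF u(1) x]
    by (simp add: eval_last_map_btree) (simp add: eval_last_def)
qed

lemma BP_letters: "x \<in> BP \<Longrightarrow> set (letters x) \<subseteq> S"
  using bracketed_permutationsD by simp

lemma chi_row_stab:
  assumes u: "u \<in> tabs" and r: "r \<in> row_stab u" and x: "x \<in> BP"
  shows "chi (tabloid lam u) (map_btree r x) = chi (tabloid lam u) x"
proof -
  have rp: "r permutes S" using r by (simp add: row_stab_def label_perms_def)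
  have "map (image r) (tabloid lam u) = tabloid lam u"
    using tabloid_row_stab[OF u rp] r by (simp add: map_image_tabloid)
  then show ?thesis using chi_relabel[of "tabloid lam u" r x] u rp BP_letters[OF x] by simp
qed

lemma chi_noncomb: "T \<in> Tabl \<Longrightarrow> x \<in> NC \<Longrightarrow> chi T x = 0"
  using row_invariant_functional(2)[OF _ fil_funct_chi chi_row_stab] by blast

text \<open>Division by \<open>comb_value\<close> makes the comb of a tableau go to its polytabloid
  exactly.\<close>

definition phi_basis :: "nat btree \<Rightarrow> nat set list \<Rightarrow>\<^sub>0 complex"
  where "phi_basis x = (\<Sum>T\<in>Tabl. Poly_Mapping.single T (chi T x / comb_value))"

definition phi :: "(nat btree \<Rightarrow>\<^sub>0 complex) \<Rightarrow> nat set list \<Rightarrow>\<^sub>0 complex"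
  where "phi = pext phi_basis"

lemma plin_phi_basis: "plin l (phi_basis x) = (\<Sum>T\<in>Tabl. chi T x / comb_value * l T)"
  by (simp add: phi_basis_def plin_sum)

lemma lookup_phi_basis: "lookup (phi_basis x) T = (if T \<in> Tabl then chi T x / comb_value else 0)"
  unfolding phi_basis_def by (rule lookup_sum_single[OF finite_Tabl])

lemma lookup_phi: "lookup (phi x) T = (if T \<in> Tabl then plin (chi T) x / comb_value else 0)"
proof -
  have "lookup (phi x) T = plin (\<lambda>y. lookup (phi_basis y) T) x"
    unfolding phi_def plin_delta[symmetric] plin_pext ..
  also have "\<dots> = plin (\<lambda>y. (if T \<in> Tabl then 1 / comb_value else 0) * chi T y) x"
    by (intro plin_cong) (simp add: lookup_phi_basis)
  finally show ?thesis by (simp add: plin_fun_mult)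
qed

lemma phi_ideal: "w \<in> I \<Longrightarrow> phi w = 0"
  by (rule poly_mapping_eqI) (simp add: lookup_phi killsD[OF fil_funct_chi])

lemma phi_noncomb: "x \<in> NC \<Longrightarrow> phi_basis x = 0"
  by (rule poly_mapping_eqI) (simp add: lookup_phi_basis chi_noncomb)

lemma phi_noncombs: "keys x \<subseteq> NC \<Longrightarrow> phi x = 0"
  unfolding phi_def pext_def using phi_noncomb
  by (intro sum.neutral) (auto intro!: poly_mapping_eqI)

lemma image_inj_Tabl:
  assumes p: "p permutes S"
  shows "bij_betw (map (image p)) Tabl Tabl"
proof (rule bij_betwI[where g = "map (image (inv' p))"])
  show "map (image p) \<in> Tabl \<rightarrow> Tabl" "map (image (inv' p)) \<in> Tabl \<rightarrow> Tabl"
    using tableau_comp p permutes_inv[OF p] by (auto simp: map_image_tabloid)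
qed (simp_all only: map_image_inv[OF p])

lemma phi_basis_relabel:
  assumes p: "p permutes S" and x: "x \<in> BP"
  shows "phi_basis (map_btree p x) = push (map (image p)) (phi_basis x)"
proof (rule plin_eqI)
  fix l
  have "plin l (phi_basis (map_btree p x)) = (\<Sum>T\<in>Tabl. chi (map (image p) T) (map_btree p x) / comb_value * l (map (image p) T))"
    unfolding plin_phi_basis by (rule sum.reindex_bij_betw[OF image_inj_Tabl[OF p], symmetric])
  also have "\<dots> = plin l (push (map (image p)) (phi_basis x))"
    unfolding plin_push plin_phi_basis
    by (intro sum.cong refl) (simp only: chi_relabel[OF _ p BP_letters[OF x]])
  finally show "plin l (phi_basis (map_btree p x)) = plin l (push (map (image p)) (phi_basis x))" .
qed

lemma phi_relabel:
  assumes p: "p permutes S" and x: "keys x \<subseteq> BP"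
  shows "phi (push (map_btree p) x) = push (map (image p)) (phi x)"
  unfolding phi_def pext_push push_pext
  using x by (intro pext_cong phi_basis_relabel[OF p]) auto

lemma polytabloid_eq:
  "t \<in> tabs \<Longrightarrow> polytabloid lam t = (\<Sum>p\<in>col_stab t. Poly_Mapping.single (tabloid lam (p \<circ> t)) (of_int (sign p)))"
  by (simp add: polytabloid_def column_stabilizer_eq)

text \<open>Both coefficients at \<open>T\<close> are settled by
  \<open>column_row_dichotomy\<close>. Either one column permutation \<open>p\<close> carries
  \<open>t\<close> to \<open>T\<close>, and both equal the sign of \<open>p\<close>; or two letters
  share a column of \<open>t\<close> and a row of \<open>T\<close>, and both vanish.\<close>

lemma phi_tcomb:
  assumes t: "t \<in> tabs"
  shows "phi_basis (tcomb t) = polytabloid lam t"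
proof (rule poly_mapping_eqI)
  fix T
  let ?C = "col_stab t"
  have lk: "lookup (polytabloid lam t) T = (\<Sum>p\<in>?C. if tabloid lam (p \<circ> t) = T then of_int (sign p) else 0)"
    by (simp add: polytabloid_eq[OF t] lookup_sum lookup_single when_def)
  have pt: "p \<circ> t \<in> tabs" if "p \<in> ?C" for p using tableau_comp[OF t] col_stab_permutes[OF that] by blast
  have col_inv: "colt t (inv' p a) = colt t a" if "p \<in> ?C" "a \<in> S" for p a
  proof -
    have p: "p permutes S" by (rule col_stab_permutes[OF that(1)])
    have "inv' p a \<in> S" using that permutes_in_image[OF permutes_inv[OF p]] by simp
    then have "colt t (p (inv' p a)) = colt t (inv' p a)" using that(1) by (simp add: col_stab_def label_perms_def)
    then show ?thesis by (simp add: permutes_inverses(1)[OF p])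
  qed
  show "lookup (phi_basis (tcomb t)) T = lookup (polytabloid lam t) T"
  proof (cases "T \<in> Tabl")
    case False
    then have "tabloid lam (p \<circ> t) \<noteq> T" if "p \<in> ?C" for p using pt[OF that] by blast
    then show ?thesis using False by (simp add: lookup_phi_basis lk)
  next
    case True
    then obtain u where u: "u \<in> tabs" "T = tabloid lam u" by auto
    from column_row_dichotomy[OF t u(1)] show ?thesis
    proof
      assume "\<exists>p\<in>?C. tabloid lam (p \<circ> t) = tabloid lam u"
      then obtain p where p: "p \<in> ?C" "tabloid lam (p \<circ> t) = T" using u by auto
      have pp: "p permutes S" by (rule col_stab_permutes[OF p(1)])
      \<comment> \<open>The column of a preimage is fixed by the column stabilizer and its row by
        \<open>T\<close>, so its cell is determined.\<close>
      have uniq: "q = p" if q: "q \<in> ?C" "tabloid lam (q \<circ> t) = T" for q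
      proof -
        have qp: "q permutes S" by (rule col_stab_permutes[OF q(1)])
        have "inv' q a = inv' p a" if a: "a \<in> S" for a
        proof -
          have "rowt (q \<circ> t) a = rowt (p \<circ> t) a"
            using tabloid_eq_iff[OF pt[OF p(1)] pt[OF q(1)]] p q a by metis
          then have "rowt t (inv' q a) = rowt t (inv' p a)"
            by (simp only: pos_comp[OF t pp a] pos_comp[OF t qp a])
          moreover have "colt t (inv' q a) = colt t (inv' p a)" using col_inv p q a by simp
          ultimately have "pos t (inv' q a) = pos t (inv' p a)" by (rule prod_eqI)
          moreover have "inv' q a \<in> S" "inv' p a \<in> S"
            using a permutes_in_image[OF permutes_inv[OF qp]] permutes_in_image[OF permutes_inv[OF pp]] by simp_all
          ultimately show ?thesis using tableau_pos[OF t] by metis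
        qed
        moreover have "inv' q a = inv' p a" if "a \<notin> S" for a
          using that permutes_not_in[OF permutes_inv[OF qp]] permutes_not_in[OF permutes_inv[OF pp]] by simp
        ultimately have "\<And>a. inv' q a = inv' p a" by blast
        then have "inv' q = inv' p" by (rule ext)
        then have "inv' (inv' q) = inv' (inv' p)" by (rule arg_cong)
        then show ?thesis by (simp only: permutes_inv_inv[OF qp] permutes_inv_inv[OF pp])
      qed
      have "lookup (polytabloid lam t) T = (\<Sum>q\<in>?C. if q = p then of_int (sign p) else 0)"
        unfolding lk
      proof (rule sum.cong[OF refl])
        fix q assume q: "q \<in> ?C"
        have "tabloid lam (q \<circ> t) = T \<longleftrightarrow> q = p" using uniq[OF q] p(2) by blast
        then show "(if tabloid lam (q \<circ> t) = T then of_int (sign q) else (0::complex)) = (if q = p then of_int (sign p) else 0)"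
          by (simp split: if_split)
      qed
      also have "\<dots> = of_int (sign p)" using p(1) finite_col_stab by simp
      finally have R: "lookup (polytabloid lam t) T = of_int (sign p)" .
      have "chi T (tcomb (p \<circ> t)) = comb_value"
        using chi_tabloid[OF pt[OF p(1)], of "tcomb (p \<circ> t)"] letters_tcomb[OF pt[OF p(1)]] eval_last_tcomb[OF pt[OF p(1)]] p(2) by simp
      moreover have "chi T (tcomb (p \<circ> t)) = of_int (sign p) * chi T (tcomb t)"
        by (rule tcomb_col_stab[OF fil_funct_chi t p(1)])
      moreover have "(of_int (sign p) :: complex) * of_int (sign p) = 1" by (metis of_int_1 of_int_mult sign_idempotent)
      ultimately have "chi T (tcomb t) = of_int (sign p) * comb_value" by (metis mult.assoc mult_1)
      then show ?thesis using True R comb_value_nonzero by (simp add: lookup_phi_basis)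
    next
      assume "\<exists>a\<in>S. \<exists>b\<in>S. a \<noteq> b \<and> colt t a = colt t b \<and> rowt u a = rowt u b"
      then obtain a b where ab: "a \<in> S" "b \<in> S" "a \<noteq> b" "colt t a = colt t b" "rowt u a = rowt u b" by blast
      have rs: "Transposition.transpose a b \<in> row_stab u"
        using ab by (auto simp: row_stab_def intro!: label_perms_transpose)
      have "chi T (tcomb t) = 0"
        using tcomb_transpose[OF fil_funct_chi t ab(1-4), of T] chi_row_stab[OF u(1) rs tcomb_bracketed[OF t]] u(2)
        by (simp add: tcomb_comp)
      moreover have "tabloid lam (p \<circ> t) \<noteq> T" if p: "p \<in> ?C" for p
      proof
        assume "tabloid lam (p \<circ> t) = T"
        then have rows: "\<forall>x\<in>S. rowt (p \<circ> t) x = rowt u x" using tabloid_eq_iff[OF u(1) pt[OF p]] u(2) by simp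
        have pp: "p permutes S" by (rule col_stab_permutes[OF p])
        have "rowt t (inv' p a) = rowt t (inv' p b)"
          using rows ab pos_comp[OF t pp] by simp
        moreover have "colt t (inv' p a) = colt t (inv' p b)" using col_inv[OF p] ab by simp
        ultimately have "pos t (inv' p a) = pos t (inv' p b)" by (rule prod_eqI)
        moreover have "inv' p a \<in> S" "inv' p b \<in> S" using ab permutes_in_image[OF permutes_inv[OF pp]] by simp_all
        ultimately have "inv' p a = inv' p b" using tableau_pos[OF t] by metis
        then show False using ab(3) permutes_inverses(1)[OF pp] by metis
      qed
      ultimately show ?thesis using True by (simp add: lookup_phi_basis lk)
    qed
  qed
qed

section \<open>The map back from tabloids to combs\<close>

definition kappa :: complex
  where "kappa = (SOME c. c \<noteq> 0 \<and> (\<forall>U. specht_like t0 U \<longrightarrow> kappa_sum t0 S U = c * U id))"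

lemma kappa: "kappa \<noteq> 0" "specht_like t0 U \<Longrightarrow> kappa_sum t0 S U = kappa * U id"
  using someI_ex[OF kappa_sum_full[OF t0]] unfolding kappa_def[symmetric] by blast+

text \<open>The sum runs over a coset of the row stabilizer of \<open>t0\<close>; it is the row
  symmetrization of the comb of any tableau with tabloid \<open>T\<close>. Being given on all
  tabloids, it involves no choice of coordinates in the Specht module.\<close>

definition psi_basis :: "nat set list \<Rightarrow> nat btree \<Rightarrow>\<^sub>0 complex"
  where "psi_basis T = (\<Sum>p\<in>{p. p permutes S \<and> tabloid lam (p \<circ> t0) = T}. Poly_Mapping.single (tcomb (p \<circ> t0)) (1 / kappa))"

definition psi :: "(nat set list \<Rightarrow>\<^sub>0 complex) \<Rightarrow> nat btree \<Rightarrow>\<^sub>0 complex"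
  where "psi = pext psi_basis"

lemma keys_psi: "keys (psi e) \<subseteq> BP"
  unfolding psi_def psi_basis_def
  using tcomb_bracketed tableau_comp[OF t0] by (intro keys_pext keys_sum_subset) auto

lemma plin_psi_basis:
  "plin l (psi_basis T) = (\<Sum>p\<in>{p. p permutes S \<and> tabloid lam (p \<circ> t0) = T}. l (tcomb (p \<circ> t0))) / kappa"
  by (simp add: psi_basis_def plin_sum sum_divide_distrib)

lemma psi_basis_relabel:
  assumes p: "p permutes S"
  shows "push (map_btree p) (psi_basis T) = psi_basis (map (image p) T)"
proof (rule plin_eqI)
  fix l
  let ?A = "\<lambda>T. {q. q permutes S \<and> tabloid lam (q \<circ> t0) = T}"
  have tc: "tabloid lam (g \<circ> q \<circ> t0) = map (image g) (tabloid lam (q \<circ> t0))" for g q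
    by (simp only: map_image_tabloid comp_assoc)
  have bij: "bij_betw (\<lambda>q. p \<circ> q) (?A T) (?A (map (image p) T))"
  proof (rule bij_betwI[where g = "\<lambda>q. inv' p \<circ> q"])
    show "(\<lambda>q. p \<circ> q) \<in> ?A T \<rightarrow> ?A (map (image p) T)"
      using p by (auto simp only: tc intro: permutes_compose)
    show "(\<lambda>q. inv' p \<circ> q) \<in> ?A (map (image p) T) \<rightarrow> ?A T"
    proof
      fix q assume "q \<in> ?A (map (image p) T)"
      then have q: "q permutes S" "tabloid lam (q \<circ> t0) = map (image p) T" by auto
      have "tabloid lam (inv' p \<circ> q \<circ> t0) = T" unfolding tc q(2) by (rule map_image_inv(1)[OF p])
      then show "inv' p \<circ> q \<in> ?A T" using permutes_compose[OF q(1) permutes_inv[OF p]] by simp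
    qed
  qed (simp_all add: comp_assoc[symmetric] permutes_inv_o[OF p])
  show "plin l (push (map_btree p) (psi_basis T)) = plin l (psi_basis (map (image p) T))"
    unfolding plin_push plin_psi_basis sum.reindex_bij_betw[OF bij, symmetric]
    by (simp add: tcomb_comp[symmetric] comp_assoc)
qed

lemma psi_relabel: "p permutes S \<Longrightarrow> push (map_btree p) (psi e) = psi (push (map (image p)) e)"
  unfolding psi_def pext_push push_pext by (intro pext_cong psi_basis_relabel)

definition ideal_noncombs :: "(nat btree \<Rightarrow>\<^sub>0 complex) set"
  where "ideal_noncombs = {w + y | w y. w \<in> I \<and> keys y \<subseteq> NC}"

lemma pm_subspace_ideal_noncombs: "pm_subspace ideal_noncombs"
  unfolding pm_subspace_def
proof (intro conjI ballI allI)
  note J = pm_subspaceD[OF pm_subspace_ideal[of n S]] and M = pm_subspaceD[OF pm_subspace_keys[of NC]]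
  show "0 \<in> ideal_noncombs"
    unfolding ideal_noncombs_def using J(1) by (intro CollectI exI[of _ 0]) simp
  fix x assume "x \<in> ideal_noncombs"
  then obtain w y where x: "x = w + y" "w \<in> I" "keys y \<subseteq> NC" by (auto simp: ideal_noncombs_def)
  {
    fix x' assume "x' \<in> ideal_noncombs"
    then obtain w' y' where x': "x' = w' + y'" "w' \<in> I" "keys y' \<subseteq> NC" by (auto simp: ideal_noncombs_def)
    show "x + x' \<in> ideal_noncombs"
      unfolding ideal_noncombs_def
      using x x' J(2)[of w w'] M(2)[of y y'] by (intro CollectI exI[of _ "w + w'"] exI[of _ "y + y'"]) (simp add: add_ac)
  }
  show "scl c x \<in> ideal_noncombs" for c
    unfolding ideal_noncombs_def
    using x J(3)[of w c] M(3)[of y c] by (intro CollectI exI[of _ "scl c w"] exI[of _ "scl c y"]) (simp add: scl_distribs(1))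
qed

lemma kills_ideal_noncombs:
  assumes "kills L ideal_noncombs"
  shows "comb_funct n S (mset_set S) L" "x \<in> NC \<Longrightarrow> L x = 0"
proof -
  have "w \<in> ideal_noncombs" if "w \<in> I" for w
    unfolding ideal_noncombs_def using that by (intro CollectI exI[of _ w] exI[of _ 0]) simp
  then have LI: "fil_funct n S L" using assms by (auto simp: kills_def)
  show nc: "L x = 0" if "x \<in> NC" for x
  proof -
    have "basis_vec x \<in> ideal_noncombs"
      unfolding ideal_noncombs_def using that pm_subspaceD(1)[OF pm_subspace_ideal[of n S]]
      by (intro CollectI exI[of _ 0] exI[of _ "basis_vec x"]) simp
    from killsD[OF assms this] show ?thesis by simp
  qed
  show "comb_funct n S (mset_set S) L"
    unfolding comb_funct_def
  proof (intro conjI LI ballI impI)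
    fix x assume x: "x \<in> bracketings n S" "noncomb x" "mset (letters x) = mset_set S"
    have "mset (letters x) = mset (sorted_list_of_set S)"
      using x(3) mset_set_set[of "sorted_list_of_set S"] by simp
    then have "distinct (letters x)" "set (letters x) = S"
      using mset_eq_imp_distinct_iff[of "letters x" "sorted_list_of_set S"] mset_eq_setD[of "letters x" "sorted_list_of_set S"] by simp_all
    then show "L x = 0" using x by (intro nc) (simp add: bracketed_permutationsI)
  qed
qed

text \<open>\<open>phi\<close> sums over the column stabilizer and \<open>psi\<close> over cosets of
  the row stabilizer, so together they give the Young symmetrizer, whose constant
  \<open>kappa\<close> is divided out.\<close>

lemma functional_psi_phi_t0:
  assumes L: "comb_funct n S (mset_set S) L"
  shows "plin L (psi (phi_basis (tcomb t0))) = L (tcomb t0)"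
proof -
  let ?A = "\<lambda>T. {q. q permutes S \<and> tabloid lam (q \<circ> t0) = T}"
  have bij: "bij_betw (\<lambda>r. p \<circ> r) (row_stab t0) (?A (tabloid lam (p \<circ> t0)))" if p: "p permutes S" for p
  proof (rule bij_betwI[where g = "\<lambda>q. inv' p \<circ> q"])
    have eq: "r \<in> row_stab t0 \<longleftrightarrow> r permutes S \<and> tabloid lam (r \<circ> t0) = tabloid lam t0" for r
      using tabloid_row_stab[OF t0, of r] by (auto simp: row_stab_def label_perms_def)
    have tc: "tabloid lam (g \<circ> q \<circ> t0) = map (image g) (tabloid lam (q \<circ> t0))" for g q
      by (simp only: map_image_tabloid comp_assoc)
    show "(\<lambda>r. p \<circ> r) \<in> row_stab t0 \<rightarrow> ?A (tabloid lam (p \<circ> t0))"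
    proof
      fix r assume "r \<in> row_stab t0"
      then have r: "r permutes S" "tabloid lam (r \<circ> t0) = tabloid lam t0" by (auto simp only: eq)
      have "tabloid lam (p \<circ> r \<circ> t0) = tabloid lam (p \<circ> t0)" unfolding tc r(2) by (rule map_image_tabloid)
      then show "p \<circ> r \<in> ?A (tabloid lam (p \<circ> t0))" using permutes_compose[OF r(1) p] by simp
    qed
    show "(\<lambda>q. inv' p \<circ> q) \<in> ?A (tabloid lam (p \<circ> t0)) \<rightarrow> row_stab t0"
    proof
      fix q assume q: "q \<in> ?A (tabloid lam (p \<circ> t0))"
      have "tabloid lam (inv' p \<circ> q \<circ> t0) = map (image (inv' p)) (map (image p) (tabloid lam t0))"
        unfolding tc using q by (simp only: map_image_tabloid mem_Collect_eq)
      also have "\<dots> = tabloid lam t0" by (rule map_image_inv(1)[OF p])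
      finally show "inv' p \<circ> q \<in> row_stab t0"
        using q permutes_compose[OF _ permutes_inv[OF p], of q] by (simp add: eq)
    qed
  qed (simp_all add: comp_assoc[symmetric] permutes_inv_o[OF p])
  have "plin L (psi (phi_basis (tcomb t0))) = plin (\<lambda>T. plin L (psi_basis T)) (polytabloid lam t0)"
    by (simp add: psi_def plin_pext phi_tcomb[OF t0])
  also have "\<dots> = (\<Sum>p\<in>col_stab t0. of_int (sign p) * ((\<Sum>q\<in>?A (tabloid lam (p \<circ> t0)). L (tcomb (q \<circ> t0))) / kappa))"
    by (simp add: polytabloid_eq[OF t0] plin_sum plin_psi_basis)
  also have "\<dots> = (\<Sum>p\<in>col_stab t0. \<Sum>r\<in>row_stab t0. of_int (sign p) * L (tcomb (p \<circ> r \<circ> t0))) / kappa"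
    unfolding sum_divide_distrib
    by (intro sum.cong refl)
      (simp add: sum.reindex_bij_betw[OF bij, symmetric] col_stab_permutes sum_distrib_left sum_divide_distrib)
  also have "\<dots> = kappa_sum t0 S (\<lambda>g. L (tcomb (g \<circ> t0))) / kappa"
    by (simp add: kappa_sum_def row_stab_def)
  also have "\<dots> = L (tcomb t0)"
    using kappa specht_like_tcomb[OF L t0] by simp
  finally show ?thesis .
qed

lemma comb_funct_relabel:
  assumes L: "comb_funct n S (mset_set S) L" and p: "p permutes S"
  shows "comb_funct n S (mset_set S) (\<lambda>x. L (map_btree p x))"
  unfolding comb_funct_def
proof (intro conjI ballI impI)
  show "fil_funct n S (\<lambda>x. L (map_btree p x))"
    using L permutes_image[OF p] by (intro fil_funct_relabel) (auto simp: comb_funct_def)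
  fix x assume x: "x \<in> bracketings n S" "noncomb x" "mset (letters x) = mset_set S"
  have "mset (letters (map_btree p x)) = image_mset p (mset_set S)" using x(3) by (simp add: letters_map_btree)
  also have "\<dots> = mset_set S"
    using permutes_image[OF p] inj_on_subset[OF permutes_inj[OF p] subset_UNIV] by (simp add: image_mset_mset_set)
  finally show "L (map_btree p x) = 0"
    using L x permutes_image[OF p] bracketings_map_btree[OF x(1), of p S] by (auto simp: comb_funct_def noncomb_relabel)
qed

text \<open>By separation it suffices to compare \<open>L\<close> with its composite
  \<open>L'\<close> with \<open>psi\<close> and \<open>phi\<close>. Both vanish on the ideal and on
  non-combs, and on combs equivariance reduces the comparison to \<open>t0\<close>.\<close>

lemma psi_phi:
  assumes x: "keys x \<subseteq> BP"
  shows "x - psi (phi x) \<in> ideal_noncombs"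
proof (rule separation[OF pm_subspace_ideal_noncombs])
  fix L assume kL: "kills L ideal_noncombs"
  note L = kills_ideal_noncombs[OF kL]
  define L' where "L' y = plin L (psi (phi_basis y))" for y
  have L'p: "plin L' y = plin L (psi (phi y))" for y
    unfolding L'_def phi_def psi_def plin_pext ..
  have fL': "fil_funct n S L'"
    unfolding kills_def L'p by (simp add: phi_ideal psi_def)
  have "L' y = L y" if y: "y \<in> BP" for y
  proof (cases "noncomb y")
    case True
    then show ?thesis using y L(2) phi_noncomb by (simp add: L'_def psi_def)
  next
    case False
    obtain c s where c: "s \<in> tabs" "\<forall>L. fil_funct n S L \<longrightarrow> L y = c * L (tcomb s)"
      using bracketed_comb[OF y False] by blast
    obtain g where g: "g permutes S" "\<forall>x\<in>D. g (t0 x) = s x" using tableaux_transitive[OF t0 c(1)] by blast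
    have s: "tcomb s = map_btree g (tcomb t0)"
      unfolding tcomb_comp[symmetric] using g by (intro tcomb_cong) simp
    have "L' (tcomb s) = plin L (push (map_btree g) (psi (phi_basis (tcomb t0))))"
      unfolding L'_def s phi_basis_relabel[OF g(1) tcomb_bracketed[OF t0]] psi_relabel[OF g(1)] ..
    also have "\<dots> = L (tcomb s)"
      unfolding plin_push s by (rule functional_psi_phi_t0[OF comb_funct_relabel[OF L(1) g(1)]])
    finally have "L' (tcomb s) = L (tcomb s)" .
    moreover have "L' y = c * L' (tcomb s)" "L y = c * L (tcomb s)"
      using c(2) fL' L(1) unfolding comb_funct_def by blast+
    ultimately show ?thesis by simp
  qed
  then have "plin L' x = plin L x" using x by (intro plin_cong) auto
  then show "plin L (x - psi (phi x)) = 0" by (simp add: plin_diff L'p)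
qed

end

section \<open>The decomposition\<close>

lemma rep_sum_simps:
  "carrier (space (rep_sum V W)) = carrier (space V) \<times> carrier (space W)"
  "add (space (rep_sum V W)) (a, b) (c, d) = (add (space V) a c, add (space W) b d)"
  "module.smult (space (rep_sum V W)) z (a, b) = (module.smult (space V) z a, module.smult (space W) z b)"
  "act (rep_sum V W) p (a, b) = (act V p a, act W p b)"
  by (simp_all add: rep_sum_def direct_sum_def)

context hook_shape
begin

lemma phi_add: "phi (x + y) = phi x + phi y" and phi_diff: "phi (x - y) = phi x - phi y"
  and phi_scl: "phi (scl c x) = scl c (phi x)" and phi_single: "phi (basis_vec a) = phi_basis a"
  unfolding phi_def by (simp_all add: pext_add pext_diff pext_scl scl_distribs(4))

lemma psi_add: "psi (x + y) = psi x + psi y"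
  and psi_scl: "psi (scl c x) = scl c (psi x)"
  unfolding psi_def by (simp_all add: pext_add pext_diff pext_scl)

definition specht_set :: "(nat set list \<Rightarrow>\<^sub>0 complex) set"
  where "specht_set = pm.span (polytabloid lam ` tabs)"

lemma keys_polytabloid: "t \<in> tabs \<Longrightarrow> keys (polytabloid lam t) \<subseteq> Tabl"
  using tableau_comp col_stab_permutes unfolding polytabloid_eq by (intro keys_sum_subset) auto

lemma pm_subspace_specht: "pm_subspace specht_set"
  unfolding specht_set_def by (rule pm_subspace_span)

lemma phi_in_specht:
  assumes "keys x \<subseteq> BP"
  shows "phi x \<in> specht_set"
  unfolding phi_def
proof (rule pm_subspace_pext[OF pm_subspace_specht])
  fix y assume "y \<in> keys x"
  then have y: "y \<in> BP" using assms by auto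
  show "phi_basis y \<in> specht_set"
  proof (cases "noncomb y")
    case True
    then show ?thesis using y phi_noncomb pm_subspaceD(1)[OF pm_subspace_specht] by simp
  next
    case False
    obtain c s where c: "s \<in> tabs" "\<forall>L. fil_funct n S L \<longrightarrow> L y = c * L (tcomb s)"
      using bracketed_comb[OF y False] by blast
    have "phi_basis y = scl c (phi_basis (tcomb s))"
      using c(2) fil_funct_chi by (intro poly_mapping_eqI) (simp add: lookup_phi_basis)
    then show ?thesis
      using c(1) pm_subspaceD(3)[OF pm_subspace_specht]
      by (simp add: phi_tcomb) (auto simp: specht_set_def intro: pm.span_base pm.span_scale)
  qed
qed

lemma specht_eq_phi: "specht_set = phi ` {x. keys x \<subseteq> BP}"
proof
  have "pm_subspace (phi ` {x. keys x \<subseteq> BP})"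
    unfolding pm_subspace_def
  proof (intro conjI ballI allI)
    note M = pm_subspaceD[OF pm_subspace_keys[of BP]]
    show "0 \<in> phi ` {x. keys x \<subseteq> BP}" by (rule image_eqI[of _ _ 0]) (simp_all add: phi_def)
    fix e assume "e \<in> phi ` {x. keys x \<subseteq> BP}"
    then obtain x where x: "e = phi x" "keys x \<subseteq> BP" by auto
    {
      fix e' assume "e' \<in> phi ` {x. keys x \<subseteq> BP}"
      then obtain x' where "e' = phi x'" "keys x' \<subseteq> BP" by auto
      then show "e + e' \<in> phi ` {x. keys x \<subseteq> BP}"
        using x M(2)[of x x'] by (intro image_eqI[of _ _ "x + x'"]) (simp_all add: phi_add)
    }
    show "scl c e \<in> phi ` {x. keys x \<subseteq> BP}" for c
      using x M(3)[of x c] by (intro image_eqI[of _ _ "scl c x"]) (simp_all add: phi_scl)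
  qed
  moreover have "polytabloid lam ` tabs \<subseteq> phi ` {x. keys x \<subseteq> BP}"
  proof
    fix e assume "e \<in> polytabloid lam ` tabs"
    then obtain t where "t \<in> tabs" "e = polytabloid lam t" by auto
    then show "e \<in> phi ` {x. keys x \<subseteq> BP}"
      using tcomb_bracketed by (intro image_eqI[of _ _ "basis_vec (tcomb t)"]) (simp_all add: phi_single phi_tcomb)
  qed
  ultimately show "specht_set \<subseteq> phi ` {x. keys x \<subseteq> BP}"
    unfolding specht_set_def by (intro pm_span_minimal)
qed (use phi_in_specht in auto)

text \<open>\<open>phi\<close> is onto the Specht module and kills the difference in
  \<open>psi_phi\<close>, so applying it to that difference for a preimage gives the claim.\<close>

lemma phi_psi:
  assumes "e \<in> specht_set"
  shows "phi (psi e) = e"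
proof -
  obtain x where x: "e = phi x" "keys x \<subseteq> BP" using assms specht_eq_phi by auto
  obtain w y where wy: "x - psi (phi x) = w + y" "w \<in> I" "keys y \<subseteq> NC"
    using psi_phi[OF x(2)] by (auto simp: ideal_noncombs_def)
  have "phi (x - psi (phi x)) = 0"
    using phi_ideal[OF wy(2)] phi_noncombs[OF wy(3)] by (simp add: wy(1) phi_add)
  then show ?thesis using x by (simp add: phi_diff)
qed

subsection \<open>The representations\<close>

abbreviation "cs \<equiv> pm_coset I"

lemma tabloid_space: "space (tabloid_rep lam) = free_space Tabl"
  by (simp add: tabloid_rep_def)

lemma specht_simps:
  "carrier (space (specht lam)) = specht_set" "act (specht lam) p = push (map (image p))"
  "add (space (specht lam)) = (+)" "module.smult (space (specht lam)) = scl" "zero (space (specht lam)) = 0"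
proof -
  have "vspan (free_space Tabl) (polytabloid lam ` tabs) = specht_set"
    unfolding specht_set_def using keys_polytabloid by (intro vspan_free_space) auto
  then show "carrier (space (specht lam)) = specht_set"
    by (simp add: specht_def Let_def tabloid_space)
qed (simp_all add: specht_def Let_def tabloid_space, simp add: tabloid_rep_def)

lemma sub_ideal: "pm_subspace I"
  by (rule pm_subspace_ideal)

lemma bracketing_span_simps:
  assumes T: "T \<subseteq> BP"
  shows "carrier (space (bracketing_span n k T)) = cs ` {x. keys x \<subseteq> T}"
    "add (space (bracketing_span n k T)) (cs x) (cs y) = cs (x + y)"
    "module.smult (space (bracketing_span n k T)) c (cs x) = cs (scl c x)"
    "zero (space (bracketing_span n k T)) = cs 0"
proof -
  have F: "free_filippov n S = quotient_space (free_space (bracketings n S)) I"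
    by (simp add: free_filippov_def)
  have "bracketing_class n S ` T = cs ` basis_vec ` T"
    by (simp add: bracketing_class_def[abs_def] a_r_coset_free image_image)
  moreover have "T \<subseteq> bracketings n S" using T bracketed_permutationsD by blast
  ultimately have "vspan (free_filippov n S) (bracketing_class n S ` T) = cs ` {x. keys x \<subseteq> T}"
    unfolding F using vspan_quotient_space[OF sub_ideal] by simp
  then show "carrier (space (bracketing_span n k T)) = cs ` {x. keys x \<subseteq> T}"
    by (simp add: bracketing_span_def Let_def letters_set_def)
qed (simp_all add: bracketing_span_def Let_def free_filippov_def letters_set_def[symmetric] quotient_space_simps[OF sub_ideal] del: One_nat_def)

lemma act_bracketing_span:
  assumes p: "p permutes S"
  shows "act (bracketing_span n k T) p (cs x) = cs (push (map_btree p) x)"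
proof -
  let ?h = "push (map_btree p)" and ?g = "push (map_btree (inv' p))"
  have gh: "?g (?h y) = y" "?h (?g y) = y" for y
    using permutes_inv_o[OF p] by (simp_all add: push_push btree.map_comp[symmetric] comp_def[of "map_btree _"] btree.map_comp btree.map_id0 btree.map_id)
  have "?h ` cs x = cs (?h x)"
  proof (intro equalityI subsetI)
    fix z assume "z \<in> ?h ` cs x"
    then obtain y where y: "z = ?h y" "y - x \<in> I" by (auto simp: mem_pm_coset)
    have "?h (y - x) \<in> I" using push_ideal[OF y(2)] permutes_image[OF p] by auto
    then show "z \<in> cs (?h x)" by (simp add: y(1) mem_pm_coset push_linear)
  next
    fix z assume "z \<in> cs (?h x)"
    then have "?g (z - ?h x) \<in> I"
      using push_ideal[of "z - ?h x" n S "inv' p"] permutes_image[OF permutes_inv[OF p]] by (simp add: mem_pm_coset)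
    then have "?g z \<in> cs x" by (simp add: mem_pm_coset push_linear gh)
    then show "z \<in> ?h ` cs x" by (intro image_eqI[of _ _ "?g z"]) (simp_all add: gh)
  qed
  then show ?thesis by (simp add: bracketing_span_def Let_def)
qed

lemma NC_BP: "NC \<subseteq> BP" by auto

lemmas rho_simps = bracketing_span_simps[OF subset_refl, folded rho_def]
lemmas rho_noncomb_simps = bracketing_span_simps[OF NC_BP, folded rho_noncomb_def]
lemmas rho_act = act_bracketing_span[of _ BP, folded rho_def]
lemmas rho_noncomb_act = act_bracketing_span[of _ NC, folded rho_noncomb_def]

lemma keys_relabel: "p permutes S \<Longrightarrow> keys x \<subseteq> BP \<Longrightarrow> keys (push (map_btree p) x) \<subseteq> BP"
  using keys_push[of "map_btree p" x] bracketed_relabel by blast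

lemma sym_group_S: "carrier (sym_group (nletters n k)) = {p. p permutes S}"
  by (simp add: sym_group_def letters_set_def)

lemma cs_eq_iff: "cs x = cs y \<longleftrightarrow> x - y \<in> I"
  by (rule pm_coset_eq_iff[OF sub_ideal])

definition repr :: "(nat btree \<Rightarrow>\<^sub>0 complex) set \<Rightarrow> nat btree \<Rightarrow>\<^sub>0 complex"
  where "repr A = (SOME x. keys x \<subseteq> BP \<and> cs x = A)"

text \<open>The two components are \<open>phi\<close> and the complementary projection, identity
  minus \<open>psi\<close> after \<open>phi\<close>. The choice of representative is harmless
  because \<open>phi\<close> kills the ideal.\<close>

definition split_map :: "(nat btree \<Rightarrow>\<^sub>0 complex) set \<Rightarrow> (nat set list \<Rightarrow>\<^sub>0 complex) \<times> (nat btree \<Rightarrow>\<^sub>0 complex) set"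
  where "split_map A = (phi (repr A), cs (repr A - psi (phi (repr A))))"

lemma split_map_cs:
  assumes x: "keys x \<subseteq> BP"
  shows "split_map (cs x) = (phi x, cs (x - psi (phi x)))"
proof -
  have r: "keys (repr (cs x)) \<subseteq> BP \<and> cs (repr (cs x)) = cs x"
    unfolding repr_def by (rule someI[of _ x]) (simp add: x)
  then have d: "repr (cs x) - x \<in> I" by (simp add: cs_eq_iff)
  have p: "phi (repr (cs x)) = phi x" using phi_ideal[OF d] by (simp add: phi_diff)
  show ?thesis unfolding split_map_def p using d by (simp add: cs_eq_iff)
qed

lemma cs_remainder:
  assumes "keys x \<subseteq> BP"
  shows "cs (x - psi (phi x)) \<in> cs ` {y. keys y \<subseteq> NC}"
proof -
  obtain w y where wy: "x - psi (phi x) = w + y" "w \<in> I" "keys y \<subseteq> NC"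
    using psi_phi[OF assms] by (auto simp: ideal_noncombs_def)
  have "cs (x - psi (phi x)) = cs y" unfolding cs_eq_iff wy(1) using wy(2) by simp
  then show ?thesis using wy(3) by auto
qed

lemma specht_decomposition:
  "rep_iso (sym_group (nletters n k)) (rho n k) (rep_sum (specht lam) (rho_noncomb n k))"
  unfolding rep_iso_def
proof (rule bexI[of _ split_map])
  note M = pm_subspaceD[OF pm_subspace_keys[of BP]]
  show "split_map \<in> rep_hom (sym_group (nletters n k)) (rho n k) (rep_sum (specht lam) (rho_noncomb n k))"
    unfolding rep_hom_def LinearCombinations.module_hom_def
  proof (intro CollectI conjI allI impI ballI)
    show "split_map \<in> carrier (space (rho n k)) \<rightarrow> carrier (space (rep_sum (specht lam) (rho_noncomb n k)))"
      unfolding rep_sum_simps specht_simps rho_simps rho_noncomb_simps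
      using phi_in_specht cs_remainder by (auto simp: split_map_cs)
  next
    fix A B assume "A \<in> carrier (space (rho n k)) \<and> B \<in> carrier (space (rho n k))"
    then obtain x y where x: "keys x \<subseteq> BP" "A = cs x" and y: "keys y \<subseteq> BP" "B = cs y"
      unfolding rho_simps by auto
    show "split_map (A \<oplus>\<^bsub>space (rho n k)\<^esub> B) =
      split_map A \<oplus>\<^bsub>space (rep_sum (specht lam) (rho_noncomb n k))\<^esub> split_map B"
      using M(2)[OF _ _, of x y] x y
      by (simp add: rho_simps split_map_cs rep_sum_simps specht_simps rho_noncomb_simps phi_add psi_add algebra_simps)
  next
    fix c A assume "c \<in> carrier (class_ring :: complex ring) \<and> A \<in> carrier (space (rho n k))"
    then obtain x where x: "keys x \<subseteq> BP" "A = cs x" unfolding rho_simps by auto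
    show "split_map (c \<odot>\<^bsub>space (rho n k)\<^esub> A) = c \<odot>\<^bsub>space (rep_sum (specht lam) (rho_noncomb n k))\<^esub> split_map A"
      using M(3)[of x c] x
      by (simp add: rho_simps split_map_cs rep_sum_simps specht_simps rho_noncomb_simps phi_scl psi_scl scl_distribs(5))
  next
    fix p A assume "p \<in> carrier (sym_group (nletters n k))" "A \<in> carrier (space (rho n k))"
    then obtain x where p: "p permutes S" and x: "keys x \<subseteq> BP" "A = cs x"
      unfolding rho_simps sym_group_S by auto
    show "split_map (act (rho n k) p A) = act (rep_sum (specht lam) (rho_noncomb n k)) p (split_map A)"
      unfolding x(2) rho_act[OF p] split_map_cs[OF x(1)] split_map_cs[OF keys_relabel[OF p x(1)]] rep_sum_simps
        rho_noncomb_act[OF p] specht_simps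
      by (simp add: phi_relabel[OF p x(1)] psi_relabel[OF p] push_linear)
  qed
  show "bij_betw split_map (carrier (space (rho n k))) (carrier (space (rep_sum (specht lam) (rho_noncomb n k))))"
    unfolding bij_betw_def
  proof
    show "inj_on split_map (carrier (space (rho n k)))"
    proof (rule inj_onI)
      fix A B assume "A \<in> carrier (space (rho n k))" "B \<in> carrier (space (rho n k))" and eq: "split_map A = split_map B"
      then obtain x y where x: "keys x \<subseteq> BP" "A = cs x" and y: "keys y \<subseteq> BP" "B = cs y"
        unfolding rho_simps by auto
      have "phi x = phi y" "cs (x - psi (phi x)) = cs (y - psi (phi y))"
        using eq unfolding x(2) y(2) split_map_cs[OF x(1)] split_map_cs[OF y(1)] by blast+
      then show "A = B" using x y by (simp add: cs_eq_iff)
    qed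
    show "split_map ` carrier (space (rho n k)) = carrier (space (rep_sum (specht lam) (rho_noncomb n k)))"
    proof
      show "split_map ` carrier (space (rho n k)) \<subseteq> carrier (space (rep_sum (specht lam) (rho_noncomb n k)))"
        unfolding rep_sum_simps specht_simps rho_simps rho_noncomb_simps
        using phi_in_specht cs_remainder by (auto simp: split_map_cs)
      show "carrier (space (rep_sum (specht lam) (rho_noncomb n k))) \<subseteq> split_map ` carrier (space (rho n k))"
      proof
        fix z assume "z \<in> carrier (space (rep_sum (specht lam) (rho_noncomb n k)))"
        then obtain e y where z: "z = (e, cs y)" "e \<in> specht_set" "keys y \<subseteq> NC"
          unfolding rep_sum_simps specht_simps rho_noncomb_simps by auto
        \<comment> \<open>\<open>psi e + y\<close> is the preimage: \<open>phi\<close> undoes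
          \<open>psi\<close> on the Specht module and kills the non-comb part
          \<open>y\<close>.\<close>
        have kx: "keys (psi e + y) \<subseteq> BP"
          using M(2)[of "psi e" y] keys_psi[of e] z(3) by auto
        have "phi (psi e + y) = e" using phi_psi[OF z(2)] phi_noncombs[OF z(3)] by (simp add: phi_add)
        then have "split_map (cs (psi e + y)) = z" unfolding split_map_cs[OF kx] z(1) by simp
        then show "z \<in> split_map ` carrier (space (rho n k))" using kx unfolding rho_simps by blast
      qed
    qed
  qed
qed

section \<open>Embedding of the Specht module and multiplicity one\<close>

lemma rep_copies_simps:
  "carrier (space (rep_copies d (specht lam))) = {..<d} \<rightarrow>\<^sub>E specht_set"
  "add (space (rep_copies d (specht lam))) u v = (\<lambda>i\<in>{..<d}. u i + v i)"
  "module.smult (space (rep_copies d (specht lam))) c v = (\<lambda>i\<in>{..<d}. scl c (v i))"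
  "act (rep_copies d (specht lam)) p v = (\<lambda>i\<in>{..<d}. push (map (image p)) (v i))"
  by (simp_all add: rep_copies_def specht_simps)

text \<open>\<open>phi\<close> is a left inverse of \<open>psi\<close> on the Specht module and
  kills the ideal, so \<open>psi\<close> stays injective modulo the ideal.\<close>

lemma specht_embeds: "rep_embeds (sym_group (nletters n k)) (rep_copies 1 (specht lam)) (rho n k)"
  unfolding rep_embeds_def
proof (rule bexI[of _ "\<lambda>v. cs (psi (v 0))"])
  show "(\<lambda>v. cs (psi (v 0))) \<in> rep_hom (sym_group (nletters n k)) (rep_copies 1 (specht lam)) (rho n k)"
    unfolding rep_hom_def LinearCombinations.module_hom_def
  proof (intro CollectI conjI allI impI ballI)
    show "(\<lambda>v. cs (psi (v 0))) \<in> carrier (space (rep_copies 1 (specht lam))) \<rightarrow> carrier (space (rho n k))"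
      unfolding rho_simps using keys_psi by auto
  qed (simp_all add: rep_copies_simps rho_simps psi_add psi_scl sym_group_S rho_act psi_relabel)
  show "inj_on (\<lambda>v. cs (psi (v 0))) (carrier (space (rep_copies 1 (specht lam))))"
  proof (rule inj_onI)
    fix u v assume u: "u \<in> carrier (space (rep_copies 1 (specht lam)))" and v: "v \<in> carrier (space (rep_copies 1 (specht lam)))"
      and eq: "cs (psi (u 0)) = cs (psi (v 0))"
    then have "phi (psi (u 0) - psi (v 0)) = 0" by (intro phi_ideal) (simp add: cs_eq_iff)
    moreover have uv: "u \<in> {..<1} \<rightarrow>\<^sub>E specht_set" "v \<in> {..<1} \<rightarrow>\<^sub>E specht_set"
      using u v by (simp_all only: rep_copies_simps)
    moreover have "u 0 \<in> specht_set" "v 0 \<in> specht_set" using uv by (auto dest: PiE_mem)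
    ultimately have "u 0 = v 0" by (simp add: phi_diff phi_psi)
    then show "u = v" by (intro PiE_ext[OF uv]) auto
  qed
qed

text \<open>The row symmetrization of the comb of \<open>t0\<close>; its class spans the vectors of
  \<open>rho n k\<close> that the row stabilizer fixes.\<close>

definition row_vec :: "nat btree \<Rightarrow>\<^sub>0 complex"
  where "row_vec = (\<Sum>r\<in>row_stab t0. basis_vec (tcomb (r \<circ> t0)))"

lemma finite_row_stab: "finite (row_stab t0)"
  unfolding row_stab_def by (rule finite_label_perms) simp

lemma card_row_stab: "card (row_stab t0) > 0"
proof -
  have "id \<in> row_stab t0" by (simp add: row_stab_def label_perms_def permutes_id)
  then show ?thesis using finite_row_stab by (auto simp: card_gt_0_iff)
qed

lemma row_stab_permutes: "r \<in> row_stab t0 \<Longrightarrow> r permutes S"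
  by (simp add: row_stab_def label_perms_def)

lemma sum_row_stab_left:
  assumes q: "q \<in> row_stab t0"
  shows "(\<Sum>r\<in>row_stab t0. F (q \<circ> r)) = sum F (row_stab t0)"
proof (rule sum.reindex_bij_betw)
  have qp: "q permutes S" by (rule row_stab_permutes[OF q])
  have "tabloid lam (q \<circ> t0) = tabloid lam t0" using tabloid_row_stab[OF t0 qp] q by blast
  then have "tabloid lam (inv' q \<circ> t0) = map (image (inv' q)) (tabloid lam (q \<circ> t0))"
    by (simp only: map_image_tabloid)
  also have "\<dots> = map (image (inv' q)) (map (image q) (tabloid lam t0))" by (simp only: map_image_tabloid)
  also have "\<dots> = tabloid lam t0" by (rule map_image_inv(1)[OF qp])
  finally have iq: "inv' q \<in> row_stab t0" using tabloid_row_stab[OF t0 permutes_inv[OF qp]] by simp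
  show "bij_betw (\<lambda>r. q \<circ> r) (row_stab t0) (row_stab t0)"
  proof (rule bij_betwI[where g = "\<lambda>r. inv' q \<circ> r"])
    show "(\<lambda>r. q \<circ> r) \<in> row_stab t0 \<rightarrow> row_stab t0" "(\<lambda>r. inv' q \<circ> r) \<in> row_stab t0 \<rightarrow> row_stab t0"
      using q iq label_perms_comp unfolding row_stab_def by blast+
  qed (simp_all add: comp_assoc[symmetric] permutes_inv_o[OF qp])
qed

lemma keys_row_vec: "keys row_vec \<subseteq> BP"
  unfolding row_vec_def using tcomb_bracketed tableau_comp[OF t0] row_stab_permutes
  by (intro keys_sum_subset) auto

lemma row_vec_invariant:
  assumes "q \<in> row_stab t0"
  shows "push (map_btree q) row_vec = row_vec"
  using sum_row_stab_left[OF assms, of "\<lambda>r. basis_vec (tcomb (r \<circ> t0))"]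
  by (simp add: row_vec_def push_sum tcomb_comp[symmetric] comp_assoc)

text \<open>Its coefficient at the tabloid of \<open>t0\<close> is the order of the row
  stabilizer.\<close>

lemma phi_row_vec_nonzero: "phi row_vec \<noteq> 0"
proof -
  have T0: "tabloid lam t0 \<in> Tabl" using t0 by blast
  have c: "chi (tabloid lam t0) (tcomb (r \<circ> t0)) = comb_value" if r: "r \<in> row_stab t0" for r
    using chi_row_stab[OF t0 r tcomb_bracketed[OF t0]] chi_tabloid[OF t0, of "tcomb t0"] letters_tcomb[OF t0] eval_last_tcomb[OF t0]
    by (simp add: tcomb_comp)
  have "lookup (phi row_vec) (tabloid lam t0) = of_nat (card (row_stab t0))"
    using T0 comb_value_nonzero by (simp add: lookup_phi row_vec_def plin_sum c)
  then show ?thesis using card_row_stab by (metis lookup_zero of_nat_eq_0_iff less_irrefl)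
qed

text \<open>On a row-invariant vector a functional may be replaced by its average over the row
  stabilizer, and \<open>row_invariant_functional\<close> makes that average proportional to one
  evaluation. The factor \<open>b\<close> is read off from this evaluation and is thus the same for
  all functionals.\<close>

lemma row_invariant_multiple:
  assumes x: "keys x \<subseteq> BP" and inv: "\<And>r. r \<in> row_stab t0 \<Longrightarrow> push (map_btree r) x - x \<in> I"
  shows "\<exists>b. x - scl b row_vec \<in> I"
proof
  define c :: complex where "c = of_nat (card (row_stab t0))"
  define b where "b = plin (eval_last n (rowt t0)) x / (comb_value * c)"
  have c: "c \<noteq> 0" using card_row_stab by (simp add: c_def)
  show "x - scl b row_vec \<in> I"
  proof (rule separation[OF sub_ideal])
    fix L assume L: "fil_funct n S L"
    \<comment> \<open>The sum over the row stabilizer: it is \<open>c\<close> times \<open>L\<close>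
      on the invariant vector \<open>x\<close>, and its value at \<open>tcomb t0\<close> is
      \<open>L\<close> on \<open>row_vec\<close>.\<close>
    define L' where "L' y = (\<Sum>r\<in>row_stab t0. L (map_btree r y))" for y
    have pL': "plin L' y = (\<Sum>r\<in>row_stab t0. plin L (push (map_btree r) y))" for y
      unfolding L'_def plin_fun_sum plin_push ..
    have fL': "fil_funct n S L'"
      unfolding kills_def
    proof
      fix w assume w: "w \<in> I"
      have "push (map_btree r) w \<in> I" if "r \<in> row_stab t0" for r
        using push_ideal[OF w] permutes_image[OF row_stab_permutes[OF that]] by auto
      then show "plin L' w = 0" unfolding pL' using killsD[OF L] by (intro sum.neutral) auto
    qed
    have iL': "L' (map_btree r y) = L' y" if r: "r \<in> row_stab t0" for r y
    proof -
      have "L' (map_btree r y) = (\<Sum>q\<in>row_stab t0. L (map_btree (q \<circ> r) y))"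
        by (simp add: L'_def btree.map_comp)
      also have "\<dots> = L' y"
        unfolding L'_def row_stab_def by (rule sum_label_perms_right[OF r[unfolded row_stab_def]])
      finally show ?thesis .
    qed
    have "plin L (push (map_btree r) x) = plin L x" if r: "r \<in> row_stab t0" for r
      using killsD[OF L inv[OF r]] by (simp add: plin_diff)
    then have 1: "plin L' x = c * plin L x" unfolding pL' by (simp add: c_def)
    have 2: "L' (tcomb t0) = plin L row_vec"
      by (simp add: L'_def row_vec_def plin_sum tcomb_comp)
    have "plin (\<lambda>y. comb_value * L' y) x = plin (\<lambda>y. L' (tcomb t0) * eval_last n (rowt t0) y) x"
    proof (rule plin_cong)
      fix y assume "y \<in> keys x"
      then have y: "y \<in> BP" using x by auto
      show "comb_value * L' y = L' (tcomb t0) * eval_last n (rowt t0) y"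
        using row_invariant_functional(1)[OF t0 fL' iL' y] by (simp add: mult.commute)
    qed
    then have "comb_value * (c * plin L x) = plin L row_vec * plin (eval_last n (rowt t0)) x"
      by (simp add: plin_fun_mult 1 2)
    then have "plin L x = b * plin L row_vec"
      using c comb_value_nonzero by (simp add: b_def field_simps)
    then show "plin L (x - scl b row_vec) = 0" by (simp add: plin_diff)
  qed
qed

text \<open>The invariant vector \<open>e\<close>, placed in two different copies, has two images
  that are both multiples of the class of \<open>row_vec\<close>. They are linearly dependent,
  against injectivity.\<close>

lemma specht_multiplicity:
  assumes "rep_embeds (sym_group (nletters n k)) (rep_copies d (specht lam)) (rho n k)"
  shows "d \<le> 1"
proof (rule ccontr)
  assume "\<not> d \<le> 1"
  then have d: "0 < d" "1 < d" by auto
  let ?V = "rep_copies d (specht lam)"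
  obtain f where f: "f \<in> rep_hom (sym_group (nletters n k)) ?V (rho n k)" "inj_on f (carrier (space ?V))"
    using assms by (auto simp: rep_embeds_def)
  have fcar: "f v \<in> cs ` {x. keys x \<subseteq> BP}" if "v \<in> carrier (space ?V)" for v
    using f(1) that unfolding rep_hom_def LinearCombinations.module_hom_def rho_simps by auto
  have fadd: "f (u \<oplus>\<^bsub>space ?V\<^esub> v) = f u \<oplus>\<^bsub>space (rho n k)\<^esub> f v" if "u \<in> carrier (space ?V)" "v \<in> carrier (space ?V)" for u v
    using f(1) that unfolding rep_hom_def LinearCombinations.module_hom_def by auto
  have fsc: "f (c \<odot>\<^bsub>space ?V\<^esub> v) = c \<odot>\<^bsub>space (rho n k)\<^esub> f v" if "v \<in> carrier (space ?V)" for c v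
    using f(1) that unfolding rep_hom_def LinearCombinations.module_hom_def by auto
  have fact: "f (act ?V p v) = act (rho n k) p (f v)" if "p permutes S" "v \<in> carrier (space ?V)" for p v
    using f(1) that unfolding rep_hom_def sym_group_S by auto
  define e where "e = phi row_vec"
  have e: "e \<in> specht_set" "e \<noteq> 0" unfolding e_def by (rule phi_in_specht[OF keys_row_vec], rule phi_row_vec_nonzero)
  have zero: "0 \<in> specht_set" by (rule pm_subspaceD(1)[OF pm_subspace_specht])
  have einv: "push (map (image r)) e = e" if "r \<in> row_stab t0" for r
    using phi_relabel[OF row_stab_permutes[OF that] keys_row_vec] row_vec_invariant[OF that] by (simp add: e_def)
  define v where "v i = (\<lambda>j\<in>{..<d}. if j = i then e else 0)" for i :: nat
  have vc: "v i \<in> carrier (space ?V)" for i unfolding rep_copies_simps v_def using e zero by auto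
  have "\<exists>b. f (v i) = cs (scl b row_vec)" for i
  proof -
    obtain x where x: "keys x \<subseteq> BP" "f (v i) = cs x" using fcar[OF vc[of i]] by auto
    have "push (map_btree r) x - x \<in> I" if r: "r \<in> row_stab t0" for r
    proof -
      have "act ?V r (v i) = v i" unfolding rep_copies_simps v_def using einv[OF r] by (auto simp: push_linear)
      then have "cs (push (map_btree r) x) = cs x"
        using fact[OF row_stab_permutes[OF r] vc[of i]] by (simp add: x(2) rho_act[OF row_stab_permutes[OF r]])
      then show ?thesis by (simp add: cs_eq_iff)
    qed
    then obtain b where "x - scl b row_vec \<in> I" using row_invariant_multiple[OF x(1)] by blast
    then show ?thesis using x(2) by (auto simp: cs_eq_iff)
  qed
  then obtain b where b: "f (v i) = cs (scl (b i) row_vec)" for i by metis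
  define lc where "lc a a' = add (space ?V) (module.smult (space ?V) a (v 0)) (module.smult (space ?V) a' (v 1))" for a a'
  have sc: "module.smult (space ?V) a (v i) \<in> carrier (space ?V)" for a i
    unfolding rep_copies_simps v_def using e zero pm_subspaceD(3)[OF pm_subspace_specht] by auto
  have lcc: "lc a a' \<in> carrier (space ?V)" for a a'
    unfolding lc_def rep_copies_simps v_def
    using e zero pm_subspaceD(2,3)[OF pm_subspace_specht] by auto
  have flc: "f (lc a a') = cs (scl (a * b 0 + a' * b 1) row_vec)" for a a'
  proof -
    have "scl (a * b 0 + a' * b 1) row_vec = scl a (scl (b 0) row_vec) + scl a' (scl (b 1) row_vec)"
      by (rule poly_mapping_eqI) (simp add: lookup_add algebra_simps)
    then show ?thesis unfolding lc_def fadd[OF sc sc] fsc[OF vc] b rho_simps by simp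
  qed
  have lc0: "lc a a' 0 = scl a e" and lc1: "lc a a' 1 = scl a' e" for a a'
    using d unfolding lc_def rep_copies_simps v_def by simp_all
  have inj: "a = a2 \<and> a' = a2'" if "a * b 0 + a' * b 1 = a2 * b 0 + a2' * b 1" for a a' a2 a2'
  proof -
    have "f (lc a a') = f (lc a2 a2')" unfolding flc that ..
    then have eq: "lc a a' = lc a2 a2'" using inj_onD[OF f(2)] lcc by blast
    obtain T where "lookup e T \<noteq> 0" using e(2) by (metis lookup_zero poly_mapping_eqI)
    have "scl a e = scl a2 e" "scl a' e = scl a2' e"
      using arg_cong[OF eq, of "\<lambda>v. v 0"] arg_cong[OF eq, of "\<lambda>v. v 1"] by (simp_all only: lc0 lc1)
    then have "lookup (scl a e) T = lookup (scl a2 e) T" "lookup (scl a' e) T = lookup (scl a2' e) T" by (simp_all only:)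
    then show ?thesis using \<open>lookup e T \<noteq> 0\<close> by simp
  qed
  \<comment> \<open>The coefficients \<open>b 1\<close> and \<open>- b 0\<close> give the same image
    as 0 and 0. Once both \<open>b 0\<close> and \<open>b 1\<close> are known to vanish, the
    coefficients 1 and 0 do so too, a contradiction.\<close>
  have "b 1 = 0 \<and> - b 0 = 0" by (rule inj) simp
  then have "(1::complex) = 0 \<and> (0::complex) = 0" by (intro inj) simp
  then show False by simp
qed

lemma noncomb_span_trivial_iff:
  "carrier (space (rho_noncomb n k)) = {\<zero>\<^bsub>space (rho_noncomb n k)\<^esub>} \<longleftrightarrow> k \<in> {1, 2}"
proof
  assume triv: "carrier (space (rho_noncomb n k)) = {\<zero>\<^bsub>space (rho_noncomb n k)\<^esub>}"
  show "k \<in> {1, 2}"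
  proof (rule ccontr)
    assume "k \<notin> {1, 2}"
    then have "k \<ge> 3" using k by auto
    then obtain x r where x: "x \<in> BP" "noncomb x" "alive n (ev r x)" using noncomb_alive[OF n] by blast
    have "cs (basis_vec x) \<in> cs ` {y. keys y \<subseteq> NC}" using x by auto
    then have "cs (basis_vec x) = cs 0" using triv unfolding rho_noncomb_simps by blast
    then have "basis_vec x \<in> I" by (simp add: cs_eq_iff)
    then have "eval_last n r x = 0" using killsD[OF fil_funct_eval_last[where n = n and X = S and r = r]] n by fastforce
    then show False using eval_last_alive[OF _ x(3)] n by simp
  qed
next
  assume k2: "k \<in> {1, 2}"
  have "\<not> noncomb x" if x: "x \<in> BP" for x
  proof
    assume nc: "noncomb x"
    note xx = bracketed_permutationsD[OF x]
    obtain ls ls' where ls: "cherry ls x" "cherry ls' x" "set ls \<inter> set ls' = {}"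
      using noncomb_cherries[OF nc] xx by blast
    have c: "set ls \<union> set ls' \<subseteq> S" "card (set ls) = n" "card (set ls') = n"
      using cherry_letters[OF ls(1) conjunct1[OF xx]] cherry_letters[OF ls(2) conjunct1[OF xx]] xx by (auto simp: distinct_card)
    have "card (set ls \<union> set ls') \<le> card S" using c(1) by (intro card_mono) auto
    then have "2 * n \<le> k * (n - 1) + 1"
      using ls(3) c by (simp add: card_Un_disjoint letters_set_def nletters_def)
    then show False using k2 n by auto
  qed
  then have "NC = {}" by blast
  then show "carrier (space (rho_noncomb n k)) = {\<zero>\<^bsub>space (rho_noncomb n k)\<^esub>}"
    unfolding rho_noncomb_simps by (simp only: subset_empty keys_eq_empty Collect_conv_if) simp
qed

end

theorem theorem3p6:
  fixes n k :: nat
  assumes "k \<ge> 1" and "n \<ge> 2"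
  shows
    "has_multiplicity (sym_group (nletters n k)) (specht (replicate (n - 1) k @ [1])) (rho n k) 1
     \<and> rep_iso (sym_group (nletters n k))
         (rho n k) (rep_sum (specht (replicate (n - 1) k @ [1])) (rho_noncomb n k))
     \<and> (carrier (space (rho_noncomb n k)) = {\<zero>\<^bsub>space (rho_noncomb n k)\<^esub>} \<longleftrightarrow> k \<in> {1, 2})"
proof -
  interpret hook_shape n k by unfold_locales (use assms in auto)
  show ?thesis
    using specht_embeds specht_multiplicity specht_decomposition noncomb_span_trivial_iff
    unfolding has_multiplicity_def lam_def by blast
qed

end
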